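(* Let $\mathcal A=\mathbb Z[p]/(p^3)$ and $\mathcal R=\mathbb Z[p]/(p^2)$. As a left or right $\mathcal A$-module, $\mathcal R$ has a two-periodic free resolution $$\cdots\xrightarrow{\,p\,}\mathcal A\xrightarrow{\,p^2\,}\mathcal A\xrightarrow{\,p\,}\mathcal A\xrightarrow{\,p^2\,}\mathcal A\longrightarrow\mathcal R\longrightarrow0.$$ Let $Z=\mathcal A/(p)\cong\mathbb Z$. Then, for every $n\ge1$, $$\operatorname{Tor}_n^{\mathcal A}(\mathcal R,Z)\cong\mathbb Z,\qquad\operatorname{Ext}^n_{\mathcal A}(\mathcal R,Z)\cong\mathbb Z.$$ With coefficients in $\mathcal R$, for every $j\ge0$, $$\operatorname{Tor}_{2j+1}^{\mathcal A}(\mathcal R,\mathcal R)\cong\mathcal R/p\mathcal R\cong\mathbb Z,\qquad\operatorname{Tor}_{2j+2}^{\mathcal A}(\mathcal R,\mathcal R)\cong p\mathcal R\cong\mathbb Z,$$ $$\operatorname{Ext}^{2j+1}_{\mathcal A}(\mathcal R,\mathcal R)\cong p\mathcal R\cong\mathbb Z,\qquad\operatorname{Ext}^{2j+2}_{\mathcal A}(\mathcal R,\mathcal R)\cong\mathcal R/p\mathcal R\cong\mathbb Z.$$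
   Context: $\mathcal R$ and $Z$ are $\mathcal A$-modules through the natural quotient maps from $\mathcal A$. An arrow labelled $p$ or $p^2$ is multiplication by that element. In the paper these rings arise as the operator ring $\mathcal A=\mathcal A(T,\mathbb Z)$ and the regular operator ring $\mathcal R=\mathcal R_T$ of the ternary $\mathbb Z$-ring $T=\mathbb Ze\oplus\mathbb Zf$ with $[e,e,e]=f$ and all other basis products zero, but the statement concerns only the displayed rings. *)

theory Defs
  imports "HOL-Algebra.Algebra"
begin

section \<open>Modules over a commutative ring\<close>

text \<open>
  The base ring is commutative, so left and right modules coincide. Modules are those of
  \<^theory>\<open>HOL-Algebra.Module\<close>. The fields \<^const>\<open>monoid.mult\<close> and \<^const>\<open>monoid.one\<close>, which a
  module record inherits from the ring record, carry no meaning for a module and are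
  filled in arbitrarily below.
\<close>

definition mod_hom ::
    "('a, 'r) ring_scheme \<Rightarrow> ('a, 'b, 'm) module_scheme \<Rightarrow> ('a, 'c, 'n) module_scheme \<Rightarrow> ('b \<Rightarrow> 'c) set"
  where "mod_hom R M N = {f \<in> carrier M \<rightarrow> carrier N.
     (\<forall>x \<in> carrier M. \<forall>y \<in> carrier M. f (x \<oplus>\<^bsub>M\<^esub> y) = f x \<oplus>\<^bsub>N\<^esub> f y) \<and>
     (\<forall>a \<in> carrier R. \<forall>x \<in> carrier M. f (a \<odot>\<^bsub>M\<^esub> x) = a \<odot>\<^bsub>N\<^esub> f x)}"

definition mod_iso ::
    "('a, 'b, 'm) module_scheme \<Rightarrow> ('a, 'r) ring_scheme \<Rightarrow> ('a, 'c, 'n) module_scheme \<Rightarrow> bool"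
    (\<open>(_ \<cong>\<^bsub>_\<^esub> _)\<close> [61, 0, 61] 60)
  where "M \<cong>\<^bsub>R\<^esub> N \<longleftrightarrow> (\<exists>f \<in> mod_hom R M N. bij_betw f (carrier M) (carrier N))"

definition quot_mod :: "('a, 'b, 'm) module_scheme \<Rightarrow> 'b set \<Rightarrow> ('a, 'b set) module"
  where "quot_mod M H = \<lparr>carrier = a_rcosets\<^bsub>M\<^esub> H, monoid.mult = (\<lambda>U V. H), one = H, ring.zero = H,
     add = set_add M, smult = (\<lambda>a U. \<Union>x\<in>U. H +>\<^bsub>M\<^esub> (a \<odot>\<^bsub>M\<^esub> x))\<rparr>"

definition mod_span :: "('a, 'r) ring_scheme \<Rightarrow> ('a, 'b, 'm) module_scheme \<Rightarrow> 'b set \<Rightarrow> 'b set"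
  where "mod_span R M G = \<Inter>{H. submodule H R M \<and> G \<subseteq> H}"

text \<open>A ring \<open>S\<close> as an \<open>R\<close>-module by way of a ring homomorphism \<open>\<phi>\<close> from \<open>R\<close> to \<open>S\<close>.\<close>

definition hom_module :: "('a \<Rightarrow> 'b) \<Rightarrow> ('b, 's) ring_scheme \<Rightarrow> ('a, 'b) module"
  where "hom_module \<phi> S = \<lparr>carrier = carrier S, monoid.mult = monoid.mult S, one = one S, ring.zero = ring.zero S,
     add = add S, smult = (\<lambda>a x. \<phi> a \<otimes>\<^bsub>S\<^esub> x)\<rparr>"

definition scaled :: "'a \<Rightarrow> ('a, 'b, 'm) module_scheme \<Rightarrow> 'b set"
  where "scaled a M = (\<lambda>x. a \<odot>\<^bsub>M\<^esub> x) ` carrier M"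


section \<open>Free modules and free resolutions\<close>

definition free_mod :: "('a, 'r) ring_scheme \<Rightarrow> 's set \<Rightarrow> ('a, 's \<Rightarrow> 'a) module"
  where "free_mod R S = \<lparr>
     carrier = {c \<in> S \<rightarrow> carrier R. (\<forall>s. s \<notin> S \<longrightarrow> c s = \<zero>\<^bsub>R\<^esub>) \<and> finite {s. c s \<noteq> \<zero>\<^bsub>R\<^esub>}},
     monoid.mult = (\<lambda>c d s. \<zero>\<^bsub>R\<^esub>), one = (\<lambda>s. \<zero>\<^bsub>R\<^esub>), ring.zero = (\<lambda>s. \<zero>\<^bsub>R\<^esub>),
     add = (\<lambda>c d s. c s \<oplus>\<^bsub>R\<^esub> d s), smult = (\<lambda>a c s. a \<otimes>\<^bsub>R\<^esub> c s)\<rparr>"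

definition free_gen :: "('a, 'r) ring_scheme \<Rightarrow> 's \<Rightarrow> 's \<Rightarrow> 'a"
  where "free_gen R s = (\<lambda>t. if t = s then \<one>\<^bsub>R\<^esub> else \<zero>\<^bsub>R\<^esub>)"

text \<open>
  A basis is a subset of the module, so index sets of the module's own element type suffice.
\<close>

definition free_module :: "('a, 'r) ring_scheme \<Rightarrow> ('a, 'b, 'm) module_scheme \<Rightarrow> bool"
  where "free_module R F \<longleftrightarrow> module R F \<and> (\<exists>B :: 'b set. free_mod R B \<cong>\<^bsub>R\<^esub> F)"

text \<open>
  \<open>free_resolution R M F d e\<close>: the sequence
  \<open>\<dots> \<rightarrow> F 2 \<rightarrow> F 1 \<rightarrow> F 0 \<rightarrow> M \<rightarrow> 0\<close>
  is exact with all \<open>F n\<close> free, where \<open>d n\<close> maps \<open>F (Suc n)\<close> to \<open>F n\<close>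
  and \<open>e\<close> maps \<open>F 0\<close> to \<open>M\<close>.
\<close>

definition free_resolution ::
    "('a, 'r) ring_scheme \<Rightarrow> ('a, 'b, 'm) module_scheme \<Rightarrow>
     (nat \<Rightarrow> ('a, 'f) module) \<Rightarrow> (nat \<Rightarrow> 'f \<Rightarrow> 'f) \<Rightarrow> ('f \<Rightarrow> 'b) \<Rightarrow> bool"
  where "free_resolution R M F d e \<longleftrightarrow>
     module R M \<and> (\<forall>n. free_module R (F n)) \<and>
     (\<forall>n. d n \<in> mod_hom R (F (Suc n)) (F n)) \<and> e \<in> mod_hom R (F 0) M \<and>
     e ` carrier (F 0) = carrier M \<and>
     a_kernel (F 0) M e = d 0 ` carrier (F (Suc 0)) \<and>
     (\<forall>n. a_kernel (F (Suc n)) (F n) (d n) = d (Suc n) ` carrier (F (Suc (Suc n))))"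

text \<open>
  The resolution from which Tor and Ext are computed. The type \<open>('a + 'b) list\<close> is large
  enough for every module to have a free resolution with elements in it; see lemma
  \<open>free_resolution_exists\<close> below. Nothing else is known about the resolution chosen, so
  a value of Tor or Ext has to be shown for all free resolutions of this type.
\<close>

definition some_resolution ::
    "('a, 'r) ring_scheme \<Rightarrow> ('a, 'b, 'm) module_scheme \<Rightarrow>
     (nat \<Rightarrow> ('a, ('a + 'b) list) module) \<times>
     (nat \<Rightarrow> ('a + 'b) list \<Rightarrow> ('a + 'b) list) \<times> (('a + 'b) list \<Rightarrow> 'b)"
  where "some_resolution R M = (SOME (F, d, e). free_resolution R M F d e)"


subsection \<open>Existence of free resolutions\<close>

lemma free_mod_simps:
  "carrier (free_mod R S) = {c \<in> S \<rightarrow> carrier R. (\<forall>s. s \<notin> S \<longrightarrow> c s = \<zero>\<^bsub>R\<^esub>) \<and> finite {s. c s \<noteq> \<zero>\<^bsub>R\<^esub>}}"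
  "\<zero>\<^bsub>free_mod R S\<^esub> = (\<lambda>s. \<zero>\<^bsub>R\<^esub>)" "c \<oplus>\<^bsub>free_mod R S\<^esub> c' = (\<lambda>s. c s \<oplus>\<^bsub>R\<^esub> c' s)"
  "a \<odot>\<^bsub>free_mod R S\<^esub> c = (\<lambda>s. a \<otimes>\<^bsub>R\<^esub> c s)"
  by (simp_all add: free_mod_def)

lemma free_mod_coeff:
  assumes "cring R" "c \<in> carrier (free_mod R S)" shows "c s \<in> carrier R"
proof -
  interpret cring R by fact
  show ?thesis using assms(2) by (cases "s \<in> S") (auto simp: free_mod_simps)
qed

lemma free_mod_module:
  assumes "cring R" shows "module R (free_mod R S)"
proof -
  interpret cring R by fact
  have fin: "finite {s. f (c s) (c' s) \<noteq> \<zero>\<^bsub>R\<^esub>}"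
    if "c \<in> carrier (free_mod R S)" "c' \<in> carrier (free_mod R S)" "f \<zero>\<^bsub>R\<^esub> \<zero>\<^bsub>R\<^esub> = \<zero>\<^bsub>R\<^esub>" for c c' and f
    by (rule finite_subset[of _ "{s. c s \<noteq> \<zero>\<^bsub>R\<^esub>} \<union> {s. c' s \<noteq> \<zero>\<^bsub>R\<^esub>}"])
       (use that in \<open>auto simp: free_mod_simps\<close>)
  have add: "c \<oplus>\<^bsub>free_mod R S\<^esub> c' \<in> carrier (free_mod R S)"
    if "c \<in> carrier (free_mod R S)" "c' \<in> carrier (free_mod R S)" for c c'
    using fin[OF that, of "add R"] that by (auto simp: free_mod_simps)
  have sm: "a \<odot>\<^bsub>free_mod R S\<^esub> c \<in> carrier (free_mod R S)"
    if "a \<in> carrier R" "c \<in> carrier (free_mod R S)" for a c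
    using fin[OF that(2) that(2), of "\<lambda>x y. a \<otimes>\<^bsub>R\<^esub> x"] that by (auto simp: free_mod_simps)
  note cf = free_mod_coeff[OF assms]
  show ?thesis
  proof (rule moduleI[OF assms])
    show "abelian_group (free_mod R S)"
    proof (rule abelian_groupI)
      fix c assume c: "c \<in> carrier (free_mod R S)"
      show "\<exists>c'\<in>carrier (free_mod R S). c' \<oplus>\<^bsub>free_mod R S\<^esub> c = \<zero>\<^bsub>free_mod R S\<^esub>"
      proof (rule bexI)
        show "(\<ominus>\<^bsub>R\<^esub> \<one>\<^bsub>R\<^esub>) \<odot>\<^bsub>free_mod R S\<^esub> c \<oplus>\<^bsub>free_mod R S\<^esub> c = \<zero>\<^bsub>free_mod R S\<^esub>"
          using cf[OF c] by (simp add: free_mod_simps l_minus l_neg)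
      qed (use c in \<open>auto intro: sm\<close>)
    next
      show "\<zero>\<^bsub>free_mod R S\<^esub> \<in> carrier (free_mod R S)" by (simp add: free_mod_simps)
    qed (use add in \<open>simp_all add: free_mod_simps(2-) cf a_ac\<close>)
  qed (use sm in \<open>simp_all add: free_mod_simps(2-) cf l_distr r_distr m_assoc\<close>)
qed

lemma free_gen_carrier:
  assumes "cring R" "s \<in> S" shows "free_gen R s \<in> carrier (free_mod R S)"
proof -
  interpret cring R by fact
  have "finite {t. free_gen R s t \<noteq> \<zero>\<^bsub>R\<^esub>}"
    by (rule finite_subset[of _ "{s}"]) (auto simp: free_gen_def)
  then show ?thesis using assms by (auto simp: free_mod_simps free_gen_def)
qed

lemma free_mod_lift:
  assumes "module R M" "g \<in> S \<rightarrow> carrier M"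
  shows "\<exists>h \<in> mod_hom R (free_mod R S) M. \<forall>s\<in>S. h (free_gen R s) = g s"
proof -
  interpret module R M by fact
  let ?P = "free_mod R S"
  note cf = free_mod_coeff[OF R.is_cring]
  define g' where "g' s = (if s \<in> S then g s else \<zero>\<^bsub>M\<^esub>)" for s
  have g': "g' s \<in> carrier M" for s using assms(2) by (auto simp: g'_def)
  define h where "h c = (\<Oplus>\<^bsub>M\<^esub> s\<in>{s. c s \<noteq> \<zero>\<^bsub>R\<^esub>}. c s \<odot>\<^bsub>M\<^esub> g' s)" for c
  have ext: "h c = (\<Oplus>\<^bsub>M\<^esub> s\<in>B. c s \<odot>\<^bsub>M\<^esub> g' s)"
    if "finite B" "{s. c s \<noteq> \<zero>\<^bsub>R\<^esub>} \<subseteq> B" "c \<in> carrier ?P" for c B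
    unfolding h_def
    by (rule M.add.finprod_mono_neutral_cong_left)
       (use that g' cf[OF that(3)] in auto)
  have "h \<in> mod_hom R ?P M"
    unfolding mod_hom_def
  proof (intro CollectI conjI ballI funcsetI)
    fix c assume c: "c \<in> carrier ?P"
    show "h c \<in> carrier M" unfolding h_def
      by (rule M.finsum_closed) (use g' cf[OF c] in auto)
    have finc: "finite {s. c s \<noteq> \<zero>\<^bsub>R\<^esub>}" using c by (auto simp: free_mod_simps)
    { fix c' assume c': "c' \<in> carrier ?P"
      let ?B = "{s. c s \<noteq> \<zero>\<^bsub>R\<^esub>} \<union> {s. c' s \<noteq> \<zero>\<^bsub>R\<^esub>}"
      have fin: "finite ?B" using c c' by (auto simp: free_mod_simps)
      have s: "c \<oplus>\<^bsub>?P\<^esub> c' \<in> carrier ?P"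
        using c c' free_mod_module[OF R.is_cring] by (metis abelian_groupE(1) module_def)
      have "h (c \<oplus>\<^bsub>?P\<^esub> c') = (\<Oplus>\<^bsub>M\<^esub> s\<in>?B. (c s \<oplus>\<^bsub>R\<^esub> c' s) \<odot>\<^bsub>M\<^esub> g' s)"
        by (subst ext[OF fin _ s]) (auto simp: free_mod_simps)
      also have "\<dots> = (\<Oplus>\<^bsub>M\<^esub> s\<in>?B. c s \<odot>\<^bsub>M\<^esub> g' s \<oplus>\<^bsub>M\<^esub> c' s \<odot>\<^bsub>M\<^esub> g' s)"
        by (rule M.finsum_cong) (use g' cf[OF c] cf[OF c'] in \<open>auto simp: smult_l_distr simp_implies_def\<close>)
      also have "\<dots> = (\<Oplus>\<^bsub>M\<^esub> s\<in>?B. c s \<odot>\<^bsub>M\<^esub> g' s) \<oplus>\<^bsub>M\<^esub> (\<Oplus>\<^bsub>M\<^esub> s\<in>?B. c' s \<odot>\<^bsub>M\<^esub> g' s)"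
        by (rule M.finsum_addf) (use g' cf[OF c] cf[OF c'] in auto)
      also have "\<dots> = h c \<oplus>\<^bsub>M\<^esub> h c'"
        by (simp add: ext[OF fin _ c] ext[OF fin _ c'])
      finally show "h (c \<oplus>\<^bsub>?P\<^esub> c') = h c \<oplus>\<^bsub>M\<^esub> h c'" . }
    fix a assume a: "a \<in> carrier R"
    have s: "a \<odot>\<^bsub>?P\<^esub> c \<in> carrier ?P"
      using a c free_mod_module[OF R.is_cring] module.smult_closed by metis
    have "h (a \<odot>\<^bsub>?P\<^esub> c) = (\<Oplus>\<^bsub>M\<^esub> s\<in>{s. c s \<noteq> \<zero>\<^bsub>R\<^esub>}. (a \<otimes>\<^bsub>R\<^esub> c s) \<odot>\<^bsub>M\<^esub> g' s)"
      by (subst ext[OF finc _ s]) (use a in \<open>auto simp: free_mod_simps\<close>)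
    also have "\<dots> = (\<Oplus>\<^bsub>M\<^esub> s\<in>{s. c s \<noteq> \<zero>\<^bsub>R\<^esub>}. a \<odot>\<^bsub>M\<^esub> (c s \<odot>\<^bsub>M\<^esub> g' s))"
      by (rule M.finsum_cong) (use a g' cf[OF c] in \<open>auto simp: smult_assoc1 simp_implies_def\<close>)
    also have "\<dots> = a \<odot>\<^bsub>M\<^esub> h c"
      unfolding h_def by (rule finsum_smult_ldistr[symmetric]) (use a g' cf[OF c] finc in auto)
    finally show "h (a \<odot>\<^bsub>?P\<^esub> c) = a \<odot>\<^bsub>M\<^esub> h c" .
  qed
  moreover have "h (free_gen R s) = g s" if s: "s \<in> S" for s
  proof -
    have "h (free_gen R s) = (\<Oplus>\<^bsub>M\<^esub> t\<in>{s}. free_gen R s t \<odot>\<^bsub>M\<^esub> g' t)"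
      by (rule ext) (auto simp: free_gen_def intro: free_gen_carrier[OF R.is_cring s, unfolded free_gen_def])
    also have "\<dots> = g s"
      using s g'[of s] by (subst M.finsum_insert) (auto simp: free_gen_def g'_def)
    finally show ?thesis .
  qed
  ultimately show ?thesis by blast
qed

lemma mod_hom_compose:
  assumes "f \<in> mod_hom R M N" "g \<in> mod_hom R N P" shows "(\<lambda>x. g (f x)) \<in> mod_hom R M P"
  using assms by (auto simp: mod_hom_def Pi_iff)

lemma mod_hom_kernel_submodule:
  assumes "module R M" "module R N" "f \<in> mod_hom R M N"
  shows "submodule (a_kernel M N f) R M"
proof -
  interpret M: module R M by fact
  interpret N: module R N by fact
  have f: "f x \<in> carrier N" "f (x \<oplus>\<^bsub>M\<^esub> y) = f x \<oplus>\<^bsub>N\<^esub> f y" "f (a \<odot>\<^bsub>M\<^esub> x) = a \<odot>\<^bsub>N\<^esub> f x"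
    if "x \<in> carrier M" "y \<in> carrier M" "a \<in> carrier R" for a x y
    using assms(3) that by (auto simp: mod_hom_def)
  have 0: "f \<zero>\<^bsub>M\<^esub> = \<zero>\<^bsub>N\<^esub>"
    using f(1,3)[of "\<zero>\<^bsub>M\<^esub>" "\<zero>\<^bsub>M\<^esub>" "\<zero>\<^bsub>R\<^esub>"] by simp
  have k: "x \<in> a_kernel M N f \<longleftrightarrow> x \<in> carrier M \<and> f x = \<zero>\<^bsub>N\<^esub>" for x
    by (simp add: a_kernel_def kernel_def)
  have sm: "a \<odot>\<^bsub>M\<^esub> x \<in> a_kernel M N f" if "a \<in> carrier R" "x \<in> a_kernel M N f" for a x
    using that f(3)[of x x a] by (simp add: k)
  show ?thesis
  proof (rule M.submoduleI)
    fix x assume x: "x \<in> a_kernel M N f"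
    have "\<ominus>\<^bsub>M\<^esub> x = (\<ominus>\<^bsub>R\<^esub> \<one>\<^bsub>R\<^esub>) \<odot>\<^bsub>M\<^esub> x" using x by (simp add: k M.smult_l_minus)
    then show "\<ominus>\<^bsub>M\<^esub> x \<in> a_kernel M N f" using sm x by simp
  qed (use f(2)[of _ _ "\<one>\<^bsub>R\<^esub>"] 0 sm in \<open>auto simp: k\<close>)
qed

definition copy_mod :: "('b \<Rightarrow> 'c) \<Rightarrow> ('c \<Rightarrow> 'b) \<Rightarrow> ('a, 'b, 'm) module_scheme \<Rightarrow> ('a, 'c) module"
  where "copy_mod i k M = \<lparr>carrier = i ` carrier M, monoid.mult = (\<lambda>x y. x), one = i \<zero>\<^bsub>M\<^esub>,
     ring.zero = i \<zero>\<^bsub>M\<^esub>, add = (\<lambda>x y. i (k x \<oplus>\<^bsub>M\<^esub> k y)), smult = (\<lambda>a x. i (a \<odot>\<^bsub>M\<^esub> k x))\<rparr>"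

lemma copy_mod:
  assumes "module R M" "inj_on i (carrier M)" "\<And>x. x \<in> carrier M \<Longrightarrow> k (i x) = x"
  shows "module R (copy_mod i k M)" "i \<in> mod_hom R M (copy_mod i k M)"
    "k \<in> mod_hom R (copy_mod i k M) M" "k ` carrier (copy_mod i k M) = carrier M"
    "bij_betw i (carrier M) (carrier (copy_mod i k M))"
proof -
  interpret module R M by fact
  show "module R (copy_mod i k M)"
  proof (rule moduleI[OF R.is_cring])
    show "abelian_group (copy_mod i k M)"
    proof (rule abelian_groupI)
      fix x assume "x \<in> carrier (copy_mod i k M)"
      then obtain y where y: "y \<in> carrier M" "x = i y" by (auto simp: copy_mod_def)
      then show "\<exists>x'\<in>carrier (copy_mod i k M). x' \<oplus>\<^bsub>copy_mod i k M\<^esub> x = \<zero>\<^bsub>copy_mod i k M\<^esub>"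
        by (intro bexI[of _ "i (\<ominus>\<^bsub>M\<^esub> y)"]) (auto simp: copy_mod_def assms(3) M.l_neg)
    qed (auto simp: copy_mod_def assms(3) M.a_ac)
  qed (auto simp: copy_mod_def assms(3) smult_l_distr smult_r_distr smult_assoc1)
qed (use assms(1) in \<open>auto simp: mod_hom_def copy_mod_def assms(2,3) bij_betw_def image_image
    module.smult_closed abelian_groupE(1) module_def\<close>)

lemma inj_free_mod_elements:
  "\<exists>i :: (('a + 'b) list \<Rightarrow> 'a) \<Rightarrow> ('a + 'b) list. inj_on i (carrier (free_mod R S))"
proof -
  let ?U = "UNIV :: ('a + 'b) list set"
  let ?W = "?U \<times> ?U"
  have inf: "infinite ?U" by (rule infinite_UNIV_listI)
  then have infW: "infinite ?W" by (metis UNIV_not_empty finite_cartesian_productD1)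
  have "|Fpow ?W| =o |?W|" using infW by (rule card_of_Fpow_infinite)
  moreover have "|?W| =o |?U|" using inf by (rule card_of_Times_same_infinite)
  ultimately have "|Fpow ?W| \<le>o |?U|" by (meson ordIso_transitive ordIso_iff_ordLeq)
  then obtain i :: "(('a + 'b) list \<times> ('a + 'b) list) set \<Rightarrow> ('a + 'b) list" where i: "inj_on i (Fpow ?W)"
    unfolding card_of_ordLeq[symmetric] by blast
  define \<Phi> where "\<Phi> c = (\<lambda>s. (s, [Inl (c s) :: 'a + 'b])) ` {s. c s \<noteq> \<zero>\<^bsub>R\<^esub>}" for c :: "('a + 'b) list \<Rightarrow> 'a"
  have eq: "c s = (if \<exists>a. (s, [Inl a]) \<in> \<Phi> c then THE a. (s, [Inl a]) \<in> \<Phi> c else \<zero>\<^bsub>R\<^esub>)" for c s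
    by (auto simp: \<Phi>_def image_iff)
  have "inj \<Phi>" by (rule injI) (subst fun_eq_iff, subst (1 2) eq, simp)
  moreover have "\<Phi> ` carrier (free_mod R S) \<subseteq> Fpow ?W"
    by (auto simp: Fpow_def \<Phi>_def free_mod_simps)
  ultimately have "inj_on (i \<circ> \<Phi>) (carrier (free_mod R S))"
    using i by (meson comp_inj_on inj_on_subset subset_UNIV)
  then show ?thesis by blast
qed

lemma free_cover_exists:
  fixes K :: "('a, 'k, 'm) module_scheme" and j :: "'k \<Rightarrow> ('a + 'b) list"
  assumes K: "module R K" and j: "inj j"
  shows "\<exists>(F :: ('a, ('a + 'b) list) module) f.
     free_module R F \<and> f \<in> mod_hom R F K \<and> f ` carrier F = carrier K"
proof -
  interpret module R K by fact
  let ?B = "j ` carrier K"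
  let ?P = "free_mod R ?B"
  obtain i :: "(('a + 'b) list \<Rightarrow> 'a) \<Rightarrow> ('a + 'b) list" where i: "inj_on i (carrier ?P)"
    using inj_free_mod_elements[of R ?B] by blast
  define k where "k = inv_into (carrier ?P) i"
  define F where "F = copy_mod i k ?P"
  have P: "module R ?P" by (rule free_mod_module[OF R.is_cring])
  note F = copy_mod[OF P i, of k, folded F_def, unfolded k_def, OF inv_into_f_f[OF i], folded k_def]
  have "inv_into UNIV j \<in> ?B \<rightarrow> carrier K" using j by auto
  from free_mod_lift[OF K this] obtain h where h: "h \<in> mod_hom R ?P K" "\<And>s. s \<in> ?B \<Longrightarrow> h (free_gen R s) = inv_into UNIV j s"
    by blast
  have surj: "h ` carrier ?P = carrier K"
  proof
    show "h ` carrier ?P \<subseteq> carrier K" using h(1) by (auto simp: mod_hom_def)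
    show "carrier K \<subseteq> h ` carrier ?P"
    proof
      fix x assume "x \<in> carrier K"
      then show "x \<in> h ` carrier ?P"
        using h(2)[of "j x"] j free_gen_carrier[OF R.is_cring, of "j x" ?B] by force
    qed
  qed
  have "free_module R F"
    using F by (auto simp: free_module_def mod_iso_def)
  moreover have "(\<lambda>x. h (k x)) \<in> mod_hom R F K" by (rule mod_hom_compose[OF F(3) h(1)])
  moreover have "(\<lambda>x. h (k x)) ` carrier F = carrier K"
    using F(4) surj by (simp add: image_image[symmetric, of h k])
  ultimately show ?thesis by blast
qed

lemma free_resolution_exists:
  fixes M :: "('a, 'b, 'm) module_scheme"
  assumes M: "module R M"
  shows "\<exists>F d e. some_resolution R M = (F, d, e) \<and> free_resolution R M F d e"
proof -
  have "inj (\<lambda>x :: 'b. [Inr x :: 'a + 'b])" by (auto simp: inj_def)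
  from free_cover_exists[OF M this] obtain F0 :: "('a, ('a + 'b) list) module" and e
    where F0: "free_module R F0" "e \<in> mod_hom R F0 M" "e ` carrier F0 = carrier M" by blast
  let ?ok = "\<lambda>(F :: ('a, ('a + 'b) list) module, K). free_module R F \<and> submodule K R F"
  let ?step = "\<lambda>(F, K) (F', K'). \<exists>d. d \<in> mod_hom R F' F \<and> d ` carrier F' = K \<and> K' = a_kernel F' F d"
  have step: "\<exists>G. ?ok G \<and> ?step FK G" if ok: "?ok FK" for FK
  proof -
    obtain F K where FK: "FK = (F, K)" by (cases FK)
    have F: "module R F" "submodule K R F" using ok by (auto simp: FK free_module_def)
    have K: "module R (F\<lparr>carrier := K\<rparr>)" using submodule.submodule_is_module[OF F(2,1)] .
    from free_cover_exists[OF K inj_on_id2] obtain F' :: "('a, ('a + 'b) list) module" and d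
      where F': "free_module R F'" "d \<in> mod_hom R F' (F\<lparr>carrier := K\<rparr>)" "d ` carrier F' = K"
      by auto
    have d: "d \<in> mod_hom R F' F"
      using F'(2) module.submoduleE(1)[OF F] by (auto simp: mod_hom_def)
    have "submodule (a_kernel F' F d) R F'"
      using mod_hom_kernel_submodule[OF _ F(1) d] F'(1) by (auto simp: free_module_def)
    then show ?thesis using F' d by (intro exI[of _ "(F', a_kernel F' F d)"]) (auto simp: FK)
  qed
  have K0: "submodule (a_kernel F0 M e) R F0"
    using mod_hom_kernel_submodule[OF _ M F0(2)] F0(1) by (auto simp: free_module_def)
  have "\<exists>g. \<forall>n. (?ok (g n) \<and> (n = 0 \<longrightarrow> g n = (F0, a_kernel F0 M e))) \<and> ?step (g n) (g (Suc n))"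
  proof (rule dependent_nat_choice)
    show "\<exists>G. ?ok G \<and> (0 = 0 \<longrightarrow> G = (F0, a_kernel F0 M e))"
      using F0(1) K0 by blast
    fix FK and n :: nat
    assume "?ok FK \<and> (n = 0 \<longrightarrow> FK = (F0, a_kernel F0 M e))"
    then show "\<exists>G. (?ok G \<and> (Suc n = 0 \<longrightarrow> G = (F0, a_kernel F0 M e))) \<and> ?step FK G"
      using step[of FK] by simp
  qed
  then obtain g where "\<forall>n. (?ok (g n) \<and> (n = 0 \<longrightarrow> g n = (F0, a_kernel F0 M e))) \<and> ?step (g n) (g (Suc n))" ..
  then have g: "g 0 = (F0, a_kernel F0 M e)" "\<And>n. ?ok (g n)" "\<And>n. ?step (g n) (g (Suc n))"
    by simp_all
  define F K where "F n = fst (g n)" and "K n = snd (g n)" for n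
  have "\<forall>n. \<exists>d. d \<in> mod_hom R (F (Suc n)) (F n) \<and> d ` carrier (F (Suc n)) = K n
      \<and> K (Suc n) = a_kernel (F (Suc n)) (F n) d"
    using g(3) by (auto simp: F_def K_def case_prod_unfold)
  then obtain d where d: "\<And>n. d n \<in> mod_hom R (F (Suc n)) (F n)"
      "\<And>n. d n ` carrier (F (Suc n)) = K n"
      "\<And>n. K (Suc n) = a_kernel (F (Suc n)) (F n) (d n)" by metis
  have z: "F 0 = F0" "K 0 = a_kernel F0 M e" using g(1) by (auto simp: F_def K_def)
  have "free_resolution R M F d e"
    unfolding free_resolution_def using M d F0 z g(2)
    by (auto simp: F_def case_prod_unfold simp flip: d(3))
  then have "case (F, d, e) of (F, d, e) \<Rightarrow> free_resolution R M F d e" by simp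
  from someI[where P = "\<lambda>(F, d, e). free_resolution R M F d e", OF this]
  have "case some_resolution R M of (F, d, e) \<Rightarrow> free_resolution R M F d e"
    by (simp only: some_resolution_def)
  then show ?thesis by (auto split: prod.splits)
qed


section \<open>Tensor products and Tor\<close>

definition tensor_rels ::
    "('a, 'r) ring_scheme \<Rightarrow> ('a, 'b, 'm) module_scheme \<Rightarrow> ('a, 'c, 'n) module_scheme \<Rightarrow>
     ('b \<times> 'c \<Rightarrow> 'a) set"
  where "tensor_rels R M N = (let P = free_mod R (carrier M \<times> carrier N); g = free_gen R in
     {g (x \<oplus>\<^bsub>M\<^esub> x', y) \<ominus>\<^bsub>P\<^esub> (g (x, y) \<oplus>\<^bsub>P\<^esub> g (x', y)) | x x' y.
        x \<in> carrier M \<and> x' \<in> carrier M \<and> y \<in> carrier N} \<union>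
     {g (x, y \<oplus>\<^bsub>N\<^esub> y') \<ominus>\<^bsub>P\<^esub> (g (x, y) \<oplus>\<^bsub>P\<^esub> g (x, y')) | x y y'.
        x \<in> carrier M \<and> y \<in> carrier N \<and> y' \<in> carrier N} \<union>
     {g (a \<odot>\<^bsub>M\<^esub> x, y) \<ominus>\<^bsub>P\<^esub> a \<odot>\<^bsub>P\<^esub> g (x, y) | a x y.
        a \<in> carrier R \<and> x \<in> carrier M \<and> y \<in> carrier N} \<union>
     {g (x, a \<odot>\<^bsub>N\<^esub> y) \<ominus>\<^bsub>P\<^esub> a \<odot>\<^bsub>P\<^esub> g (x, y) | a x y.
        a \<in> carrier R \<and> x \<in> carrier M \<and> y \<in> carrier N})"

definition tensor_null ::
    "('a, 'r) ring_scheme \<Rightarrow> ('a, 'b, 'm) module_scheme \<Rightarrow> ('a, 'c, 'n) module_scheme \<Rightarrow>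
     ('b \<times> 'c \<Rightarrow> 'a) set"
  where "tensor_null R M N =
     mod_span R (free_mod R (carrier M \<times> carrier N)) (tensor_rels R M N)"

definition tensor ::
    "('a, 'r) ring_scheme \<Rightarrow> ('a, 'b, 'm) module_scheme \<Rightarrow> ('a, 'c, 'n) module_scheme \<Rightarrow>
     ('a, ('b \<times> 'c \<Rightarrow> 'a) set) module"
  where "tensor R M N = quot_mod (free_mod R (carrier M \<times> carrier N)) (tensor_null R M N)"

definition pure_tensor ::
    "('a, 'r) ring_scheme \<Rightarrow> ('a, 'b, 'm) module_scheme \<Rightarrow> ('a, 'c, 'n) module_scheme \<Rightarrow>
     'b \<Rightarrow> 'c \<Rightarrow> ('b \<times> 'c \<Rightarrow> 'a) set"
  where "pure_tensor R M N x y =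
     tensor_null R M N +>\<^bsub>free_mod R (carrier M \<times> carrier N)\<^esub> free_gen R (x, y)"

text \<open>
  The map \<open>f \<otimes> id\<close> from \<open>M \<otimes> N\<close> to \<open>M' \<otimes> N\<close> induced by a homomorphism \<open>f\<close> from \<open>M\<close> to
  \<open>M'\<close>. Extensionality makes it unique as a total function.
\<close>

definition tensor_map ::
    "('a, 'r) ring_scheme \<Rightarrow> ('a, 'b, 'm) module_scheme \<Rightarrow> ('a, 'd, 'k) module_scheme \<Rightarrow>
     ('a, 'c, 'n) module_scheme \<Rightarrow> ('b \<Rightarrow> 'd) \<Rightarrow> ('b \<times> 'c \<Rightarrow> 'a) set \<Rightarrow> ('d \<times> 'c \<Rightarrow> 'a) set"
  where "tensor_map R M M' N f = (THE h.
     h \<in> mod_hom R (tensor R M N) (tensor R M' N) \<inter> extensional (carrier (tensor R M N)) \<and>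
     (\<forall>x \<in> carrier M. \<forall>y \<in> carrier N. h (pure_tensor R M N x y) = pure_tensor R M' N (f x) y))"

definition Tor ::
    "nat \<Rightarrow> ('a, 'r) ring_scheme \<Rightarrow> ('a, 'b, 'm) module_scheme \<Rightarrow> ('a, 'c, 'n) module_scheme \<Rightarrow>
     ('a, (('a + 'b) list \<times> 'c \<Rightarrow> 'a) set set) module"
  where "Tor n R M N = (case some_resolution R M of (F, d, e) \<Rightarrow>
     let T = (\<lambda>i. tensor R (F i) N);
         \<delta> = (\<lambda>i. tensor_map R (F (Suc i)) (F i) N (d i));
         cycles = (case n of 0 \<Rightarrow> carrier (T 0) | Suc i \<Rightarrow> a_kernel (T (Suc i)) (T i) (\<delta> i));
         boundaries = \<delta> n ` carrier (T (Suc n))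
     in quot_mod ((T n)\<lparr>carrier := cycles\<rparr>) boundaries)"


section \<open>Hom and Ext\<close>

definition Hom_mod ::
    "('a, 'r) ring_scheme \<Rightarrow> ('a, 'b, 'm) module_scheme \<Rightarrow> ('a, 'c, 'n) module_scheme \<Rightarrow>
     ('a, 'b \<Rightarrow> 'c) module"
  where "Hom_mod R M N = \<lparr>carrier = mod_hom R M N \<inter> extensional (carrier M),
     monoid.mult = (\<lambda>f g. \<lambda>x \<in> carrier M. \<zero>\<^bsub>N\<^esub>), one = (\<lambda>x \<in> carrier M. \<zero>\<^bsub>N\<^esub>),
     ring.zero = (\<lambda>x \<in> carrier M. \<zero>\<^bsub>N\<^esub>),
     add = (\<lambda>f g. \<lambda>x \<in> carrier M. f x \<oplus>\<^bsub>N\<^esub> g x),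
     smult = (\<lambda>a f. \<lambda>x \<in> carrier M. a \<odot>\<^bsub>N\<^esub> f x)\<rparr>"

definition Ext ::
    "nat \<Rightarrow> ('a, 'r) ring_scheme \<Rightarrow> ('a, 'b, 'm) module_scheme \<Rightarrow> ('a, 'c, 'n) module_scheme \<Rightarrow>
     ('a, (('a + 'b) list \<Rightarrow> 'c) set) module"
  where "Ext n R M N = (case some_resolution R M of (F, d, e) \<Rightarrow>
     let C = (\<lambda>i. Hom_mod R (F i) N);
         \<delta> = (\<lambda>i f. compose (carrier (F (Suc i))) f (d i));
         cocycles = a_kernel (C n) (C (Suc n)) (\<delta> n);
         coboundaries = (case n of 0 \<Rightarrow> {\<zero>\<^bsub>C 0\<^esub>} | Suc i \<Rightarrow> \<delta> i ` carrier (C i))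
     in quot_mod ((C n)\<lparr>carrier := cocycles\<rparr>) coboundaries)"


section \<open>The rings and modules of the theorem\<close>

abbreviation ZX :: "(int, nat \<Rightarrow> int) up_ring"
  where "ZX \<equiv> UP \<Z>"

definition indet :: "nat \<Rightarrow> int"
  where "indet = up_ring.monom ZX 1 1"

definition A_ring :: "(nat \<Rightarrow> int) set ring"
  where "A_ring = ZX Quot (PIdl\<^bsub>ZX\<^esub> (indet [^]\<^bsub>ZX\<^esub> (3::nat)))"

definition R_ring :: "(nat \<Rightarrow> int) set ring"
  where "R_ring = ZX Quot (PIdl\<^bsub>ZX\<^esub> (indet [^]\<^bsub>ZX\<^esub> (2::nat)))"

definition pA :: "(nat \<Rightarrow> int) set"
  where "pA = PIdl\<^bsub>ZX\<^esub> (indet [^]\<^bsub>ZX\<^esub> (3::nat)) +>\<^bsub>ZX\<^esub> indet"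

definition Z_ring :: "(nat \<Rightarrow> int) set set ring"
  where "Z_ring = A_ring Quot (PIdl\<^bsub>A_ring\<^esub> pA)"

text \<open>The quotient map \<open>\<int>[p]/(p\<^sup>3) \<rightarrow> \<int>[p]/(p\<^sup>2)\<close>; it sends \<open>(p\<^sup>3) + f\<close> to \<open>(p\<^sup>2) + f\<close>.\<close>

definition A_to_R :: "(nat \<Rightarrow> int) set \<Rightarrow> (nat \<Rightarrow> int) set"
  where "A_to_R a = PIdl\<^bsub>ZX\<^esub> (indet [^]\<^bsub>ZX\<^esub> (2::nat)) <+>\<^bsub>ZX\<^esub> a"

definition A_to_Z :: "(nat \<Rightarrow> int) set \<Rightarrow> (nat \<Rightarrow> int) set set"
  where "A_to_Z a = PIdl\<^bsub>A_ring\<^esub> pA +>\<^bsub>A_ring\<^esub> a"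

text \<open>
  The constant coefficient, which all polynomials in a residue class share. It is the
  composite of \<^const>\<open>A_to_Z\<close> with the isomorphism from \<^const>\<open>Z_ring\<close> to the integers, and makes
  the integers an \<^const>\<open>A_ring\<close>-module on which \<^const>\<open>pA\<close> acts as zero.
\<close>

definition A_to_int :: "(nat \<Rightarrow> int) set \<Rightarrow> int"
  where "A_to_int a = the_elem ((\<lambda>f. up_ring.coeff ZX f 0) ` a)"

definition A_mod :: "((nat \<Rightarrow> int) set, (nat \<Rightarrow> int) set) module"
  where "A_mod = hom_module (\<lambda>a. a) A_ring"

definition R_mod :: "((nat \<Rightarrow> int) set, (nat \<Rightarrow> int) set) module"
  where "R_mod = hom_module A_to_R R_ring"

definition Z_mod :: "((nat \<Rightarrow> int) set, (nat \<Rightarrow> int) set set) module"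
  where "Z_mod = hom_module A_to_Z Z_ring"

definition int_mod :: "((nat \<Rightarrow> int) set, int) module"
  where "int_mod = hom_module A_to_int \<Z>"

definition pR_mod :: "((nat \<Rightarrow> int) set, (nat \<Rightarrow> int) set) module"
  where "pR_mod = R_mod\<lparr>carrier := scaled pA R_mod\<rparr>"

definition R_mod_pR :: "((nat \<Rightarrow> int) set, (nat \<Rightarrow> int) set set) module"
  where "R_mod_pR = quot_mod R_mod (scaled pA R_mod)"

end

theory Submission
  imports Defs
begin

text \<open>
  Any free resolution of \<open>\<R>\<close> is compared with the periodic one: lifting along surjections onto
  kernels gives chain maps in both directions that are mutually inverse up to homotopy. Tensoring
  with \<open>N\<close>, or applying \<open>Hom(-, N)\<close>, the periodic resolution becomes the complex with all terms \<open>N\<close>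
  and differentials alternately \<open>p\<^sup>2\<close> and \<open>p\<close>. On \<open>Z\<close> both act as zero; on \<open>\<R>\<close>, \<open>p\<^sup>2\<close> acts as zero
  and \<open>p\<close> has kernel and image \<open>p\<R>\<close>.
\<close>

section \<open>Homomorphisms and quotients of modules\<close>

text \<open>Tor and Ext are read off from \<open>some_resolution\<close>, of which only freeness and
  exactness are known, so one explicit resolution settles nothing by itself: the homology has to be
  found for every free resolution F. Because the terms of the periodic resolution have rank one, the
  comparison with F can be written with elements. A chain map into F amounts to elements b of the
  terms of F, and a homotopy on the periodic side to ring elements t. With a chain map f back, the
  maps between F \<otimes> N and N are x \<otimes> y \<mapsto> f(x) y and y \<mapsto> b \<otimes> y,
  and those between Hom(F, N) and N are h \<mapsto> h(b) and y \<mapsto> (x \<mapsto> f(x) y). So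
  neither A \<otimes> N nor Hom(A, N) is ever formed. Exactness of the periodic resolution rests on
  one fact: multiplication by p^i in \<int>[p]/(p^3) shifts coefficients, hence its kernel consists
  of the multiples of p^(3 - i), for i = 1 and i = 2.\<close>

lemma (in abelian_group) minus_eq_zero_iff:
  assumes "x \<in> carrier G" "y \<in> carrier G"
  shows "x \<ominus> y = \<zero> \<longleftrightarrow> x = y"
  using assms by (metis a_minus_def a_inv_closed minus_equality minus_minus r_neg)

lemma mod_homD:
  assumes "f \<in> mod_hom R M N"
  shows "x \<in> carrier M \<Longrightarrow> f x \<in> carrier N"
    and "x \<in> carrier M \<Longrightarrow> y \<in> carrier M \<Longrightarrow> f (x \<oplus>\<^bsub>M\<^esub> y) = f x \<oplus>\<^bsub>N\<^esub> f y"
    and "a \<in> carrier R \<Longrightarrow> x \<in> carrier M \<Longrightarrow> f (a \<odot>\<^bsub>M\<^esub> x) = a \<odot>\<^bsub>N\<^esub> f x"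
  using assms by (auto simp: mod_hom_def)

lemma mod_homI:
  assumes "\<And>x. x \<in> carrier M \<Longrightarrow> f x \<in> carrier N"
    and "\<And>x y. x \<in> carrier M \<Longrightarrow> y \<in> carrier M \<Longrightarrow> f (x \<oplus>\<^bsub>M\<^esub> y) = f x \<oplus>\<^bsub>N\<^esub> f y"
    and "\<And>a x. a \<in> carrier R \<Longrightarrow> x \<in> carrier M \<Longrightarrow> f (a \<odot>\<^bsub>M\<^esub> x) = a \<odot>\<^bsub>N\<^esub> f x"
  shows "f \<in> mod_hom R M N"
  using assms by (auto simp: mod_hom_def)

lemma mod_isoI:
  assumes "f \<in> mod_hom R M N" "bij_betw f (carrier M) (carrier N)"
  shows "M \<cong>\<^bsub>R\<^esub> N"
  using assms by (auto simp: mod_iso_def)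

lemma mod_hom_zero:
  assumes "module R M" "module R N" "f \<in> mod_hom R M N"
  shows "f \<zero>\<^bsub>M\<^esub> = \<zero>\<^bsub>N\<^esub>"
proof -
  interpret M: module R M by fact
  interpret N: module R N by fact
  have "f (\<zero>\<^bsub>R\<^esub> \<odot>\<^bsub>M\<^esub> \<zero>\<^bsub>M\<^esub>) = \<zero>\<^bsub>R\<^esub> \<odot>\<^bsub>N\<^esub> f \<zero>\<^bsub>M\<^esub>"
    using mod_homD(3)[OF assms(3)] by blast
  then show ?thesis using mod_homD(1)[OF assms(3)] by simp
qed

lemma mod_hom_uminus:
  assumes "module R M" "module R N" "f \<in> mod_hom R M N" "x \<in> carrier M"
  shows "f (\<ominus>\<^bsub>M\<^esub> x) = \<ominus>\<^bsub>N\<^esub> f x"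
proof -
  interpret M: module R M by fact
  interpret N: module R N by fact
  have "f ((\<ominus>\<^bsub>R\<^esub> \<one>\<^bsub>R\<^esub>) \<odot>\<^bsub>M\<^esub> x) = (\<ominus>\<^bsub>R\<^esub> \<one>\<^bsub>R\<^esub>) \<odot>\<^bsub>N\<^esub> f x"
    using mod_homD(3)[OF assms(3)] assms(4) by blast
  then show ?thesis using assms(4) mod_homD(1)[OF assms(3)]
    by (simp add: M.smult_l_minus N.smult_l_minus)
qed

lemma mod_hom_minus:
  assumes "module R M" "module R N" "f \<in> mod_hom R M N" "x \<in> carrier M" "y \<in> carrier M"
  shows "f (x \<ominus>\<^bsub>M\<^esub> y) = f x \<ominus>\<^bsub>N\<^esub> f y"
proof -
  interpret M: module R M by fact
  interpret N: module R N by fact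
  show ?thesis
    using assms by (simp add: a_minus_def mod_homD(2)[OF assms(3)] mod_hom_uminus)
qed

lemma mod_hom_cong:
  assumes "f \<in> mod_hom R M N" "module R M" "\<And>x. x \<in> carrier M \<Longrightarrow> g x = f x"
  shows "g \<in> mod_hom R M N"
proof -
  interpret module R M by fact
  show ?thesis using assms(1,3) by (auto simp: mod_hom_def)
qed

lemma mod_hom_id: "(\<lambda>x. x) \<in> mod_hom R M M"
  by (auto simp: mod_hom_def)

lemma mod_hom_add:
  assumes "module R N" "f \<in> mod_hom R M N" "g \<in> mod_hom R M N"
  shows "(\<lambda>x. f x \<oplus>\<^bsub>N\<^esub> g x) \<in> mod_hom R M N"
proof -
  interpret module R N by fact
  show ?thesis
    by (rule mod_homI) (use mod_homD[OF assms(2)] mod_homD[OF assms(3)] in \<open>simp_all add: M.a_ac smult_r_distr\<close>)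
qed

lemma mod_hom_diff:
  assumes "module R N" "f \<in> mod_hom R M N" "g \<in> mod_hom R M N"
  shows "(\<lambda>x. f x \<ominus>\<^bsub>N\<^esub> g x) \<in> mod_hom R M N"
proof -
  interpret module R N by fact
  show ?thesis
    by (rule mod_homI)
       (use mod_homD[OF assms(2)] mod_homD[OF assms(3)] in
         \<open>simp_all add: M.a_ac a_minus_def M.minus_add smult_r_distr smult_r_minus\<close>)
qed

lemma mod_hom_smult:
  assumes "module R N" "f \<in> mod_hom R M N" "c \<in> carrier R"
  shows "(\<lambda>x. c \<odot>\<^bsub>N\<^esub> f x) \<in> mod_hom R M N"
proof -
  interpret module R N by fact
  show ?thesis
    by (rule mod_homI)
       (use mod_homD[OF assms(2)] assms(3) in
         \<open>simp_all add: smult_r_distr R.m_comm flip: smult_assoc1\<close>)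
qed

lemma mod_hom_restrict_carrier:
  assumes "f \<in> mod_hom R M N" "Z \<subseteq> carrier M" "\<And>x. x \<in> Z \<Longrightarrow> f x \<in> Z'"
  shows "f \<in> mod_hom R (M\<lparr>carrier := Z\<rparr>) (N\<lparr>carrier := Z'\<rparr>)"
  using assms by (auto simp: mod_hom_def subset_iff)

lemma mod_hom_inv_into:
  assumes "module R M" "f \<in> mod_hom R M N" "bij_betw f (carrier M) (carrier N)"
  shows "inv_into (carrier M) f \<in> mod_hom R N M"
proof -
  interpret module R M by fact
  let ?i = "inv_into (carrier M) f"
  have i: "?i y \<in> carrier M" "f (?i y) = y" if "y \<in> carrier N" for y
    using that assms(3) by (auto simp: bij_betw_def inv_into_into f_inv_into_f)
  have eq: "?i y = x" if "x \<in> carrier M" "f x = y" for x y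
    using that assms(3) by (auto simp: bij_betw_def)
  show ?thesis
    by (rule mod_homI) (use i mod_homD[OF assms(2)] in \<open>auto intro!: eq\<close>)
qed

text \<open>This is the tool for uniqueness: once the set of agreement is a submodule, two
  homomorphisms that agree on generators agree everywhere, as used in
  \<open>free_mod_hom_eqI\<close>.\<close>

lemma mod_hom_equalizer_submodule:
  assumes "module R M" "module R N" "f \<in> mod_hom R M N" "g \<in> mod_hom R M N"
  shows "submodule {x \<in> carrier M. f x = g x} R M"
proof -
  interpret M: module R M by fact
  show ?thesis
    by (rule M.submoduleI)
       (use mod_homD[OF assms(3)] mod_homD[OF assms(4)] in
         \<open>auto simp: mod_hom_zero[OF assms(1,2,3)] mod_hom_zero[OF assms(1,2,4)]
           mod_hom_uminus[OF assms(1,2,3)] mod_hom_uminus[OF assms(1,2,4)]\<close>)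
qed

lemma mod_hom_image_submodule:
  assumes "module R M" "module R N" "f \<in> mod_hom R M N"
  shows "submodule (f ` carrier M) R N"
proof -
  interpret M: module R M by fact
  interpret N: module R N by fact
  note f = mod_homD[OF assms(3)]
  show ?thesis
  proof (rule N.submoduleI)
    show "\<zero>\<^bsub>N\<^esub> \<in> f ` carrier M"
      using mod_hom_zero[OF assms] by (metis M.zero_closed imageI)
  next
    fix y assume "y \<in> f ` carrier M"
    then obtain x where x: "x \<in> carrier M" "y = f x" by blast
    show "\<ominus>\<^bsub>N\<^esub> y \<in> f ` carrier M"
      by (rule image_eqI[of _ _ "\<ominus>\<^bsub>M\<^esub> x"]) (use x mod_hom_uminus[OF assms] in auto)
    show "a \<odot>\<^bsub>N\<^esub> y \<in> f ` carrier M" if "a \<in> carrier R" for a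
      by (rule image_eqI[of _ _ "a \<odot>\<^bsub>M\<^esub> x"]) (use x that f(3) in auto)
    fix z assume "z \<in> f ` carrier M"
    then obtain w where w: "w \<in> carrier M" "z = f w" by blast
    show "y \<oplus>\<^bsub>N\<^esub> z \<in> f ` carrier M"
      by (rule image_eqI[of _ _ "x \<oplus>\<^bsub>M\<^esub> w"]) (use x w f(2) in auto)
  qed (use f in auto)
qed

section \<open>Kernels and quotient modules\<close>

lemma a_kernel_iff: "x \<in> a_kernel M N f \<longleftrightarrow> x \<in> carrier M \<and> f x = \<zero>\<^bsub>N\<^esub>"
  by (simp add: a_kernel_def')

locale quotient_module = module R M for R (structure) and M (structure) and H +
  assumes sub: "submodule H R M"
begin

sublocale abelian_subgroup H M
  by (rule abelian_subgroupI3)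
     (use sub M.abelian_group_axioms in \<open>auto simp: additive_subgroup_def submodule_def\<close>)

lemma coset_carrier: "x \<in> carrier M \<Longrightarrow> H +>\<^bsub>M\<^esub> x \<in> carrier (quot_mod M H)"
  by (simp add: quot_mod_def a_rcosetsI a_subset)

lemma coset_cases:
  assumes "U \<in> carrier (quot_mod M H)" obtains x where "x \<in> carrier M" "U = H +>\<^bsub>M\<^esub> x"
  using assms by (auto simp: quot_mod_def A_RCOSETS_def RCOSETS_def a_r_coset_def)

lemma coset_eq_iff:
  assumes "x \<in> carrier M" "y \<in> carrier M"
  shows "H +>\<^bsub>M\<^esub> x = H +>\<^bsub>M\<^esub> y \<longleftrightarrow> x \<ominus>\<^bsub>M\<^esub> y \<in> H"
  using assms a_rcos_module a_repr_independence' a_rcos_self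
  by (metis a_minus_def)

lemma coset_add:
  "x \<in> carrier M \<Longrightarrow> y \<in> carrier M \<Longrightarrow>
    (H +>\<^bsub>M\<^esub> x) \<oplus>\<^bsub>quot_mod M H\<^esub> (H +>\<^bsub>M\<^esub> y) = H +>\<^bsub>M\<^esub> (x \<oplus>\<^bsub>M\<^esub> y)"
  by (simp add: quot_mod_def a_rcos_sum)

lemma coset_zero: "\<zero>\<^bsub>quot_mod M H\<^esub> = H +>\<^bsub>M\<^esub> \<zero>\<^bsub>M\<^esub>"
  by (simp add: quot_mod_def a_subset)

text \<open>Scaling in \<open>quot_mod\<close> is a union over all representatives. It collapses
  because each representative contributes the same coset and a coset is never empty.\<close>

lemma coset_smult:
  assumes a: "a \<in> carrier R" and x: "x \<in> carrier M"
  shows "a \<odot>\<^bsub>quot_mod M H\<^esub> (H +>\<^bsub>M\<^esub> x) = H +>\<^bsub>M\<^esub> (a \<odot>\<^bsub>M\<^esub> x)"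
proof -
  have eq: "H +>\<^bsub>M\<^esub> (a \<odot>\<^bsub>M\<^esub> y) = H +>\<^bsub>M\<^esub> (a \<odot>\<^bsub>M\<^esub> x)" if "y \<in> H +>\<^bsub>M\<^esub> x" for y
  proof -
    have y: "y \<in> carrier M" using that x a_elemrcos_carrier by blast
    have "y \<ominus>\<^bsub>M\<^esub> x \<in> H" using that x y a_rcos_module by (simp add: a_minus_def)
    then have "a \<odot>\<^bsub>M\<^esub> (y \<ominus>\<^bsub>M\<^esub> x) \<in> H" using submoduleE(4)[OF sub] a by blast
    then have "a \<odot>\<^bsub>M\<^esub> y \<ominus>\<^bsub>M\<^esub> a \<odot>\<^bsub>M\<^esub> x \<in> H"
      using a x y by (simp add: a_minus_def smult_r_distr smult_r_minus)
    then show ?thesis using a x y by (simp add: coset_eq_iff)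
  qed
  have "H +>\<^bsub>M\<^esub> x \<noteq> {}" using x a_rcos_self by blast
  then have "(\<Union>y\<in>H +>\<^bsub>M\<^esub> x. H +>\<^bsub>M\<^esub> (a \<odot>\<^bsub>M\<^esub> y)) = H +>\<^bsub>M\<^esub> (a \<odot>\<^bsub>M\<^esub> x)"
    by (rule SUP_eq_const) (rule eq)
  then show ?thesis by (simp add: quot_mod_def)
qed

lemma quot_mod_module: "module R (quot_mod M H)"
proof (rule moduleI[OF R.is_cring])
  show "abelian_group (quot_mod M H)"
  proof (rule abelian_groupI)
    fix U assume "U \<in> carrier (quot_mod M H)"
    then obtain x where "x \<in> carrier M" "U = H +>\<^bsub>M\<^esub> x" by (rule coset_cases)
    then show "\<exists>V\<in>carrier (quot_mod M H). V \<oplus>\<^bsub>quot_mod M H\<^esub> U = \<zero>\<^bsub>quot_mod M H\<^esub>"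
      by (intro bexI[of _ "H +>\<^bsub>M\<^esub> (\<ominus>\<^bsub>M\<^esub> x)"]) (simp_all add: coset_add coset_carrier coset_zero M.l_neg)
  qed (auto elim!: coset_cases simp: coset_add coset_carrier coset_zero M.a_ac)
qed (auto elim!: coset_cases simp: coset_smult coset_add coset_carrier smult_l_distr smult_r_distr smult_assoc1)

lemma coset_hom: "(\<lambda>x. H +>\<^bsub>M\<^esub> x) \<in> mod_hom R M (quot_mod M H)"
  by (rule mod_homI) (simp_all add: coset_carrier coset_add coset_smult)

lemma quot_mod_lift:
  assumes N: "module R N" and f: "f \<in> mod_hom R M N" and H: "\<And>x. x \<in> H \<Longrightarrow> f x = \<zero>\<^bsub>N\<^esub>"
  obtains h where "h \<in> mod_hom R (quot_mod M H) N" "\<And>x. x \<in> carrier M \<Longrightarrow> h (H +>\<^bsub>M\<^esub> x) = f x"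
proof -
  interpret N: module R N by fact
  \<comment> \<open>The choice of a representative is harmless: two representatives differ by an
    element of \<open>H\<close>, which \<open>f\<close> kills.\<close>
  define h where "h U = f (SOME x. x \<in> carrier M \<and> U = H +>\<^bsub>M\<^esub> x)" for U
  have h: "h (H +>\<^bsub>M\<^esub> x) = f x" if x: "x \<in> carrier M" for x
  proof -
    define y where "y = (SOME y. y \<in> carrier M \<and> H +>\<^bsub>M\<^esub> x = H +>\<^bsub>M\<^esub> y)"
    have y: "y \<in> carrier M" "H +>\<^bsub>M\<^esub> x = H +>\<^bsub>M\<^esub> y"
      unfolding y_def using someI[of "\<lambda>y. y \<in> carrier M \<and> H +>\<^bsub>M\<^esub> x = H +>\<^bsub>M\<^esub> y" x] x by auto
    then have "f (x \<ominus>\<^bsub>M\<^esub> y) = \<zero>\<^bsub>N\<^esub>" using x H by (simp add: coset_eq_iff)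
    then have "f x = f y"
      using x y mod_hom_minus[OF module_axioms N f x y(1)] mod_homD(1)[OF f]
      by (simp add: N.minus_eq_zero_iff)
    then show ?thesis by (simp add: h_def y_def)
  qed
  have "h \<in> mod_hom R (quot_mod M H) N"
    by (rule mod_homI)
       (auto elim!: coset_cases simp: h coset_add coset_smult mod_homD[OF f])
  then show ?thesis using h that by blast
qed

text \<open>The first isomorphism theorem: the map induced by \<open>f\<close> through
  \<open>quot_mod_lift\<close> is injective because \<open>f\<close> kills exactly
  \<open>H\<close>.\<close>

lemma quot_mod_iso:
  assumes N: "module R N" and f: "f \<in> mod_hom R M N" and surj: "f ` carrier M = carrier N"
    and H: "\<And>x. x \<in> carrier M \<Longrightarrow> f x = \<zero>\<^bsub>N\<^esub> \<longleftrightarrow> x \<in> H"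
  shows "quot_mod M H \<cong>\<^bsub>R\<^esub> N"
proof -
  interpret N: module R N by fact
  obtain h where h: "h \<in> mod_hom R (quot_mod M H) N" "\<And>x. x \<in> carrier M \<Longrightarrow> h (H +>\<^bsub>M\<^esub> x) = f x"
    using quot_mod_lift[OF N f] H a_subset by blast
  have "inj_on h (carrier (quot_mod M H))"
  proof (rule inj_onI)
    fix U V assume "U \<in> carrier (quot_mod M H)" "V \<in> carrier (quot_mod M H)" "h U = h V"
    then obtain x y where xy: "x \<in> carrier M" "y \<in> carrier M" "U = H +>\<^bsub>M\<^esub> x" "V = H +>\<^bsub>M\<^esub> y" "f x = f y"
      by (metis coset_cases h(2))
    then have "f (x \<ominus>\<^bsub>M\<^esub> y) = \<zero>\<^bsub>N\<^esub>"
      using mod_hom_minus[OF module_axioms N f xy(1,2)] mod_homD(1)[OF f xy(2)]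
      by (simp add: N.minus_eq_zero_iff)
    then have "x \<ominus>\<^bsub>M\<^esub> y \<in> H" using H xy by simp
    then show "U = V" using xy by (simp add: coset_eq_iff)
  qed
  moreover have "h ` carrier (quot_mod M H) = carrier N"
  proof
    show "h ` carrier (quot_mod M H) \<subseteq> carrier N" using mod_homD(1)[OF h(1)] by blast
    show "carrier N \<subseteq> h ` carrier (quot_mod M H)"
    proof
      fix y assume "y \<in> carrier N"
      then obtain x where "x \<in> carrier M" "y = f x" using surj by blast
      then show "y \<in> h ` carrier (quot_mod M H)"
        by (intro image_eqI[of _ _ "H +>\<^bsub>M\<^esub> x"]) (simp_all add: h(2) coset_carrier)
    qed
  qed
  ultimately show ?thesis using h(1) unfolding mod_iso_def bij_betw_def by blast
qed

end

text \<open>A homology module \<open>Z / B\<close> is computed by transporting a known description of \<open>Z' / B'\<close>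
  along maps that are mutually inverse up to boundaries.\<close>

lemma homology_iso:
  assumes C: "module R C" and N: "module R N" and W: "module R W"
    and Z: "submodule Z R C" and B: "submodule B R C" "B \<subseteq> Z"
    and \<phi>: "\<phi> \<in> mod_hom R C N" "\<And>z. z \<in> Z \<Longrightarrow> \<phi> z \<in> Z'" "\<And>z. z \<in> B \<Longrightarrow> \<phi> z \<in> B'"
    and \<psi>: "\<And>y. y \<in> Z' \<Longrightarrow> \<psi> y \<in> Z" "\<And>y. y \<in> B' \<Longrightarrow> \<psi> y \<in> B"
    and \<psi>\<phi>: "\<And>z. z \<in> Z \<Longrightarrow> \<psi> (\<phi> z) \<ominus>\<^bsub>C\<^esub> z \<in> B"
    and \<phi>\<psi>: "\<And>y. y \<in> Z' \<Longrightarrow> \<phi> (\<psi> y) \<ominus>\<^bsub>N\<^esub> y \<in> B'"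
    and Z': "submodule Z' R N"
    and \<theta>: "\<theta> \<in> mod_hom R (N\<lparr>carrier := Z'\<rparr>) W" "\<theta> ` Z' = carrier W"
      "\<And>y. y \<in> Z' \<Longrightarrow> \<theta> y = \<zero>\<^bsub>W\<^esub> \<longleftrightarrow> y \<in> B'"
  shows "quot_mod (C\<lparr>carrier := Z\<rparr>) B \<cong>\<^bsub>R\<^esub> W"
proof -
  interpret C: module R C by fact
  interpret N: module R N by fact
  interpret W: module R W by fact
  note ZC = C.submoduleE(1)[OF Z] and ZN = N.submoduleE(1)[OF Z']
  have CZ: "module R (C\<lparr>carrier := Z\<rparr>)" using submodule.submodule_is_module[OF Z C] .
  interpret CZ: module R "C\<lparr>carrier := Z\<rparr>" by (rule CZ)
  have NZ: "module R (N\<lparr>carrier := Z'\<rparr>)" using submodule.submodule_is_module[OF Z' N] .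
  \<comment> \<open>An element homologous to a boundary is a boundary. It is applied with
    \<open>y\<close> the image of a cycle \<open>x\<close> under the two comparison maps.\<close>
  have minusB: "x \<in> B" if "x \<in> Z" "y \<in> B" "y \<ominus>\<^bsub>C\<^esub> x \<in> B" for x y
  proof -
    have "x = y \<oplus>\<^bsub>C\<^esub> \<ominus>\<^bsub>C\<^esub> (y \<ominus>\<^bsub>C\<^esub> x)"
      using that ZC B(2) by (auto simp: C.minus_add a_minus_def C.M.a_assoc[symmetric] C.r_neg subset_iff)
    then show ?thesis using C.submoduleE(3,5)[OF B(1)] that by metis
  qed
  \<comment> \<open>The quotient is taken inside the cycles, so \<open>B\<close> has to be a
    submodule of \<open>Z\<close> and not only of \<open>C\<close>.\<close>
  have BZ: "submodule B R (C\<lparr>carrier := Z\<rparr>)"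
    using CZ.module_incl_imp_submodule[of B] B(2) submodule.submodule_is_module[OF B(1) C] by simp
  interpret Q: quotient_module R "C\<lparr>carrier := Z\<rparr>" B
    by (rule quotient_module.intro[OF CZ quotient_module_axioms.intro[OF BZ]])
  have \<phi>Z: "\<phi> \<in> mod_hom R (C\<lparr>carrier := Z\<rparr>) (N\<lparr>carrier := Z'\<rparr>)"
    by (rule mod_hom_restrict_carrier[OF \<phi>(1) ZC \<phi>(2)])
  show ?thesis
  proof (rule Q.quot_mod_iso[OF W mod_hom_compose[OF \<phi>Z \<theta>(1)]])
    show "(\<lambda>x. \<theta> (\<phi> x)) ` carrier (C\<lparr>carrier := Z\<rparr>) = carrier W"
    proof
      show "(\<lambda>x. \<theta> (\<phi> x)) ` carrier (C\<lparr>carrier := Z\<rparr>) \<subseteq> carrier W"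
        using \<phi>(2) \<theta>(2) by auto
      show "carrier W \<subseteq> (\<lambda>x. \<theta> (\<phi> x)) ` carrier (C\<lparr>carrier := Z\<rparr>)"
      proof
        fix w assume "w \<in> carrier W"
        then obtain y where y: "y \<in> Z'" "w = \<theta> y" using \<theta>(2) by blast
        let ?z = "\<phi> (\<psi> y)"
        have z: "?z \<in> Z'" "?z \<ominus>\<^bsub>N\<^esub> y \<in> B'" using y \<phi>(2) \<psi>(1) \<phi>\<psi> by auto
        have zZ: "?z \<ominus>\<^bsub>N\<^esub> y \<in> Z'" using z(1) y N.submoduleE(3,5)[OF Z'] by (simp add: a_minus_def)
        then have "\<theta> (?z \<ominus>\<^bsub>N\<^esub> y) = \<zero>\<^bsub>W\<^esub>" using \<theta>(3) z by simp
        \<comment> \<open>\<open>\<theta>\<close> respects the operations of \<open>N\<close> with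
          carrier cut down to \<open>Z'\<close>, where the negative is formed relative to the
          smaller carrier. Scaling by -1 involves only operations that both records share.\<close>
        moreover have "\<theta> (?z \<ominus>\<^bsub>N\<^esub> y) = \<theta> (?z \<oplus>\<^bsub>N\<^esub> \<ominus>\<^bsub>R\<^esub> \<one>\<^bsub>R\<^esub> \<odot>\<^bsub>N\<^esub> y)"
          using y ZN by (auto simp: a_minus_def N.smult_l_minus subset_iff)
        moreover have "\<ominus>\<^bsub>R\<^esub> \<one>\<^bsub>R\<^esub> \<odot>\<^bsub>N\<^esub> y \<in> Z'" using N.submoduleE(4)[OF Z'] y by blast
        ultimately have "\<theta> ?z \<oplus>\<^bsub>W\<^esub> (\<ominus>\<^bsub>R\<^esub> \<one>\<^bsub>R\<^esub> \<odot>\<^bsub>W\<^esub> \<theta> y) = \<zero>\<^bsub>W\<^esub>"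
          using mod_homD(2,3)[OF \<theta>(1)] z(1) y by simp
        then have "\<theta> ?z = \<theta> y"
          using mod_homD(1)[OF \<theta>(1)] z(1) y by (simp add: W.smult_l_minus W.minus_eq_zero_iff flip: a_minus_def)
        then show "w \<in> (\<lambda>x. \<theta> (\<phi> x)) ` carrier (C\<lparr>carrier := Z\<rparr>)"
          using y \<psi>(1) by (auto intro!: image_eqI[of _ _ "\<psi> y"])
      qed
    qed
    \<comment> \<open>If \<open>\<phi> z\<close> lies in \<open>B'\<close>, then
      \<open>\<psi>\<close> carries it into \<open>B\<close>, and \<open>z\<close> differs from the
      result by a boundary. The converse is that \<open>\<phi>\<close> maps \<open>B\<close> into
      \<open>B'\<close>.\<close>
    show "\<theta> (\<phi> z) = \<zero>\<^bsub>W\<^esub> \<longleftrightarrow> z \<in> B" if "z \<in> carrier (C\<lparr>carrier := Z\<rparr>)" for z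
      using that \<theta>(3) \<phi>(2,3) \<psi>(2) \<psi>\<phi> minusB by (auto, metis)
  qed
qed

section \<open>Free modules are projective\<close>

text \<open>Induction over a finite set containing the support: a nonzero coefficient at
  \<open>t\<close> is split off as a multiple of the generator at \<open>t\<close>, and what remains
  is supported in the smaller set.\<close>

lemma free_mod_generated:
  assumes R: "cring R" and H: "submodule H R (free_mod R S)"
    and gen: "\<And>s. s \<in> S \<Longrightarrow> free_gen R s \<in> H"
  shows "H = carrier (free_mod R S)"
proof
  interpret cring R by fact
  interpret P: module R "free_mod R S" by (rule free_mod_module[OF R])
  show "H \<subseteq> carrier (free_mod R S)" by (rule P.submoduleE(1)[OF H])
  have "c \<in> H" if "finite T" "c \<in> carrier (free_mod R S)" "{s. c s \<noteq> \<zero>\<^bsub>R\<^esub>} \<subseteq> T" for T c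
    using that
  proof (induction T arbitrary: c)
    case empty
    then have "c = \<zero>\<^bsub>free_mod R S\<^esub>" by (auto simp: free_mod_simps)
    then show ?case using P.submoduleE(2,4)[OF H] P.smult_l_null P.submoduleE(1)[OF H]
      by (metis zero_closed all_not_in_conv subset_iff)
  next
    case (insert t T)
    have cs: "c s \<in> carrier R" for s by (rule free_mod_coeff[OF R insert.prems(1)])
    show ?case
    proof (cases "c t = \<zero>\<^bsub>R\<^esub>")
      case True
      then show ?thesis using insert by blast
    next
      case False
      then have t: "t \<in> S" using insert.prems(1) by (auto simp: free_mod_simps)
      let ?c = "c(t := \<zero>\<^bsub>R\<^esub>)"
      have "finite {s. ?c s \<noteq> \<zero>\<^bsub>R\<^esub>}"
        by (rule finite_subset[of _ "{s. c s \<noteq> \<zero>\<^bsub>R\<^esub>}"]) (use insert.prems in \<open>auto simp: free_mod_simps\<close>)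
      then have "?c \<in> carrier (free_mod R S)" using insert.prems(1) by (auto simp: free_mod_simps)
      then have "?c \<in> H" by (rule insert.IH) (use insert.prems in auto)
      moreover have "c t \<odot>\<^bsub>free_mod R S\<^esub> free_gen R t \<in> H"
        using P.submoduleE(4)[OF H] gen[OF t] cs by blast
      moreover have "c = c t \<odot>\<^bsub>free_mod R S\<^esub> free_gen R t \<oplus>\<^bsub>free_mod R S\<^esub> ?c"
        by (rule ext) (use cs in \<open>auto simp: free_mod_simps free_gen_def\<close>)
      ultimately show ?thesis using P.submoduleE(5)[OF H] by metis
    qed
  qed
  then show "carrier (free_mod R S) \<subseteq> H" by (auto simp: free_mod_simps)
qed

lemma free_mod_hom_eqI:
  assumes M: "module R M" and f: "f \<in> mod_hom R (free_mod R S) M" and g: "g \<in> mod_hom R (free_mod R S) M"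
    and gen: "\<And>s. s \<in> S \<Longrightarrow> f (free_gen R s) = g (free_gen R s)"
    and c: "c \<in> carrier (free_mod R S)"
  shows "f c = g c"
proof -
  interpret module R M by fact
  have R: "cring R" by (rule R.is_cring)
  have "{x \<in> carrier (free_mod R S). f x = g x} = carrier (free_mod R S)"
    by (rule free_mod_generated[OF R mod_hom_equalizer_submodule[OF free_mod_module[OF R] M f g]])
       (simp add: gen free_gen_carrier[OF R])
  then show ?thesis using c by blast
qed

text \<open>Projectivity: choose preimages under \<open>u\<close> for the images of the basis and
  extend linearly. The condition compares images instead of asking \<open>u\<close> to be onto
  \<open>H\<close>, since in a resolution \<open>u\<close> is a boundary map, which reaches only a
  kernel.\<close>

lemma free_module_lift:
  fixes F :: "('a, 'c, 'm) module_scheme"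
  assumes F: "free_module R F" and G: "module R G" and H: "module R H"
    and f: "f \<in> mod_hom R F H" and u: "u \<in> mod_hom R G H"
    and fu: "f ` carrier F \<subseteq> u ` carrier G"
  obtains s where "s \<in> mod_hom R F G" "\<And>x. x \<in> carrier F \<Longrightarrow> u (s x) = f x"
proof -
  interpret G: module R G by fact
  have R: "cring R" by (rule G.R.is_cring)
  obtain S :: "'c set" and \<phi> where \<phi>: "\<phi> \<in> mod_hom R (free_mod R S) F" "bij_betw \<phi> (carrier (free_mod R S)) (carrier F)"
    using F unfolding free_module_def mod_iso_def by blast
  have "\<exists>y. y \<in> carrier G \<and> u y = f (\<phi> (free_gen R b))" if "b \<in> S" for b
  proof -
    have "\<phi> (free_gen R b) \<in> carrier F"
      using \<phi>(1) free_gen_carrier[OF R that] by (auto dest: mod_homD(1))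
    then show ?thesis using fu by (metis imageE image_subset_iff)
  qed
  then obtain g where g: "\<And>b. b \<in> S \<Longrightarrow> g b \<in> carrier G \<and> u (g b) = f (\<phi> (free_gen R b))" by metis
  then obtain h where h: "h \<in> mod_hom R (free_mod R S) G" "\<And>b. b \<in> S \<Longrightarrow> h (free_gen R b) = g b"
    using free_mod_lift[OF G, of g S] by auto
  let ?i = "inv_into (carrier (free_mod R S)) \<phi>"
  have i: "?i \<in> mod_hom R F (free_mod R S)"
    by (rule mod_hom_inv_into[OF free_mod_module[OF R] \<phi>])
  have uh: "u (h c) = f (\<phi> c)" if "c \<in> carrier (free_mod R S)" for c
    using H mod_hom_compose[OF h(1) u] mod_hom_compose[OF \<phi>(1) f] _ that
    by (rule free_mod_hom_eqI) (simp add: g h(2))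
  have "u (h (?i x)) = f x" if "x \<in> carrier F" for x
    using that \<phi>(2) mod_homD(1)[OF i] by (simp add: uh bij_betw_inv_into_right)
  then show ?thesis using that mod_hom_compose[OF i h(1)] by blast
qed

lemma hom_module_self_module:
  assumes "cring R" shows "module R (hom_module (\<lambda>a. a) R)"
proof -
  interpret cring R by fact
  show ?thesis
    by (rule moduleI[OF assms abelian_groupI])
       (auto simp: hom_module_def a_ac l_distr r_distr m_assoc intro: bexI[of _ "\<ominus>\<^bsub>R\<^esub> _"] l_neg)
qed

lemma hom_module_self_free:
  assumes R: "cring R" shows "free_module R (hom_module (\<lambda>a. a) R)"
proof -
  interpret cring R by fact
  \<comment> \<open>\<open>free_module\<close> takes its index set among the elements of the module,
    so the one-point index set is {1}.\<close>
  let ?P = "free_mod R {\<one>\<^bsub>R\<^esub>}"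
  have "(\<lambda>c. c \<one>\<^bsub>R\<^esub>) \<in> mod_hom R ?P (hom_module (\<lambda>a. a) R)"
    by (auto simp: mod_hom_def free_mod_simps hom_module_def)
  moreover have "bij_betw (\<lambda>c. c \<one>\<^bsub>R\<^esub>) (carrier ?P) (carrier (hom_module (\<lambda>a. a) R))"
  proof (rule bij_betwI[where g = "\<lambda>a s. if s = \<one>\<^bsub>R\<^esub> then a else \<zero>\<^bsub>R\<^esub>"])
    have "finite {s. (if s = \<one>\<^bsub>R\<^esub> then a else \<zero>\<^bsub>R\<^esub>) \<noteq> \<zero>\<^bsub>R\<^esub>}" for a
      by (rule finite_subset[of _ "{\<one>\<^bsub>R\<^esub>}"]) auto
    then show "(\<lambda>a s. if s = \<one>\<^bsub>R\<^esub> then a else \<zero>\<^bsub>R\<^esub>) \<in> carrier (hom_module (\<lambda>a. a) R) \<rightarrow> carrier ?P"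
      by (auto simp: free_mod_simps hom_module_def)
  qed (auto simp: free_mod_simps hom_module_def)
  ultimately show ?thesis
    using hom_module_self_module[OF R] by (auto simp: free_module_def mod_iso_def)
qed

section \<open>Tensor products and modules of homomorphisms\<close>

lemma (in module) mod_span_submodule:
  assumes "G \<subseteq> carrier M"
  shows "submodule (mod_span R M G) R M"
proof (rule submoduleI)
  show "mod_span R M G \<subseteq> carrier M"
    using carrier_is_submodule assms by (auto simp: mod_span_def)
  show "\<zero>\<^bsub>M\<^esub> \<in> mod_span R M G"
    by (auto simp: mod_span_def submodule_def dest: subgroup.one_closed)
qed (auto simp: mod_span_def intro: submoduleE)

lemma mod_span_superset: "G \<subseteq> mod_span R M G"
  by (auto simp: mod_span_def)

lemma mod_span_minimal: "submodule H R M \<Longrightarrow> G \<subseteq> H \<Longrightarrow> mod_span R M G \<subseteq> H"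
  by (auto simp: mod_span_def)

locale module_pair = M: module R M + N: module R N
  for R (structure) and M :: "('a, 'b, 'm) module_scheme" and N :: "('a, 'c, 'n) module_scheme"
begin

abbreviation "P \<equiv> free_mod R (carrier M \<times> carrier N)"

sublocale P: module R P
  by (rule free_mod_module[OF M.R.is_cring])

lemma gen_closed: "x \<in> carrier M \<Longrightarrow> y \<in> carrier N \<Longrightarrow> free_gen R (x, y) \<in> carrier P"
  by (rule free_gen_carrier[OF M.R.is_cring]) simp

lemma tensor_rels_carrier: "tensor_rels R M N \<subseteq> carrier P"
  unfolding tensor_rels_def Let_def by (auto intro!: P.M.minus_closed P.M.add.m_closed P.smult_closed gen_closed)

sublocale Q: quotient_module R P "tensor_null R M N"
  unfolding tensor_null_def
  by (rule quotient_module.intro[OF P.module_axioms quotient_module_axioms.intro[OF P.mod_span_submodule[OF tensor_rels_carrier]]])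

lemma tensor_module: "module R (tensor R M N)"
  unfolding tensor_def by (rule Q.quot_mod_module)

lemma pure_tensor_closed:
  "x \<in> carrier M \<Longrightarrow> y \<in> carrier N \<Longrightarrow> pure_tensor R M N x y \<in> carrier (tensor R M N)"
  unfolding tensor_def pure_tensor_def by (intro Q.coset_carrier gen_closed)

lemma tensor_null_rels: "r \<in> tensor_rels R M N \<Longrightarrow> r \<in> tensor_null R M N"
  unfolding tensor_null_def by (rule subsetD[OF mod_span_superset])

lemma pure_tensor_add_left:
  assumes "x \<in> carrier M" "x' \<in> carrier M" "y \<in> carrier N"
  shows "pure_tensor R M N (x \<oplus>\<^bsub>M\<^esub> x') y = pure_tensor R M N x y \<oplus>\<^bsub>tensor R M N\<^esub> pure_tensor R M N x' y"
proof -
  have "free_gen R (x \<oplus>\<^bsub>M\<^esub> x', y) \<ominus>\<^bsub>P\<^esub> (free_gen R (x, y) \<oplus>\<^bsub>P\<^esub> free_gen R (x', y)) \<in> tensor_null R M N"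
    by (rule tensor_null_rels) (unfold tensor_rels_def Let_def, use assms in blast)
  then show ?thesis
    using assms unfolding tensor_def pure_tensor_def
    by (simp add: Q.coset_eq_iff Q.coset_add gen_closed P.M.add.m_closed)
qed

lemma pure_tensor_add_right:
  assumes "x \<in> carrier M" "y \<in> carrier N" "y' \<in> carrier N"
  shows "pure_tensor R M N x (y \<oplus>\<^bsub>N\<^esub> y') = pure_tensor R M N x y \<oplus>\<^bsub>tensor R M N\<^esub> pure_tensor R M N x y'"
proof -
  have "free_gen R (x, y \<oplus>\<^bsub>N\<^esub> y') \<ominus>\<^bsub>P\<^esub> (free_gen R (x, y) \<oplus>\<^bsub>P\<^esub> free_gen R (x, y')) \<in> tensor_null R M N"
    by (rule tensor_null_rels) (unfold tensor_rels_def Let_def, use assms in blast)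
  then show ?thesis
    using assms unfolding tensor_def pure_tensor_def
    by (simp add: Q.coset_eq_iff Q.coset_add gen_closed P.M.add.m_closed)
qed

lemma pure_tensor_smult_left:
  assumes "a \<in> carrier R" "x \<in> carrier M" "y \<in> carrier N"
  shows "pure_tensor R M N (a \<odot>\<^bsub>M\<^esub> x) y = a \<odot>\<^bsub>tensor R M N\<^esub> pure_tensor R M N x y"
proof -
  have "free_gen R (a \<odot>\<^bsub>M\<^esub> x, y) \<ominus>\<^bsub>P\<^esub> a \<odot>\<^bsub>P\<^esub> free_gen R (x, y) \<in> tensor_null R M N"
    by (rule tensor_null_rels) (unfold tensor_rels_def Let_def, use assms in blast)
  then show ?thesis
    using assms unfolding tensor_def pure_tensor_def
    by (simp add: Q.coset_eq_iff Q.coset_smult gen_closed P.smult_closed)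
qed

lemma pure_tensor_smult_right:
  assumes "a \<in> carrier R" "x \<in> carrier M" "y \<in> carrier N"
  shows "pure_tensor R M N x (a \<odot>\<^bsub>N\<^esub> y) = a \<odot>\<^bsub>tensor R M N\<^esub> pure_tensor R M N x y"
proof -
  have "free_gen R (x, a \<odot>\<^bsub>N\<^esub> y) \<ominus>\<^bsub>P\<^esub> a \<odot>\<^bsub>P\<^esub> free_gen R (x, y) \<in> tensor_null R M N"
    by (rule tensor_null_rels) (unfold tensor_rels_def Let_def, use assms in blast)
  then show ?thesis
    using assms unfolding tensor_def pure_tensor_def
    by (simp add: Q.coset_eq_iff Q.coset_smult gen_closed P.smult_closed)
qed

lemma pure_tensor_hom: "x \<in> carrier M \<Longrightarrow> pure_tensor R M N x \<in> mod_hom R N (tensor R M N)"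
  by (rule mod_homI) (simp_all add: pure_tensor_closed pure_tensor_add_right pure_tensor_smult_right)

text \<open>Composing with the coset map moves the comparison to the free module on pairs, where
  generators decide. Later identities between maps out of a tensor product are checked on pure
  tensors in this way.\<close>

lemma tensor_hom_eqI:
  assumes W: "module R W" and f: "f \<in> mod_hom R (tensor R M N) W" and g: "g \<in> mod_hom R (tensor R M N) W"
    and pure: "\<And>x y. x \<in> carrier M \<Longrightarrow> y \<in> carrier N \<Longrightarrow> f (pure_tensor R M N x y) = g (pure_tensor R M N x y)"
    and z: "z \<in> carrier (tensor R M N)"
  shows "f z = g z"
proof -
  obtain c where c: "c \<in> carrier P" "z = tensor_null R M N +>\<^bsub>P\<^esub> c"
    using Q.coset_cases z unfolding tensor_def by metis
  have "(\<lambda>c. f (tensor_null R M N +>\<^bsub>P\<^esub> c)) \<in> mod_hom R P W"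
    "(\<lambda>c. g (tensor_null R M N +>\<^bsub>P\<^esub> c)) \<in> mod_hom R P W"
    using mod_hom_compose[OF Q.coset_hom] f g unfolding tensor_def by blast+
  from free_mod_hom_eqI[OF W this _ c(1)] show ?thesis
    using pure unfolding c(2) pure_tensor_def by blast
qed

text \<open>The universal property. Bilinearity of \<open>\<beta>\<close> puts each of the four
  families of relations into the kernel of the linear extension \<open>f\<close>; that kernel is a
  submodule, so it contains their span \<open>tensor_null\<close>.\<close>

lemma tensor_lift:
  assumes W: "module R W"
    and left: "\<And>y. y \<in> carrier N \<Longrightarrow> (\<lambda>x. \<beta> x y) \<in> mod_hom R M W"
    and right: "\<And>x. x \<in> carrier M \<Longrightarrow> \<beta> x \<in> mod_hom R N W"
  obtains h where "h \<in> mod_hom R (tensor R M N) W"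
    "\<And>x y. x \<in> carrier M \<Longrightarrow> y \<in> carrier N \<Longrightarrow> h (pure_tensor R M N x y) = \<beta> x y"
proof -
  interpret W: module R W by fact
  have \<beta>: "\<beta> x y \<in> carrier W" if "x \<in> carrier M" "y \<in> carrier N" for x y
    using mod_homD(1)[OF right] that by blast
  then have "(\<lambda>(x, y). \<beta> x y) \<in> carrier M \<times> carrier N \<rightarrow> carrier W" by auto
  then obtain f where f: "f \<in> mod_hom R P W"
      "\<And>x y. x \<in> carrier M \<Longrightarrow> y \<in> carrier N \<Longrightarrow> f (free_gen R (x, y)) = \<beta> x y"
    using free_mod_lift[OF W, of "\<lambda>(x, y). \<beta> x y" "carrier M \<times> carrier N"] by auto
  note ff = mod_homD[OF f(1)] mod_hom_minus[OF P.module_axioms W f(1)]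
  have "tensor_rels R M N \<subseteq> a_kernel P W f"
    using \<beta> unfolding tensor_rels_def Let_def
    by (auto simp: a_kernel_iff f(2) ff gen_closed mod_homD(2,3)[OF left] mod_homD(2,3)[OF right]
          W.minus_eq_zero_iff P.M.minus_closed)
  then have "f c = \<zero>\<^bsub>W\<^esub>" if "c \<in> tensor_null R M N" for c
    using mod_span_minimal[OF mod_hom_kernel_submodule[OF P.module_axioms W f(1)], of "tensor_rels R M N"] that
    unfolding tensor_null_def by (auto simp: a_kernel_iff)
  from Q.quot_mod_lift[OF W f(1) this] obtain h
    where "h \<in> mod_hom R (tensor R M N) W" "\<And>c. c \<in> carrier P \<Longrightarrow> h (tensor_null R M N +>\<^bsub>P\<^esub> c) = f c"
    unfolding tensor_def by blast
  then show ?thesis using that f(2) gen_closed unfolding pure_tensor_def by metis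
qed

end

text \<open>\<open>tensor_map\<close> is a definite description, so nothing is known of it before
  existence and uniqueness are shown: the former is \<open>tensor_lift\<close>, the latter
  \<open>tensor_hom_eqI\<close>.\<close>

lemma tensor_map:
  assumes M: "module R M" and M': "module R M'" and N: "module R N" and f: "f \<in> mod_hom R M M'"
  shows "tensor_map R M M' N f \<in> mod_hom R (tensor R M N) (tensor R M' N)"
    and "x \<in> carrier M \<Longrightarrow> y \<in> carrier N \<Longrightarrow>
      tensor_map R M M' N f (pure_tensor R M N x y) = pure_tensor R M' N (f x) y"
proof -
  interpret T: module_pair R M N by (intro module_pair.intro M N)
  interpret T': module_pair R M' N by (intro module_pair.intro M' N)
  note ff = mod_homD[OF f]
  define good where "good h \<longleftrightarrow>
     h \<in> mod_hom R (tensor R M N) (tensor R M' N) \<inter> extensional (carrier (tensor R M N)) \<and>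
     (\<forall>x \<in> carrier M. \<forall>y \<in> carrier N. h (pure_tensor R M N x y) = pure_tensor R M' N (f x) y)" for h
  obtain h where h: "h \<in> mod_hom R (tensor R M N) (tensor R M' N)"
    "\<And>x y. x \<in> carrier M \<Longrightarrow> y \<in> carrier N \<Longrightarrow> h (pure_tensor R M N x y) = pure_tensor R M' N (f x) y"
  proof (rule T.tensor_lift[OF T'.tensor_module, where \<beta> = "\<lambda>x y. pure_tensor R M' N (f x) y"])
    show "(\<lambda>x. pure_tensor R M' N (f x) y) \<in> mod_hom R M (tensor R M' N)" if "y \<in> carrier N" for y
      by (rule mod_homI)
         (simp_all add: that ff T'.pure_tensor_closed T'.pure_tensor_add_left T'.pure_tensor_smult_left)
    show "pure_tensor R M' N (f x) \<in> mod_hom R N (tensor R M' N)" if "x \<in> carrier M" for x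
      by (rule T'.pure_tensor_hom) (rule ff(1)[OF that])
  qed (rule that)
  \<comment> \<open>Restricting makes the lift extensional, which fixes its values outside the
    carrier and so makes the description unique.\<close>
  have ex: "good (restrict h (carrier (tensor R M N)))"
    unfolding good_def
    using h T.pure_tensor_closed by (auto intro: mod_hom_cong[OF h(1) T.tensor_module])
  have unique: "h1 = h2" if "good h1" "good h2" for h1 h2
  proof (rule extensionalityI)
    show "h1 z = h2 z" if "z \<in> carrier (tensor R M N)" for z
      by (rule T.tensor_hom_eqI[OF T'.tensor_module _ _ _ that]) (use \<open>good h1\<close> \<open>good h2\<close> in \<open>auto simp: good_def\<close>)
  qed (use that in \<open>auto simp: good_def\<close>)
  have "good (tensor_map R M M' N f)"
    unfolding tensor_map_def good_def[symmetric] by (rule theI[of good, OF ex unique[OF _ ex]])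
  then show "tensor_map R M M' N f \<in> mod_hom R (tensor R M N) (tensor R M' N)"
    and "x \<in> carrier M \<Longrightarrow> y \<in> carrier N \<Longrightarrow>
      tensor_map R M M' N f (pure_tensor R M N x y) = pure_tensor R M' N (f x) y"
    by (auto simp: good_def)
qed

section \<open>The module of homomorphisms\<close>

lemma Hom_mod_carrier: "f \<in> carrier (Hom_mod R M N) \<longleftrightarrow> f \<in> mod_hom R M N \<and> f \<in> extensional (carrier M)"
  by (simp add: Hom_mod_def)

lemma restrict_Hom_mod:
  assumes "module R M" "f \<in> mod_hom R M N"
  shows "restrict f (carrier M) \<in> carrier (Hom_mod R M N)"
  using mod_hom_cong[OF assms(2,1)] by (auto simp: Hom_mod_carrier)

lemma Hom_mod_module:
  fixes M :: "('a, 'b, 'm) module_scheme" and N :: "('a, 'c, 'n) module_scheme"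
  assumes M: "module R M" and N: "module R N"
  shows "module R (Hom_mod R M N)"
proof -
  interpret M: module R M by fact
  interpret N: module R N by fact
  note hom = mod_homD[where M = M and N = N and R = R]
  have add: "f \<oplus>\<^bsub>Hom_mod R M N\<^esub> g \<in> carrier (Hom_mod R M N)"
    if "f \<in> carrier (Hom_mod R M N)" "g \<in> carrier (Hom_mod R M N)" for f g
    using restrict_Hom_mod[OF M mod_hom_add[OF N, where M = M]] that by (simp add: Hom_mod_def)
  have smult: "a \<odot>\<^bsub>Hom_mod R M N\<^esub> f \<in> carrier (Hom_mod R M N)"
    if "a \<in> carrier R" "f \<in> carrier (Hom_mod R M N)" for a f
    using restrict_Hom_mod[OF M mod_hom_smult[OF N, where M = M]] that by (simp add: Hom_mod_def)
  have zero: "\<zero>\<^bsub>Hom_mod R M N\<^esub> \<in> carrier (Hom_mod R M N)"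
    using restrict_Hom_mod[OF M, of "\<lambda>x. \<zero>\<^bsub>N\<^esub>" N] by (simp add: Hom_mod_def mod_hom_def)
  \<comment> \<open>Elements of the Hom module are extensional, so each module axiom reduces to a
    pointwise identity in \<open>N\<close>.\<close>
  have eqI: "f = g" if "f \<in> extensional (carrier M)" "g \<in> extensional (carrier M)"
    "\<And>x. x \<in> carrier M \<Longrightarrow> f x = g x" for f g :: "'b \<Rightarrow> 'c"
    using that by (rule extensionalityI)
  have ops: "(f \<oplus>\<^bsub>Hom_mod R M N\<^esub> g) x = f x \<oplus>\<^bsub>N\<^esub> g x" "(a \<odot>\<^bsub>Hom_mod R M N\<^esub> f) x = a \<odot>\<^bsub>N\<^esub> f x"
    "\<zero>\<^bsub>Hom_mod R M N\<^esub> x = \<zero>\<^bsub>N\<^esub>" if "x \<in> carrier M" for f g a x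
    using that by (simp_all add: Hom_mod_def)
  have cl: "f x \<in> carrier N" if "f \<in> carrier (Hom_mod R M N)" "x \<in> carrier M" for f x
    using that hom(1) by (simp add: Hom_mod_carrier)
  have ext: "f \<in> extensional (carrier M)" if "f \<in> carrier (Hom_mod R M N)" for f
    using that by (simp add: Hom_mod_carrier)
  show ?thesis
  proof (rule moduleI[OF M.R.is_cring])
    show "abelian_group (Hom_mod R M N)"
    proof (rule abelian_groupI)
      fix f assume f: "f \<in> carrier (Hom_mod R M N)"
      show "\<exists>g\<in>carrier (Hom_mod R M N). g \<oplus>\<^bsub>Hom_mod R M N\<^esub> f = \<zero>\<^bsub>Hom_mod R M N\<^esub>"
      proof (rule bexI)
        show g: "(\<ominus>\<^bsub>R\<^esub> \<one>\<^bsub>R\<^esub>) \<odot>\<^bsub>Hom_mod R M N\<^esub> f \<in> carrier (Hom_mod R M N)"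
          using smult f by simp
        show "(\<ominus>\<^bsub>R\<^esub> \<one>\<^bsub>R\<^esub>) \<odot>\<^bsub>Hom_mod R M N\<^esub> f \<oplus>\<^bsub>Hom_mod R M N\<^esub> f = \<zero>\<^bsub>Hom_mod R M N\<^esub>"
          by (rule eqI) (use ext[OF add[OF g f]] ext[OF zero] in
            \<open>auto simp: ops cl[OF f] N.smult_l_minus N.l_neg\<close>)
      qed
    qed (rule add zero eqI; auto intro!: ext add zero simp: ops cl N.M.a_ac add zero)+
  qed (rule smult eqI; auto intro!: ext add zero smult simp: ops cl add smult N.smult_l_distr N.smult_r_distr N.smult_assoc1)+
qed

section \<open>Comparison of free resolutions\<close>

lemma free_resolutionD:
  assumes "free_resolution R M F d e"
  shows "module R M" "free_module R (F n)" "module R (F n)" "d n \<in> mod_hom R (F (Suc n)) (F n)"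
    "e \<in> mod_hom R (F 0) M" "e ` carrier (F 0) = carrier M"
    "x \<in> carrier (F 0) \<Longrightarrow> e x = \<zero>\<^bsub>M\<^esub> \<longleftrightarrow> x \<in> d 0 ` carrier (F (Suc 0))"
    "y \<in> carrier (F (Suc n)) \<Longrightarrow> d n y = \<zero>\<^bsub>F n\<^esub> \<longleftrightarrow> y \<in> d (Suc n) ` carrier (F (Suc (Suc n)))"
  using assms unfolding free_resolution_def free_module_def by (metis a_kernel_iff)+

lemma free_resolution_complex:
  assumes "free_resolution R M F d e"
  shows "x \<in> carrier (F (Suc 0)) \<Longrightarrow> e (d 0 x) = \<zero>\<^bsub>M\<^esub>"
    and "y \<in> carrier (F (Suc (Suc n))) \<Longrightarrow> d n (d (Suc n) y) = \<zero>\<^bsub>F n\<^esub>"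
proof -
  note D = free_resolutionD[OF assms] and d = mod_homD(1)[OF free_resolutionD(4)[OF assms]]
  show "x \<in> carrier (F (Suc 0)) \<Longrightarrow> e (d 0 x) = \<zero>\<^bsub>M\<^esub>" using D(7)[OF d] by blast
  show "y \<in> carrier (F (Suc (Suc n))) \<Longrightarrow> d n (d (Suc n) y) = \<zero>\<^bsub>F n\<^esub>" using D(8)[OF d] by blast
qed

text \<open>The comparison theorem for lifts of the identity of \<open>M\<close>: the terms of
  \<open>F\<close> are projective, and \<open>G\<close> is exact, so each boundary that has to be
  hit can be hit.\<close>

lemma resolution_chain_map:
  assumes F: "free_resolution R M F d e" and G: "free_resolution R M G d' e'"
  obtains f where "\<And>n. f n \<in> mod_hom R (F n) (G n)"
    and "\<And>x. x \<in> carrier (F 0) \<Longrightarrow> e' (f 0 x) = e x"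
    and "\<And>n x. x \<in> carrier (F (Suc n)) \<Longrightarrow> d' n (f (Suc n) x) = f n (d n x)"
proof -
  note FD = free_resolutionD[OF F] and GD = free_resolutionD[OF G]
  note dF = mod_homD[OF FD(4)]
  \<comment> \<open>The invariant must permit the next lift: \<open>f\<close> sends boundaries to
    boundaries. In degree 0 this follows from the augmentations, afterwards from exactness of
    \<open>G\<close>, since d d = 0. The guarded conjunct keeps the augmentation condition for the
    first map only.\<close>
  let ?ok = "\<lambda>n f. f \<in> mod_hom R (F n) (G n) \<and> (n = 0 \<longrightarrow> (\<forall>x \<in> carrier (F 0). e' (f x) = e x)) \<and>
    (\<forall>x \<in> carrier (F (Suc n)). f (d n x) \<in> d' n ` carrier (G (Suc n)))"
  let ?step = "\<lambda>n f g. \<forall>x \<in> carrier (F (Suc n)). d' n (g x) = f (d n x)"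
  have "\<exists>f. \<forall>n. ?ok n (f n) \<and> ?step n (f n) (f (Suc n))"
  proof (rule dependent_nat_choice)
    obtain f where f: "f \<in> mod_hom R (F 0) (G 0)" "\<And>x. x \<in> carrier (F 0) \<Longrightarrow> e' (f x) = e x"
      by (rule free_module_lift[OF FD(2) GD(3) FD(1) FD(5) GD(5)]) (use FD(6) GD(6) in auto)
    have "f (d 0 x) \<in> d' 0 ` carrier (G (Suc 0))" if "x \<in> carrier (F (Suc 0))" for x
      using f that GD(7) mod_homD(1)[OF f(1)] dF(1) free_resolution_complex(1)[OF F] by metis
    then show "\<exists>f. ?ok 0 f" using f by auto
  next
    fix n f assume f: "?ok n f"
    note fh = mod_homD[OF conjunct1[OF f]]
    have "(\<lambda>x. f (d n x)) \<in> mod_hom R (F (Suc n)) (G n)"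
      using mod_hom_compose[OF FD(4)] f by blast
    then obtain g where g: "g \<in> mod_hom R (F (Suc n)) (G (Suc n))"
      "\<And>x. x \<in> carrier (F (Suc n)) \<Longrightarrow> d' n (g x) = f (d n x)"
      by (rule free_module_lift[OF FD(2) GD(3) GD(3) _ GD(4)]) (use f in auto)
    have "g (d (Suc n) x) \<in> d' (Suc n) ` carrier (G (Suc (Suc n)))" if "x \<in> carrier (F (Suc (Suc n)))" for x
    proof -
      have "d' n (g (d (Suc n) x)) = f \<zero>\<^bsub>F n\<^esub>"
        using g(2) dF(1) that free_resolution_complex(2)[OF F] by metis
      then show ?thesis
        using GD(8) mod_homD(1)[OF g(1)] dF(1) that mod_hom_zero[OF FD(3) GD(3) conjunct1[OF f]] by metis
    qed
    then show "\<exists>g. ?ok (Suc n) g \<and> ?step n f g" using g by auto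
  qed
  then show ?thesis using that by metis
qed

text \<open>A chain map that lifts zero is contracted degree by degree: \<open>s (Suc n)\<close>
  lifts h - s d along the next boundary of \<open>G\<close>, which is possible because that
  difference is a cycle. The identity is recorded in positive degrees, those in which Tor and Ext
  are computed here.\<close>

lemma null_homotopy:
  assumes F: "free_resolution R M F d e" and G: "free_resolution R M G d' e'"
    and h: "\<And>n. h n \<in> mod_hom R (F n) (G n)" "\<And>x. x \<in> carrier (F 0) \<Longrightarrow> e' (h 0 x) = \<zero>\<^bsub>M\<^esub>"
      "\<And>n x. x \<in> carrier (F (Suc n)) \<Longrightarrow> d' n (h (Suc n) x) = h n (d n x)"
  obtains s where "\<And>n. s n \<in> mod_hom R (F n) (G (Suc n))"
    and "\<And>n x. x \<in> carrier (F (Suc n)) \<Longrightarrow>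
      h (Suc n) x = d' (Suc n) (s (Suc n) x) \<oplus>\<^bsub>G (Suc n)\<^esub> s n (d n x)"
proof -
  note FD = free_resolutionD[OF F] and GD = free_resolutionD[OF G]
  note dF = mod_homD[OF FD(4)] and hh = mod_homD[OF h(1)]
  have dh: "d' n (h (Suc n) x \<ominus>\<^bsub>G (Suc n)\<^esub> z) = \<zero>\<^bsub>G n\<^esub>"
    if "x \<in> carrier (F (Suc n))" "z \<in> carrier (G (Suc n))" "d' n z = h n (d n x)" for n x z
  proof -
    interpret G: module R "G n" by (rule GD(3))
    show ?thesis using that
      by (simp add: mod_hom_minus[OF GD(3) GD(3) GD(4)] hh(1) h(3) dF(1) G.M.minus_eq_zero_iff)
  qed
  \<comment> \<open>The second conjunct says that d' s = h on boundaries of \<open>F\<close>, which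
    is what makes the next difference h - s d a cycle. It is inherited because s d vanishes on
    boundaries.\<close>
  let ?ok = "\<lambda>n s. s \<in> mod_hom R (F n) (G (Suc n)) \<and>
    (\<forall>x \<in> carrier (F (Suc n)). d' n (s (d n x)) = h n (d n x))"
  let ?step = "\<lambda>n s s'. \<forall>x \<in> carrier (F (Suc n)).
    d' (Suc n) (s' x) = h (Suc n) x \<ominus>\<^bsub>G (Suc n)\<^esub> s (d n x)"
  have "\<exists>s. \<forall>n. ?ok n (s n) \<and> ?step n (s n) (s (Suc n))"
  proof (rule dependent_nat_choice)
    obtain s where "s \<in> mod_hom R (F 0) (G (Suc 0))" "\<And>x. x \<in> carrier (F 0) \<Longrightarrow> d' 0 (s x) = h 0 x"
      by (rule free_module_lift[OF FD(2) GD(3) GD(3) h(1)[of 0] GD(4)]) (simp add: image_subset_iff h(2) hh(1) flip: GD(7), rule that)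
    then show "\<exists>s. ?ok 0 s" using dF(1) by auto
  next
    fix n s assume s: "?ok n s"
    note sh = mod_homD[OF conjunct1[OF s]]
    have u: "(\<lambda>x. h (Suc n) x \<ominus>\<^bsub>G (Suc n)\<^esub> s (d n x)) \<in> mod_hom R (F (Suc n)) (G (Suc n))"
      using mod_hom_diff[OF GD(3) h(1) mod_hom_compose[OF FD(4)]] s by blast
    moreover have "(\<lambda>x. h (Suc n) x \<ominus>\<^bsub>G (Suc n)\<^esub> s (d n x)) ` carrier (F (Suc n))
        \<subseteq> d' (Suc n) ` carrier (G (Suc (Suc n)))"
    proof (rule image_subsetI)
      fix x assume x: "x \<in> carrier (F (Suc n))"
      have "d' n (h (Suc n) x \<ominus>\<^bsub>G (Suc n)\<^esub> s (d n x)) = \<zero>\<^bsub>G n\<^esub>"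
        by (rule dh[OF x sh(1)[OF dF(1)[OF x]]]) (use s x in blast)
      then show "h (Suc n) x \<ominus>\<^bsub>G (Suc n)\<^esub> s (d n x) \<in> d' (Suc n) ` carrier (G (Suc (Suc n)))"
        using GD(8)[OF mod_homD(1)[OF u x]] by blast
    qed
    ultimately obtain s' where s': "s' \<in> mod_hom R (F (Suc n)) (G (Suc (Suc n)))"
      "\<And>x. x \<in> carrier (F (Suc n)) \<Longrightarrow> d' (Suc n) (s' x) = h (Suc n) x \<ominus>\<^bsub>G (Suc n)\<^esub> s (d n x)"
      by (rule free_module_lift[OF FD(2) GD(3) GD(3) _ GD(4)]) (rule that)
    interpret G: module R "G (Suc n)" by (rule GD(3))
    have "d' (Suc n) (s' (d (Suc n) x)) = h (Suc n) (d (Suc n) x)" if "x \<in> carrier (F (Suc (Suc n)))" for x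
      using that s'(2) dF(1) free_resolution_complex(2)[OF F] hh(1)
        mod_hom_zero[OF FD(3) GD(3) conjunct1[OF s]] by (simp add: a_minus_def)
    then show "\<exists>s'. ?ok (Suc n) s' \<and> ?step n s s'" using s' by auto
  qed
  then obtain s where s: "\<And>n. ?ok n (s n)" "\<And>n. ?step n (s n) (s (Suc n))" by metis
  show ?thesis
  proof (rule that[of s])
    fix n x assume x: "x \<in> carrier (F (Suc n))"
    interpret G: module R "G (Suc n)" by (rule GD(3))
    have "s n (d n x) \<in> carrier (G (Suc n))" using mod_homD(1) s(1) dF(1)[OF x] by metis
    moreover have "d' (Suc n) (s (Suc n) x) = h (Suc n) x \<ominus>\<^bsub>G (Suc n)\<^esub> s n (d n x)"
      using s(2) x by blast
    ultimately show "h (Suc n) x = d' (Suc n) (s (Suc n) x) \<oplus>\<^bsub>G (Suc n)\<^esub> s n (d n x)"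
      using hh(1)[OF x] by (simp add: a_minus_def G.M.a_assoc G.M.l_neg)
  qed (use s(1) in blast)
qed

text \<open>The difference of two lifts of the identity of \<open>M\<close> is a chain map that
  lifts zero.\<close>

lemma chain_maps_homotopic:
  assumes F: "free_resolution R M F d e" and G: "free_resolution R M G d' e'"
    and f: "\<And>n. f n \<in> mod_hom R (F n) (G n)" "\<And>x. x \<in> carrier (F 0) \<Longrightarrow> e' (f 0 x) = e x"
      "\<And>n x. x \<in> carrier (F (Suc n)) \<Longrightarrow> d' n (f (Suc n) x) = f n (d n x)"
    and g: "\<And>n. g n \<in> mod_hom R (F n) (G n)" "\<And>x. x \<in> carrier (F 0) \<Longrightarrow> e' (g 0 x) = e x"
      "\<And>n x. x \<in> carrier (F (Suc n)) \<Longrightarrow> d' n (g (Suc n) x) = g n (d n x)"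
  obtains s where "\<And>n. s n \<in> mod_hom R (F n) (G (Suc n))"
    and "\<And>n x. x \<in> carrier (F (Suc n)) \<Longrightarrow>
      f (Suc n) x \<ominus>\<^bsub>G (Suc n)\<^esub> g (Suc n) x = d' (Suc n) (s (Suc n) x) \<oplus>\<^bsub>G (Suc n)\<^esub> s n (d n x)"
proof -
  note FD = free_resolutionD[OF F] and GD = free_resolutionD[OF G]
  interpret M: module R M by (rule FD(1))
  show ?thesis
  proof (rule null_homotopy[OF F G, of "\<lambda>n x. f n x \<ominus>\<^bsub>G n\<^esub> g n x"])
    show "(\<lambda>x. f n x \<ominus>\<^bsub>G n\<^esub> g n x) \<in> mod_hom R (F n) (G n)" for n
      by (rule mod_hom_diff[OF GD(3) f(1) g(1)])
    show "e' (f 0 x \<ominus>\<^bsub>G 0\<^esub> g 0 x) = \<zero>\<^bsub>M\<^esub>" if "x \<in> carrier (F 0)" for x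
      using that mod_homD(1)[OF f(1)] mod_homD(1)[OF g(1)] mod_homD(1)[OF FD(5)]
      by (simp add: mod_hom_minus[OF GD(3) GD(1) GD(5)] f(2) g(2) M.M.minus_eq_zero_iff)
    show "d' n (f (Suc n) x \<ominus>\<^bsub>G (Suc n)\<^esub> g (Suc n) x) = f n (d n x) \<ominus>\<^bsub>G n\<^esub> g n (d n x)"
      if "x \<in> carrier (F (Suc n))" for n x
      using that mod_homD(1)[OF f(1)] mod_homD(1)[OF g(1)]
      by (simp add: mod_hom_minus[OF GD(3) GD(3) GD(4)] f(3) g(3))
  qed (rule that)
qed

section \<open>Tor and Ext from a resolution with terms of rank one\<close>

lemma hom_module_simps:
  "carrier (hom_module \<phi> S) = carrier S" "\<zero>\<^bsub>hom_module \<phi> S\<^esub> = \<zero>\<^bsub>S\<^esub>"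
  "x \<oplus>\<^bsub>hom_module \<phi> S\<^esub> y = x \<oplus>\<^bsub>S\<^esub> y" "a \<odot>\<^bsub>hom_module \<phi> S\<^esub> x = \<phi> a \<otimes>\<^bsub>S\<^esub> x"
  by (simp_all add: hom_module_def)

lemma hom_module_minus: "x \<ominus>\<^bsub>hom_module \<phi> S\<^esub> y = x \<ominus>\<^bsub>S\<^esub> y"
  by (simp add: a_minus_def a_inv_def m_inv_def hom_module_def)

text \<open>Every term is the ring itself, and every boundary is multiplication by a ring element
  \<open>c n\<close>. Leaving \<open>c\<close> arbitrary lets a single computation serve even and
  odd degrees.\<close>

locale cyclic_resolution = cring R for R (structure) +
  fixes M :: "('a, 'e, 'm) module_scheme" and c :: "nat \<Rightarrow> 'a" and e :: "'a \<Rightarrow> 'e"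
  assumes c_closed: "c n \<in> carrier R"
    and resolution: "free_resolution R M (\<lambda>n. hom_module (\<lambda>a. a) R) (\<lambda>n x. c n \<odot>\<^bsub>hom_module (\<lambda>a. a) R\<^esub> x) e"
begin

text \<open>A homomorphism out of the ring is determined by its value at 1. Hence the chain map from
  the rank-one resolution to \<open>F\<close> is recorded by the elements \<open>b n\<close>, and
  the homotopy for the composite on the rank-one side by the ring elements \<open>t n\<close>. The
  maps \<open>f\<close> and \<open>s\<close> are the chain map back and the homotopy on
  \<open>F\<close>.\<close>

lemma comparison:
  assumes F: "free_resolution R M F d eF"
  obtains f b s t where
    "\<And>n. f n \<in> mod_hom R (F n) (hom_module (\<lambda>a. a) R)" "\<And>n. b n \<in> carrier (F n)"
    "\<And>n. s n \<in> mod_hom R (F n) (F (Suc n))" "\<And>n. t n \<in> carrier R"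
    "\<And>n x. x \<in> carrier (F (Suc n)) \<Longrightarrow> f n (d n x) = c n \<otimes> f (Suc n) x"
    "\<And>n. d n (b (Suc n)) = c n \<odot>\<^bsub>F n\<^esub> b n"
    "\<And>n x. x \<in> carrier (F (Suc n)) \<Longrightarrow>
       f (Suc n) x \<odot>\<^bsub>F (Suc n)\<^esub> b (Suc n) \<ominus>\<^bsub>F (Suc n)\<^esub> x = d (Suc n) (s (Suc n) x) \<oplus>\<^bsub>F (Suc n)\<^esub> s n (d n x)"
    "\<And>n. f (Suc n) (b (Suc n)) \<ominus> \<one> = c (Suc n) \<otimes> t (Suc n) \<oplus> c n \<otimes> t n"
proof -
  let ?A = "hom_module (\<lambda>a. a) R"
  note FD = free_resolutionD[OF F]
  obtain f where f: "\<And>n. f n \<in> mod_hom R (F n) ?A" "\<And>x. x \<in> carrier (F 0) \<Longrightarrow> e (f 0 x) = eF x"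
    "\<And>n x. x \<in> carrier (F (Suc n)) \<Longrightarrow> c n \<odot>\<^bsub>?A\<^esub> f (Suc n) x = f n (d n x)"
    using resolution_chain_map[OF F resolution] by blast
  obtain g where g: "\<And>n. g n \<in> mod_hom R ?A (F n)" "\<And>x. x \<in> carrier ?A \<Longrightarrow> eF (g 0 x) = e x"
    "\<And>n x. x \<in> carrier ?A \<Longrightarrow> d n (g (Suc n) x) = g n (c n \<odot>\<^bsub>?A\<^esub> x)"
    using resolution_chain_map[OF resolution F] by blast
  have fc: "x \<in> carrier (F n) \<Longrightarrow> f n x \<in> carrier ?A" for n x by (rule mod_homD(1)[OF f(1)])
  have gc: "x \<in> carrier ?A \<Longrightarrow> g n x \<in> carrier (F n)" for n x by (rule mod_homD(1)[OF g(1)])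
  have dc: "x \<in> carrier (F (Suc n)) \<Longrightarrow> d n x \<in> carrier (F n)" for n x by (rule mod_homD(1)[OF FD(4)])
  have cc: "x \<in> carrier ?A \<Longrightarrow> c n \<odot>\<^bsub>?A\<^esub> x \<in> carrier ?A" for n x
    using c_closed by (simp add: hom_module_simps)
  obtain s where s: "\<And>n. s n \<in> mod_hom R (F n) (F (Suc n))"
    "\<And>n x. x \<in> carrier (F (Suc n)) \<Longrightarrow>
      g (Suc n) (f (Suc n) x) \<ominus>\<^bsub>F (Suc n)\<^esub> x = d (Suc n) (s (Suc n) x) \<oplus>\<^bsub>F (Suc n)\<^esub> s n (d n x)"
    by (rule chain_maps_homotopic[OF F F, of "\<lambda>n x. g n (f n x)" "\<lambda>n x. x",
          OF mod_hom_compose[OF f(1) g(1)] _ _ mod_hom_id])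
       ((simp_all add: f g fc gc dc)[4], rule that)
  obtain t where t: "\<And>n. t n \<in> mod_hom R ?A ?A"
    "\<And>n x. x \<in> carrier ?A \<Longrightarrow>
      f (Suc n) (g (Suc n) x) \<ominus>\<^bsub>?A\<^esub> x = c (Suc n) \<odot>\<^bsub>?A\<^esub> t (Suc n) x \<oplus>\<^bsub>?A\<^esub> t n (c n \<odot>\<^bsub>?A\<^esub> x)"
    by (rule chain_maps_homotopic[OF resolution resolution, of "\<lambda>n x. f n (g n x)" "\<lambda>n x. x",
          OF mod_hom_compose[OF g(1) f(1)] _ _ mod_hom_id])
       ((simp_all add: f g fc gc dc cc)[4], rule that)
  have one: "\<one> \<in> carrier ?A" by (simp add: hom_module_simps)
  have ga: "g n a = a \<odot>\<^bsub>F n\<^esub> g n \<one>" if "a \<in> carrier R" for n a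
    using mod_homD(3)[OF g(1) that one, of n] that by (simp add: hom_module_simps)
  have ta: "t n a = a \<otimes> t n \<one>" if "a \<in> carrier R" for n a
    using mod_homD(3)[OF t(1) that one, of n] that by (simp add: hom_module_simps)
  show ?thesis
  proof (rule that[of f "\<lambda>n. g n \<one>" s "\<lambda>n. t n \<one>"])
    show "f n \<in> mod_hom R (F n) ?A" "g n \<one> \<in> carrier (F n)" "s n \<in> mod_hom R (F n) (F (Suc n))" for n
      using f(1) s(1) gc[OF one] by blast+
    show "t n \<one> \<in> carrier R" for n using mod_homD(1)[OF t(1) one] by (simp add: hom_module_simps)
    show "f n (d n x) = c n \<otimes> f (Suc n) x" if "x \<in> carrier (F (Suc n))" for n x
      using f(3)[OF that] by (simp add: hom_module_simps)
    show "d n (g (Suc n) \<one>) = c n \<odot>\<^bsub>F n\<^esub> g n \<one>" for n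
      using g(3)[OF one] ga[OF c_closed] c_closed by (simp add: hom_module_simps)
    show "f (Suc n) x \<odot>\<^bsub>F (Suc n)\<^esub> g (Suc n) \<one> \<ominus>\<^bsub>F (Suc n)\<^esub> x = d (Suc n) (s (Suc n) x) \<oplus>\<^bsub>F (Suc n)\<^esub> s n (d n x)"
      if "x \<in> carrier (F (Suc n))" for n x
      using s(2)[OF that] ga[of "f (Suc n) x"] fc[OF that] by (simp add: hom_module_simps)
    show "f (Suc n) (g (Suc n) \<one>) \<ominus> \<one> = c (Suc n) \<otimes> t (Suc n) \<one> \<oplus> c n \<otimes> t n \<one>" for n
      using t(2)[OF one] ta[OF c_closed] c_closed by (simp add: hom_module_simps hom_module_minus)
  qed
qed

lemma scaling_submodules:
  assumes "module R N" "a \<in> carrier R"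
  shows "submodule {y \<in> carrier N. a \<odot>\<^bsub>N\<^esub> y = \<zero>\<^bsub>N\<^esub>} R N" "submodule ((\<lambda>y. a \<odot>\<^bsub>N\<^esub> y) ` carrier N) R N"
proof -
  have "(\<lambda>y. a \<odot>\<^bsub>N\<^esub> y) \<in> mod_hom R N N"
    by (rule mod_hom_smult[OF assms(1) mod_hom_id assms(2)])
  then show "submodule {y \<in> carrier N. a \<odot>\<^bsub>N\<^esub> y = \<zero>\<^bsub>N\<^esub>} R N" "submodule ((\<lambda>y. a \<odot>\<^bsub>N\<^esub> y) ` carrier N) R N"
    using mod_hom_kernel_submodule[OF assms(1,1)] mod_hom_image_submodule[OF assms(1,1)]
    by (simp_all add: a_kernel_def')
qed

text \<open>Here u is the scalar by which the composite comparison acts on the rank-one side. By the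
  homotopy it acts as 1 + c m t + c n t'; the last summand kills \<open>y\<close>, and the middle
  one is a boundary. The indices stay independent because Tor and Ext use them in opposite
  order.\<close>

lemma comparison_unit:
  assumes N: "module R N" and u: "u \<in> carrier R" and t: "t \<in> carrier R" "t' \<in> carrier R"
    and eq: "u \<ominus> \<one> = c m \<otimes> t \<oplus> c n \<otimes> t'" and y: "y \<in> carrier N" "c n \<odot>\<^bsub>N\<^esub> y = \<zero>\<^bsub>N\<^esub>"
  shows "u \<odot>\<^bsub>N\<^esub> y \<ominus>\<^bsub>N\<^esub> y \<in> (\<lambda>y. c m \<odot>\<^bsub>N\<^esub> y) ` carrier N"
proof -
  interpret N: module R N by fact
  have "u \<odot>\<^bsub>N\<^esub> y \<ominus>\<^bsub>N\<^esub> y = (u \<ominus> \<one>) \<odot>\<^bsub>N\<^esub> y"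
    using u y by (simp add: a_minus_def N.smult_l_distr N.smult_l_minus)
  also have "\<dots> = c m \<odot>\<^bsub>N\<^esub> (t \<odot>\<^bsub>N\<^esub> y) \<oplus>\<^bsub>N\<^esub> t' \<odot>\<^bsub>N\<^esub> (c n \<odot>\<^bsub>N\<^esub> y)"
    using t y(1) c_closed by (simp add: eq N.smult_l_distr N.smult_assoc1 m_comm[of "c n"])
  also have "\<dots> = c m \<odot>\<^bsub>N\<^esub> (t \<odot>\<^bsub>N\<^esub> y)"
    using t y c_closed by simp
  finally show ?thesis using t y by blast
qed

text \<open>In degree \<open>Suc n\<close> the outgoing boundary is multiplication by
  \<open>c n\<close> and the incoming one by \<open>c (Suc n)\<close>. The map
  \<open>\<theta>\<close> presents the resulting subquotient of \<open>N\<close> as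
  \<open>W\<close>, and \<open>homology_iso\<close> transports this to the chosen
  resolution.\<close>

lemma Tor_iso:
  assumes N: "module R N" and W: "module R W"
    and \<theta>: "\<theta> \<in> mod_hom R (N\<lparr>carrier := {y \<in> carrier N. c n \<odot>\<^bsub>N\<^esub> y = \<zero>\<^bsub>N\<^esub>}\<rparr>) W"
      "\<theta> ` {y \<in> carrier N. c n \<odot>\<^bsub>N\<^esub> y = \<zero>\<^bsub>N\<^esub>} = carrier W"
      "\<And>y. y \<in> carrier N \<Longrightarrow> c n \<odot>\<^bsub>N\<^esub> y = \<zero>\<^bsub>N\<^esub> \<Longrightarrow>
        \<theta> y = \<zero>\<^bsub>W\<^esub> \<longleftrightarrow> y \<in> (\<lambda>y. c (Suc n) \<odot>\<^bsub>N\<^esub> y) ` carrier N"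
  shows "Tor (Suc n) R M N \<cong>\<^bsub>R\<^esub> W"
proof -
  interpret N: module R N by fact
  have M: "module R M" by (rule free_resolutionD(1)[OF resolution])
  obtain F d eF where F: "some_resolution R M = (F, d, eF)" "free_resolution R M F d eF"
    using free_resolution_exists[OF M] by blast
  note FD = free_resolutionD[OF F(2)]
  obtain f b s t where
    fh: "\<And>n. f n \<in> mod_hom R (F n) (hom_module (\<lambda>a. a) R)" and b: "\<And>n. b n \<in> carrier (F n)" and
    s: "\<And>n. s n \<in> mod_hom R (F n) (F (Suc n))" and t: "\<And>n. t n \<in> carrier R" and
    fd: "\<And>n x. x \<in> carrier (F (Suc n)) \<Longrightarrow> f n (d n x) = c n \<otimes> f (Suc n) x" and
    db: "\<And>n. d n (b (Suc n)) = c n \<odot>\<^bsub>F n\<^esub> b n" and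
    hs: "\<And>n x. x \<in> carrier (F (Suc n)) \<Longrightarrow>
       f (Suc n) x \<odot>\<^bsub>F (Suc n)\<^esub> b (Suc n) \<ominus>\<^bsub>F (Suc n)\<^esub> x = d (Suc n) (s (Suc n) x) \<oplus>\<^bsub>F (Suc n)\<^esub> s n (d n x)" and
    ht: "\<And>n. f (Suc n) (b (Suc n)) \<ominus> \<one> = c (Suc n) \<otimes> t (Suc n) \<oplus> c n \<otimes> t n"
    using comparison[OF F(2)] by blast
  note f = mod_homD[OF fh, unfolded hom_module_simps]
  have T: "module_pair R (F k) N" for k by (intro module_pair.intro FD(3) N)
  define T where "T k = tensor R (F k) N" for k
  define \<delta> where "\<delta> k = tensor_map R (F (Suc k)) (F k) N (d k)" for k
  define \<sigma> where "\<sigma> k = tensor_map R (F k) (F (Suc k)) N (s k)" for k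
  define \<tau> where "\<tau> k = pure_tensor R (F k) N" for k
  note Tm = module_pair.tensor_module[OF T, folded T_def]
    and \<tau>c = module_pair.pure_tensor_closed[OF T, folded T_def \<tau>_def]
    and \<tau>l = module_pair.pure_tensor_smult_left[OF T, folded T_def \<tau>_def]
    and \<tau>r = module_pair.pure_tensor_smult_right[OF T, folded T_def \<tau>_def]
    and \<tau>a = module_pair.pure_tensor_add_left[OF T, folded T_def \<tau>_def]
    and eqI = module_pair.tensor_hom_eqI[OF T, folded T_def \<tau>_def]
    and \<delta>h = tensor_map(1)[OF FD(3) FD(3) N FD(4), folded T_def \<delta>_def]
    and \<delta>p = tensor_map(2)[OF FD(3) FD(3) N FD(4), folded \<tau>_def \<delta>_def]
    and \<sigma>h = tensor_map(1)[OF FD(3) FD(3) N s, folded T_def \<sigma>_def]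
    and \<sigma>p = tensor_map(2)[OF FD(3) FD(3) N s, folded \<tau>_def \<sigma>_def]
  have dc: "x \<in> carrier (F (Suc k)) \<Longrightarrow> d k x \<in> carrier (F k)" for k x by (rule mod_homD(1)[OF FD(4)])
  have sc: "x \<in> carrier (F k) \<Longrightarrow> s k x \<in> carrier (F (Suc k))" for k x by (rule mod_homD(1)[OF s])
  \<comment> \<open>The comparison map towards \<open>N\<close>, induced by the bilinear map f(x) y;
    the map back is y \<mapsto> b \<otimes> y.\<close>
  have "\<exists>\<phi>. \<phi> \<in> mod_hom R (T k) N \<and> (\<forall>x \<in> carrier (F k). \<forall>y \<in> carrier N. \<phi> (\<tau> k x y) = f k x \<odot>\<^bsub>N\<^esub> y)" for k
  proof -
    obtain \<phi> where "\<phi> \<in> mod_hom R (tensor R (F k) N) N"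
      "\<And>x y. x \<in> carrier (F k) \<Longrightarrow> y \<in> carrier N \<Longrightarrow> \<phi> (pure_tensor R (F k) N x y) = f k x \<odot>\<^bsub>N\<^esub> y"
    proof (rule module_pair.tensor_lift[OF T N, of "\<lambda>x y. f k x \<odot>\<^bsub>N\<^esub> y" k])
      show "(\<lambda>x. f k x \<odot>\<^bsub>N\<^esub> y) \<in> mod_hom R (F k) N" if "y \<in> carrier N" for y
        by (rule mod_homI) (use that f in \<open>auto simp: N.smult_l_distr N.smult_assoc1\<close>)
      show "(\<lambda>y. f k x \<odot>\<^bsub>N\<^esub> y) \<in> mod_hom R N N" if "x \<in> carrier (F k)" for x
        using mod_hom_smult[OF N mod_hom_id f(1)] that by blast
    qed (rule that)
    then show ?thesis unfolding T_def \<tau>_def by blast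
  qed
  then obtain \<phi> where \<phi>: "\<And>k. \<phi> k \<in> mod_hom R (T k) N"
    "\<And>k x y. x \<in> carrier (F k) \<Longrightarrow> y \<in> carrier N \<Longrightarrow> \<phi> k (\<tau> k x y) = f k x \<odot>\<^bsub>N\<^esub> y" by metis
  have \<phi>\<delta>: "\<phi> k (\<delta> k z) = c k \<odot>\<^bsub>N\<^esub> \<phi> (Suc k) z" if "z \<in> carrier (T (Suc k))" for k z
    using N mod_hom_compose[OF \<delta>h \<phi>(1)] mod_hom_smult[OF N \<phi>(1) c_closed] _ that
    by (rule eqI) (simp add: \<delta>p \<phi>(2) dc fd N.smult_assoc1 f(1) c_closed b)
  have \<delta>\<delta>: "\<delta> k (\<delta> (Suc k) z) = \<zero>\<^bsub>T k\<^esub>" if "z \<in> carrier (T (Suc (Suc k)))" for k z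
  proof -
    interpret T: module R "T k" by (rule Tm)
    interpret F: module R "F k" by (rule FD(3))
    \<comment> \<open>Since 0 \<otimes> y is a zero multiple of a pure tensor, the double boundary
      agrees with the zero map on pure tensors.\<close>
    have z: "\<tau> k \<zero>\<^bsub>F k\<^esub> y = \<zero>\<^bsub>T k\<^esub>" if "y \<in> carrier N" for y
      using \<tau>l[of \<zero> "\<zero>\<^bsub>F k\<^esub>" k y] \<tau>c that by simp
    have "(\<lambda>_. \<zero>\<^bsub>T k\<^esub>) \<in> mod_hom R (T (Suc (Suc k))) (T k)"
      by (rule mod_homI) simp_all
    from Tm mod_hom_compose[OF \<delta>h \<delta>h] this _ that show ?thesis
      by (rule eqI) (simp add: \<delta>p dc free_resolution_complex(2)[OF F(2)] z)
  qed
  have \<delta>\<psi>: "\<delta> k (\<tau> (Suc k) (b (Suc k)) y) = \<tau> k (b k) (c k \<odot>\<^bsub>N\<^esub> y)" if "y \<in> carrier N" for k y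
    using that by (simp add: \<delta>p b db \<tau>l \<tau>r c_closed)
  \<comment> \<open>The homotopy identity on \<open>F\<close>, tensored with \<open>N\<close>. Both
    sides are homomorphisms in \<open>z\<close>, so it is enough to test pure tensors.\<close>
  have homotopy: "\<tau> (Suc k) (b (Suc k)) (\<phi> (Suc k) z) \<ominus>\<^bsub>T (Suc k)\<^esub> z
      = \<delta> (Suc k) (\<sigma> (Suc k) z) \<oplus>\<^bsub>T (Suc k)\<^esub> \<sigma> k (\<delta> k z)" if "z \<in> carrier (T (Suc k))" for k z
  proof -
    interpret T: module R "T (Suc k)" by (rule Tm)
    interpret F: module R "F (Suc k)" by (rule FD(3))
    have \<psi>: "\<tau> (Suc k) (b (Suc k)) \<in> mod_hom R N (T (Suc k))"
      unfolding T_def \<tau>_def by (rule module_pair.pure_tensor_hom[OF T b])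
    have 1: "(\<lambda>z. \<tau> (Suc k) (b (Suc k)) (\<phi> (Suc k) z) \<ominus>\<^bsub>T (Suc k)\<^esub> z) \<in> mod_hom R (T (Suc k)) (T (Suc k))"
      by (rule mod_hom_diff[OF Tm mod_hom_compose[OF \<phi>(1) \<psi>] mod_hom_id])
    have 2: "(\<lambda>z. \<delta> (Suc k) (\<sigma> (Suc k) z) \<oplus>\<^bsub>T (Suc k)\<^esub> \<sigma> k (\<delta> k z)) \<in> mod_hom R (T (Suc k)) (T (Suc k))"
      by (rule mod_hom_add[OF Tm mod_hom_compose[OF \<sigma>h \<delta>h] mod_hom_compose[OF \<delta>h \<sigma>h]])
    show ?thesis
    proof (rule eqI[OF Tm 1 2 _ that])
      fix x y assume xy: "x \<in> carrier (F (Suc k))" "y \<in> carrier N"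
      \<comment> \<open>The scalar f(x) is moved across the tensor sign, from b to y. The
        subtraction is again treated as addition of a multiple by -1.\<close>
      have "\<tau> (Suc k) (f (Suc k) x \<odot>\<^bsub>F (Suc k)\<^esub> b (Suc k) \<ominus>\<^bsub>F (Suc k)\<^esub> x) y
          = \<tau> (Suc k) (f (Suc k) x \<odot>\<^bsub>F (Suc k)\<^esub> b (Suc k)) y \<oplus>\<^bsub>T (Suc k)\<^esub> \<tau> (Suc k) (\<ominus>\<^bsub>R\<^esub> \<one> \<odot>\<^bsub>F (Suc k)\<^esub> x) y"
        using xy b f(1)[OF xy(1)] by (simp add: a_minus_def F.smult_l_minus \<tau>a)
      also have "\<dots> = \<tau> (Suc k) (b (Suc k)) (f (Suc k) x \<odot>\<^bsub>N\<^esub> y) \<ominus>\<^bsub>T (Suc k)\<^esub> \<tau> (Suc k) x y"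
        using xy b f(1)[OF xy(1)] \<tau>c[OF xy]
        by (subst (1 2) \<tau>l) (simp_all add: \<tau>r a_minus_def T.smult_l_minus)
      finally show "\<tau> (Suc k) (b (Suc k)) (\<phi> (Suc k) (\<tau> (Suc k) x y)) \<ominus>\<^bsub>T (Suc k)\<^esub> \<tau> (Suc k) x y
         = \<delta> (Suc k) (\<sigma> (Suc k) (\<tau> (Suc k) x y)) \<oplus>\<^bsub>T (Suc k)\<^esub> \<sigma> k (\<delta> k (\<tau> (Suc k) x y))"
        using xy by (simp add: \<phi>(2) hs \<tau>a \<sigma>p \<delta>p sc dc)
    qed
  qed
  let ?Z = "a_kernel (T (Suc n)) (T n) (\<delta> n)" and ?B = "\<delta> (Suc n) ` carrier (T (Suc (Suc n)))"
  let ?Z' = "{y \<in> carrier N. c n \<odot>\<^bsub>N\<^esub> y = \<zero>\<^bsub>N\<^esub>}" and ?B' = "(\<lambda>y. c (Suc n) \<odot>\<^bsub>N\<^esub> y) ` carrier N"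
  interpret T: module R "T n" by (rule Tm)
  interpret T': module R "T (Suc n)" by (rule Tm)
  have \<tau>0: "\<tau> n (b n) \<zero>\<^bsub>N\<^esub> = \<zero>\<^bsub>T n\<^esub>"
    using \<tau>r[of \<zero> "b n" n "\<zero>\<^bsub>N\<^esub>"] \<tau>c b by simp
  have \<phi>c: "z \<in> carrier (T k) \<Longrightarrow> \<phi> k z \<in> carrier N" for k z by (rule mod_homD(1)[OF \<phi>(1)])
  have \<delta>c: "z \<in> carrier (T (Suc k)) \<Longrightarrow> \<delta> k z \<in> carrier (T k)" for k z by (rule mod_homD(1)[OF \<delta>h])
  have \<sigma>c: "z \<in> carrier (T k) \<Longrightarrow> \<sigma> k z \<in> carrier (T (Suc k))" for k z by (rule mod_homD(1)[OF \<sigma>h])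
  have "quot_mod ((T (Suc n))\<lparr>carrier := ?Z\<rparr>) ?B \<cong>\<^bsub>R\<^esub> W"
  proof (rule homology_iso[OF Tm N W _ _ _ \<phi>(1), where \<psi> = "\<tau> (Suc n) (b (Suc n))" and Z' = ?Z' and B' = ?B'])
    show "submodule ?Z R (T (Suc n))" by (rule mod_hom_kernel_submodule[OF Tm Tm \<delta>h])
    show "submodule ?B R (T (Suc n))" by (rule mod_hom_image_submodule[OF Tm Tm \<delta>h])
    show "?B \<subseteq> ?Z" using \<delta>\<delta> \<delta>c by (auto simp: a_kernel_iff)
    show "\<phi> (Suc n) z \<in> ?Z'" if "z \<in> ?Z" for z
      using that \<phi>\<delta>[of z n] \<phi>c mod_hom_zero[OF Tm N \<phi>(1)] by (simp add: a_kernel_iff)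
    show "\<phi> (Suc n) z \<in> ?B'" if "z \<in> ?B" for z
      using that \<phi>\<delta> \<phi>c by auto
    show "\<tau> (Suc n) (b (Suc n)) y \<in> ?Z" if "y \<in> ?Z'" for y
      using that by (simp add: a_kernel_iff \<tau>c b \<delta>\<psi> \<tau>0)
    show "\<tau> (Suc n) (b (Suc n)) y \<in> ?B" if "y \<in> ?B'" for y
      using that by (auto simp: \<tau>c b simp flip: \<delta>\<psi>)
    \<comment> \<open>On a cycle the summand \<open>\<sigma> n (\<delta> n z)\<close> of the
      homotopy is zero, which leaves a boundary.\<close>
    show "\<tau> (Suc n) (b (Suc n)) (\<phi> (Suc n) z) \<ominus>\<^bsub>T (Suc n)\<^esub> z \<in> ?B" if "z \<in> ?Z" for z
      using that mod_hom_zero[OF Tm Tm \<sigma>h] \<delta>c \<sigma>c by (simp add: a_kernel_iff homotopy)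
    show "\<phi> (Suc n) (\<tau> (Suc n) (b (Suc n)) y) \<ominus>\<^bsub>N\<^esub> y \<in> ?B'" if "y \<in> ?Z'" for y
      using comparison_unit[OF N f(1)[OF b] t t ht] that b by (simp add: \<phi>(2))
    show "submodule ?Z' R N" by (rule scaling_submodules(1)[OF N c_closed])
  qed (use \<theta> in auto)
  then show ?thesis
    unfolding Tor_def F(1) by (simp add: Let_def T_def \<delta>_def)
qed

text \<open>Hom reverses the arrows: now \<open>c (Suc n)\<close> cuts out the cocycles and
  \<open>c n\<close> produces the coboundaries. The comparison data trade places too: evaluation at
  \<open>b\<close> leads to \<open>N\<close>, and \<open>f\<close> gives the map back.\<close>

lemma Ext_iso:
  fixes N :: "('a, 'c, 'n) module_scheme"
  assumes N: "module R N" and W: "module R W"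
    and \<theta>: "\<theta> \<in> mod_hom R (N\<lparr>carrier := {y \<in> carrier N. c (Suc n) \<odot>\<^bsub>N\<^esub> y = \<zero>\<^bsub>N\<^esub>}\<rparr>) W"
      "\<theta> ` {y \<in> carrier N. c (Suc n) \<odot>\<^bsub>N\<^esub> y = \<zero>\<^bsub>N\<^esub>} = carrier W"
      "\<And>y. y \<in> carrier N \<Longrightarrow> c (Suc n) \<odot>\<^bsub>N\<^esub> y = \<zero>\<^bsub>N\<^esub> \<Longrightarrow>
        \<theta> y = \<zero>\<^bsub>W\<^esub> \<longleftrightarrow> y \<in> (\<lambda>y. c n \<odot>\<^bsub>N\<^esub> y) ` carrier N"
  shows "Ext (Suc n) R M N \<cong>\<^bsub>R\<^esub> W"
proof -
  interpret N: module R N by fact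
  have M: "module R M" by (rule free_resolutionD(1)[OF resolution])
  obtain F d eF where F: "some_resolution R M = (F, d, eF)" "free_resolution R M F d eF"
    using free_resolution_exists[OF M] by blast
  note FD = free_resolutionD[OF F(2)]
  obtain f b s t where
    fh: "\<And>n. f n \<in> mod_hom R (F n) (hom_module (\<lambda>a. a) R)" and b: "\<And>n. b n \<in> carrier (F n)" and
    s: "\<And>n. s n \<in> mod_hom R (F n) (F (Suc n))" and t: "\<And>n. t n \<in> carrier R" and
    fd: "\<And>n x. x \<in> carrier (F (Suc n)) \<Longrightarrow> f n (d n x) = c n \<otimes> f (Suc n) x" and
    db: "\<And>n. d n (b (Suc n)) = c n \<odot>\<^bsub>F n\<^esub> b n" and
    hs: "\<And>n x. x \<in> carrier (F (Suc n)) \<Longrightarrow>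
       f (Suc n) x \<odot>\<^bsub>F (Suc n)\<^esub> b (Suc n) \<ominus>\<^bsub>F (Suc n)\<^esub> x = d (Suc n) (s (Suc n) x) \<oplus>\<^bsub>F (Suc n)\<^esub> s n (d n x)" and
    ht: "\<And>n. f (Suc n) (b (Suc n)) \<ominus> \<one> = c (Suc n) \<otimes> t (Suc n) \<oplus> c n \<otimes> t n"
    using comparison[OF F(2)] by blast
  note f = mod_homD[OF fh, unfolded hom_module_simps]
  define C where "C k = Hom_mod R (F k) N" for k
  define \<delta> where "\<delta> k h = compose (carrier (F (Suc k))) h (d k)" for k and h :: "('a + 'e) list \<Rightarrow> 'c"
  have Cm: "module R (C k)" for k unfolding C_def by (rule Hom_mod_module[OF FD(3) N])
  have Ch: "h \<in> mod_hom R (F k) N" "h \<in> extensional (carrier (F k))" if "h \<in> carrier (C k)" for h k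
    using that by (simp_all add: C_def Hom_mod_carrier)
  have CI: "restrict h (carrier (F k)) \<in> carrier (C k)" if "h \<in> mod_hom R (F k) N" for h k
    unfolding C_def by (rule restrict_Hom_mod[OF FD(3) that])
  have Ceq: "h = h'" if "h \<in> carrier (C k)" "h' \<in> carrier (C k)" "\<And>x. x \<in> carrier (F k) \<Longrightarrow> h x = h' x" for h h' k
    using extensionalityI[OF Ch(2) Ch(2)] that by blast
  have dc: "x \<in> carrier (F (Suc k)) \<Longrightarrow> d k x \<in> carrier (F k)" for k x by (rule mod_homD(1)[OF FD(4)])
  have sc: "x \<in> carrier (F k) \<Longrightarrow> s k x \<in> carrier (F (Suc k))" for k x by (rule mod_homD(1)[OF s])
  have ops: "(g \<oplus>\<^bsub>C k\<^esub> h) x = g x \<oplus>\<^bsub>N\<^esub> h x" "(a \<odot>\<^bsub>C k\<^esub> h) x = a \<odot>\<^bsub>N\<^esub> h x" "\<zero>\<^bsub>C k\<^esub> x = \<zero>\<^bsub>N\<^esub>"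
    if "x \<in> carrier (F k)" for g h a x k
    using that by (simp_all add: C_def Hom_mod_def)
  have ev: "(\<lambda>h. h x) \<in> mod_hom R (C k) N" if "x \<in> carrier (F k)" for x k
    by (rule mod_homI) (simp_all add: that ops mod_homD(1)[OF Ch(1)])
  have \<delta>c: "\<delta> k h \<in> carrier (C (Suc k))" if "h \<in> carrier (C k)" for k h
    using CI[OF mod_hom_compose[OF FD(4) Ch(1)[OF that]]] by (simp add: \<delta>_def compose_def)
  have \<delta>a: "\<delta> k h x = h (d k x)" if "x \<in> carrier (F (Suc k))" for k h x
    using that by (simp add: \<delta>_def compose_def)
  have \<delta>h: "\<delta> k \<in> mod_hom R (C k) (C (Suc k))" for k
  proof -
    interpret C: module R "C k" by (rule Cm)
    interpret C': module R "C (Suc k)" by (rule Cm)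
    show ?thesis
    proof (rule mod_homI)
      show "\<delta> k h \<in> carrier (C (Suc k))" if "h \<in> carrier (C k)" for h using \<delta>c that .
      show "\<delta> k (g \<oplus>\<^bsub>C k\<^esub> h) = \<delta> k g \<oplus>\<^bsub>C (Suc k)\<^esub> \<delta> k h" if "g \<in> carrier (C k)" "h \<in> carrier (C k)" for g h
        by (rule Ceq[of _ "Suc k"]) (use that in \<open>simp_all add: \<delta>c \<delta>a ops dc\<close>)
      show "\<delta> k (a \<odot>\<^bsub>C k\<^esub> h) = a \<odot>\<^bsub>C (Suc k)\<^esub> \<delta> k h" if "a \<in> carrier R" "h \<in> carrier (C k)" for a h
        by (rule Ceq[of _ "Suc k"]) (use that in \<open>simp_all add: \<delta>c \<delta>a ops dc\<close>)
    qed
  qed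
  define \<psi> where "\<psi> k y = (\<lambda>x \<in> carrier (F k). f k x \<odot>\<^bsub>N\<^esub> y)" for k y
  have \<psi>c: "\<psi> k y \<in> carrier (C k)" if "y \<in> carrier N" for k y
    unfolding \<psi>_def by (rule CI, rule mod_homI) (use that f in \<open>auto simp: N.smult_l_distr N.smult_assoc1\<close>)
  have \<psi>a: "\<psi> k y x = f k x \<odot>\<^bsub>N\<^esub> y" if "x \<in> carrier (F k)" for k x y
    using that by (simp add: \<psi>_def)
  have \<delta>\<psi>: "\<delta> k (\<psi> k y) = \<psi> (Suc k) (c k \<odot>\<^bsub>N\<^esub> y)" if "y \<in> carrier N" for k y
    by (rule Ceq[of _ "Suc k"])
       (use that in \<open>simp_all add: \<delta>c \<psi>c c_closed \<delta>a \<psi>a dc fd f(1) N.smult_assoc1[symmetric] m_comm b\<close>)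
  let ?Z = "a_kernel (C (Suc n)) (C (Suc (Suc n))) (\<delta> (Suc n))" and ?B = "\<delta> n ` carrier (C n)"
  let ?Z' = "{y \<in> carrier N. c (Suc n) \<odot>\<^bsub>N\<^esub> y = \<zero>\<^bsub>N\<^esub>}" and ?B' = "(\<lambda>y. c n \<odot>\<^bsub>N\<^esub> y) ` carrier N"
  interpret C: module R "C (Suc n)" by (rule Cm)
  interpret C'': module R "C (Suc (Suc n))" by (rule Cm)
  interpret F: module R "F (Suc n)" by (rule FD(3))
  have vanish: "h (d (Suc n) x) = \<zero>\<^bsub>N\<^esub>" if "h \<in> ?Z" "x \<in> carrier (F (Suc (Suc n)))" for h x
    using that \<delta>a ops(3) by (metis a_kernel_iff)
  have evb: "h (d k (b (Suc k))) = c k \<odot>\<^bsub>N\<^esub> h (b k)" if "h \<in> carrier (C k)" for h k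
    using mod_homD(3)[OF Ch(1)[OF that] c_closed b] by (simp add: db)
  have hb: "h (b k) \<in> carrier N" if "h \<in> carrier (C k)" for h k
    using mod_homD(1)[OF Ch(1)[OF that] b] .
  have "quot_mod ((C (Suc n))\<lparr>carrier := ?Z\<rparr>) ?B \<cong>\<^bsub>R\<^esub> W"
  \<comment> \<open>The homomorphism towards \<open>N\<close> is evaluation at
    \<open>b (Suc n)\<close>, supplied by \<open>ev\<close>.\<close>
  proof (rule homology_iso[OF Cm N W _ _ _ ev[OF b], where \<psi> = "\<psi> (Suc n)" and Z' = ?Z' and B' = ?B'])
    show "submodule ?Z R (C (Suc n))" by (rule mod_hom_kernel_submodule[OF Cm Cm \<delta>h])
    show "submodule ?B R (C (Suc n))" by (rule mod_hom_image_submodule[OF Cm Cm \<delta>h])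
    show "?B \<subseteq> ?Z"
    proof
      fix z assume "z \<in> ?B"
      then obtain h where h: "h \<in> carrier (C n)" "z = \<delta> n h" by blast
      have "\<delta> (Suc n) (\<delta> n h) = \<zero>\<^bsub>C (Suc (Suc n))\<^esub>"
        by (rule Ceq[of _ "Suc (Suc n)"])
           (simp_all add: \<delta>c h \<delta>a dc ops free_resolution_complex(2)[OF F(2)] mod_hom_zero[OF FD(3) N Ch(1)[OF h(1)]])
      then show "z \<in> ?Z" using h \<delta>c by (simp add: a_kernel_iff)
    qed
    show "z (b (Suc n)) \<in> ?Z'" if "z \<in> ?Z" for z
      using that vanish[OF that b] evb[of z "Suc n"] hb[of z "Suc n"] by (simp add: a_kernel_iff)
    show "z (b (Suc n)) \<in> ?B'" if "z \<in> ?B" for z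
      using that hb by (auto simp: \<delta>a b evb)
    show "\<psi> (Suc n) y \<in> ?Z" if "y \<in> ?Z'" for y
    proof -
      have "\<psi> (Suc (Suc n)) \<zero>\<^bsub>N\<^esub> = \<zero>\<^bsub>C (Suc (Suc n))\<^esub>"
        by (rule Ceq[of _ "Suc (Suc n)"]) (simp_all add: \<psi>c \<psi>a ops f(1) b)
      then show ?thesis using that by (simp add: a_kernel_iff \<psi>c \<delta>\<psi>)
    qed
    show "\<psi> (Suc n) y \<in> ?B" if "y \<in> ?B'" for y
      using that by (auto simp: \<psi>c simp flip: \<delta>\<psi>)
    show "\<psi> (Suc n) (z (b (Suc n))) \<ominus>\<^bsub>C (Suc n)\<^esub> z \<in> ?B" if z: "z \<in> ?Z" for z
    proof -
      have zC: "z \<in> carrier (C (Suc n))" using z by (simp add: a_kernel_iff)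
      note zh = Ch(1)[OF zC]
      \<comment> \<open>The required cochain is the cocycle composed with the homotopy. Applying z
        to d s + s d leaves only z s d, which is the coboundary of \<open>w\<close>.\<close>
      define w where "w = (\<lambda>x \<in> carrier (F n). z (s n x))"
      have w: "w \<in> carrier (C n)" unfolding w_def by (rule CI[OF mod_hom_compose[OF s zh]])
      have "\<psi> (Suc n) (z (b (Suc n))) \<ominus>\<^bsub>C (Suc n)\<^esub> z = \<delta> n w"
      proof (rule Ceq[of _ "Suc n"])
        fix x assume x: "x \<in> carrier (F (Suc n))"
        have "(\<psi> (Suc n) (z (b (Suc n))) \<ominus>\<^bsub>C (Suc n)\<^esub> z) x = f (Suc n) x \<odot>\<^bsub>N\<^esub> z (b (Suc n)) \<ominus>\<^bsub>N\<^esub> z x"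
          using mod_hom_minus[OF Cm N ev[OF x] \<psi>c[OF hb[OF zC]] zC] by (simp add: \<psi>a x)
        also have "\<dots> = z (f (Suc n) x \<odot>\<^bsub>F (Suc n)\<^esub> b (Suc n) \<ominus>\<^bsub>F (Suc n)\<^esub> x)"
          using x b f(1)[OF x]
          by (simp add: mod_hom_minus[OF FD(3) N zh] mod_homD(3)[OF zh])
        also have "\<dots> = z (d (Suc n) (s (Suc n) x)) \<oplus>\<^bsub>N\<^esub> z (s n (d n x))"
          using x by (simp add: hs mod_homD(2)[OF zh] dc sc)
        also have "\<dots> = \<delta> n w x"
          using x mod_homD(1)[OF zh] by (simp add: vanish[OF z] sc dc \<delta>a w_def)
        finally show "(\<psi> (Suc n) (z (b (Suc n))) \<ominus>\<^bsub>C (Suc n)\<^esub> z) x = \<delta> n w x" .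
      qed (simp_all add: \<psi>c hb zC \<delta>c w)
      then show ?thesis using w by blast
    qed
    show "\<psi> (Suc n) y (b (Suc n)) \<ominus>\<^bsub>N\<^esub> y \<in> ?B'" if "y \<in> ?Z'" for y
    proof -
      \<comment> \<open>The summands are exchanged compared with Tor, because here
        \<open>c (Suc n)\<close> kills \<open>y\<close> and \<open>c n\<close> generates the
        coboundaries.\<close>
      have "f (Suc n) (b (Suc n)) \<ominus> \<one> = c n \<otimes> t n \<oplus> c (Suc n) \<otimes> t (Suc n)"
        using ht c_closed t by (simp add: a_comm)
      from comparison_unit[OF N f(1)[OF b] t t this] that b show ?thesis
        by (simp add: \<psi>a)
    qed
    show "submodule ?Z' R N" by (rule scaling_submodules(1)[OF N c_closed])
  qed (use \<theta> in auto)
  then show ?thesis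
    unfolding Ext_def F(1) by (simp add: Let_def C_def \<delta>_def[abs_def])
qed

end

section \<open>The rings of truncated integer polynomials\<close>

abbreviation "cf f i \<equiv> up_ring.coeff ZX f i"

text \<open>One exponent serves both rings: \<open>A_ring\<close> is the case k = 3 and
  \<open>R_ring\<close> the case k = 2.\<close>

definition trunc_ideal :: "nat \<Rightarrow> (nat \<Rightarrow> int) set"
  where "trunc_ideal k = PIdl\<^bsub>ZX\<^esub> (indet [^]\<^bsub>ZX\<^esub> k)"

definition trunc_ring :: "nat \<Rightarrow> (nat \<Rightarrow> int) set ring"
  where "trunc_ring k = ZX Quot trunc_ideal k"

definition cls :: "nat \<Rightarrow> (nat \<Rightarrow> int) \<Rightarrow> (nat \<Rightarrow> int) set"
  where "cls k f = trunc_ideal k +>\<^bsub>ZX\<^esub> f"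

text \<open>The value is meaningful on a class modulo the k-th power only for i < k, where all
  representatives share the coefficient and \<open>the_elem\<close> is applied to a
  singleton.\<close>

definition coef :: "nat \<Rightarrow> (nat \<Rightarrow> int) set \<Rightarrow> int"
  where "coef i U = the_elem ((\<lambda>f. cf f i) ` U)"

definition xpow :: "nat \<Rightarrow> nat \<Rightarrow> int"
  where "xpow k = up_ring.monom ZX 1 k"

lemma cf_eq: "f \<in> carrier ZX \<Longrightarrow> cf f i = f i"
  by (simp add: UP_def)

lemma ZX_carrier: "carrier ZX = up \<Z>"
  by (simp add: UP_def)

interpretation ZX: UP_ring \<Z> ZX
  by unfold_locales

lemma ZX_UP_cring: "UP_cring \<Z>"
  by (simp add: UP_cring_def int_is_cring)

lemma ZX_cring: "cring ZX"
  by (rule UP_cring.UP_cring[OF ZX_UP_cring])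

interpretation ZX: cring ZX
  by (rule ZX_cring)

text \<open>The product rule rewrites a coefficient into a convolution sum. Products with a power of
  the indeterminate should instead be simplified by the shift \<open>coeff_X_mult\<close>, so the
  sum appears only where it is called for by name.\<close>

declare ZX.coeff_mult [simp del]

lemma xpow_closed: "xpow k \<in> carrier ZX"
  unfolding xpow_def by (rule ZX.monom_closed) simp

lemma indet_pow: "indet [^]\<^bsub>ZX\<^esub> k = xpow k"
  using UP_cring.monom_pow[OF ZX_UP_cring, of 1 1 k]
    monoid.nat_pow_one[OF ring.is_monoid[OF cring.axioms(1)[OF int_is_cring]], of k]
  by (simp add: indet_def xpow_def)

lemma coeff_X_mult:
  assumes "f \<in> carrier ZX"
  shows "cf (xpow k \<otimes>\<^bsub>ZX\<^esub> f) i = (if i < k then 0 else cf f (i - k))"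
proof (cases "i < k")
  case True
  then show ?thesis using assms by (simp add: xpow_def ZX.coeff_mult)
next
  case False
  then show ?thesis using ZX.coeff_monom_mult[of 1 f k "i - k"] assms by (simp add: xpow_def)
qed

lemma xpow_mult_ex:
  assumes f: "f \<in> carrier ZX" and low: "\<And>i. i < k \<Longrightarrow> cf f i = 0"
  obtains g where "g \<in> carrier ZX" "f = xpow k \<otimes>\<^bsub>ZX\<^esub> g"
proof -
  have f': "f \<in> up \<Z>" using f by (simp add: ZX_carrier)
  then obtain n where n: "bound 0 n f" by (auto simp: up_def)
  \<comment> \<open>Division by the k-th power of the indeterminate shifts coefficients down by k. A
    degree bound for \<open>f\<close> remains valid for the shifted sequence.\<close>
  have "bound 0 n (\<lambda>i. f (i + k))" using n by (auto simp: bound_def)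
  then have g: "(\<lambda>i. f (i + k)) \<in> carrier ZX" by (auto simp: ZX_carrier up_def)
  have "f = xpow k \<otimes>\<^bsub>ZX\<^esub> (\<lambda>i. f (i + k))"
  proof (rule ZX.up_eqI)
    show "cf f i = cf (xpow k \<otimes>\<^bsub>ZX\<^esub> (\<lambda>i. f (i + k))) i" for i
      using low[of i] by (simp add: coeff_X_mult[OF g] cf_eq[OF f] cf_eq[OF g])
  qed (use f g xpow_closed in auto)
  then show ?thesis using g that by blast
qed

text \<open>Divisibility by the k-th power turns into vanishing of the low coefficients. All later
  questions about ideals, kernels and images become questions about coefficients in this
  way.\<close>

lemma trunc_ideal_iff: "f \<in> trunc_ideal k \<longleftrightarrow> f \<in> carrier ZX \<and> (\<forall>i<k. cf f i = 0)"
proof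
  assume "f \<in> trunc_ideal k"
  then obtain g where "g \<in> carrier ZX" "f = xpow k \<otimes>\<^bsub>ZX\<^esub> g"
    using ZX.m_comm xpow_closed by (auto simp: trunc_ideal_def cgenideal_def indet_pow)
  then show "f \<in> carrier ZX \<and> (\<forall>i<k. cf f i = 0)" using xpow_closed by (simp add: coeff_X_mult)
next
  assume "f \<in> carrier ZX \<and> (\<forall>i<k. cf f i = 0)"
  then obtain g where "g \<in> carrier ZX" "f = xpow k \<otimes>\<^bsub>ZX\<^esub> g" using xpow_mult_ex by metis
  then show "f \<in> trunc_ideal k"
    using ZX.m_comm[OF xpow_closed] by (auto simp: trunc_ideal_def cgenideal_def indet_pow)
qed

section \<open>Residue classes of truncated polynomials\<close>

lemma trunc_ideal: "ideal (trunc_ideal k) ZX"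
  unfolding trunc_ideal_def indet_pow by (rule ZX.cgenideal_ideal[OF xpow_closed])

lemma trunc_cring: "cring (trunc_ring k)"
  unfolding trunc_ring_def by (rule ideal.quotient_is_cring[OF trunc_ideal ZX.is_cring])

lemma cls_hom: "cls k \<in> ring_hom ZX (trunc_ring k)"
  unfolding trunc_ring_def cls_def[abs_def] by (rule ideal.rcos_ring_hom[OF trunc_ideal])

lemmas cls_closed = ring_hom_closed[OF cls_hom]
  and cls_mult = ring_hom_mult[OF cls_hom, symmetric]
  and cls_add = ring_hom_add[OF cls_hom, symmetric]
  and cls_one = ring_hom_one[OF cls_hom, symmetric]

lemma cls_zero: "\<zero>\<^bsub>trunc_ring k\<^esub> = cls k \<zero>\<^bsub>ZX\<^esub>"
  using ring_hom_zero[OF cls_hom] ZX.ring_axioms trunc_cring by (metis cring_def)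

lemma cls_cases:
  assumes "U \<in> carrier (trunc_ring k)" obtains f where "f \<in> carrier ZX" "U = cls k f"
  using assms by (auto simp: trunc_ring_def FactRing_def A_RCOSETS_def RCOSETS_def cls_def a_r_coset_def)

lemma cls_eq_iff:
  assumes "f \<in> carrier ZX" "g \<in> carrier ZX"
  shows "cls k f = cls k g \<longleftrightarrow> (\<forall>i<k. cf f i = cf g i)"
  using ZX.quotient_eq_iff_same_a_r_cos[OF trunc_ideal assms, of k] assms
  by (auto simp: cls_def trunc_ideal_iff)

lemma cls_mem_iff:
  assumes "f \<in> carrier ZX"
  shows "g \<in> cls k f \<longleftrightarrow> g \<in> carrier ZX \<and> (\<forall>i<k. cf g i = cf f i)"
proof -
  interpret ideal "trunc_ideal k" ZX by (rule trunc_ideal)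
  have "g \<in> cls k f \<longleftrightarrow> g \<in> carrier ZX \<and> cls k g = cls k f"
    using a_repr_independence'[of g f] a_rcos_self[of g] a_elemrcos_carrier[of f g] assms by (auto simp: cls_def)
  then show ?thesis using cls_eq_iff assms by blast
qed

lemma coef_cls:
  assumes "f \<in> carrier ZX" "i < k"
  shows "coef i (cls k f) = cf f i"
proof -
  have "(\<lambda>g. cf g i) ` cls k f = {cf f i}"
    using assms cls_mem_iff[OF assms(1)] by auto
  then show ?thesis by (simp add: coef_def)
qed

lemma A_ring_eq: "A_ring = trunc_ring 3" and R_ring_eq: "R_ring = trunc_ring 2"
  by (simp_all add: A_ring_def R_ring_def trunc_ring_def trunc_ideal_def)

lemma pA_eq: "pA = cls 3 (xpow 1)"
  by (simp add: pA_def cls_def trunc_ideal_def indet_def xpow_def)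

lemma xpow_mult: "xpow i \<otimes>\<^bsub>ZX\<^esub> xpow j = xpow (i + j)"
  using ZX.monom_mult[of 1 1 i j] by (simp add: xpow_def)

lemma pA_sq: "pA [^]\<^bsub>A_ring\<^esub> (2::nat) = cls 3 (xpow 2)"
proof -
  interpret cring A_ring unfolding A_ring_eq by (rule trunc_cring)
  have "pA \<in> carrier A_ring" unfolding A_ring_eq pA_eq by (rule cls_closed[OF xpow_closed])
  then have "pA [^]\<^bsub>A_ring\<^esub> (2::nat) = pA \<otimes>\<^bsub>A_ring\<^esub> pA" by (simp add: numeral_2_eq_2)
  then show ?thesis
    by (simp add: A_ring_eq pA_eq cls_mult xpow_closed xpow_mult numeral_2_eq_2 del: One_nat_def)
qed

lemma A_to_int_eq: "A_to_int = coef 0"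
  by (simp add: fun_eq_iff A_to_int_def coef_def)

text \<open>The sum of the ideal (p^2) and a class modulo p^3 is a union of classes modulo p^2. They
  coincide because representatives that agree in three coefficients agree in the first two.\<close>

lemma A_to_R_cls:
  assumes "f \<in> carrier ZX" shows "A_to_R (cls 3 f) = cls 2 f"
proof -
  interpret ideal "trunc_ideal 2" ZX by (rule trunc_ideal)
  have "A_to_R (cls 3 f) = (\<Union>g\<in>cls 3 f. cls 2 g)"
    by (auto simp: A_to_R_def set_add_def set_mult_def cls_def a_r_coset_def r_coset_def trunc_ideal_def)
  also have "\<dots> = (\<Union>g\<in>cls 3 f. cls 2 f)"
    by (rule SUP_cong) (use assms in \<open>auto simp: cls_mem_iff cls_eq_iff\<close>)
  also have "\<dots> = cls 2 f"
    using cls_mem_iff[OF assms, of f 3] assms by auto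
  finally show ?thesis .
qed

lemma A_to_R_hom: "A_to_R \<in> ring_hom A_ring R_ring"
  unfolding A_ring_eq R_ring_eq
  by (rule ring_hom_memI)
     (auto elim!: cls_cases simp: A_to_R_cls cls_closed cls_mult cls_add cls_one)

lemma coef_0_hom:
  assumes "0 < k" shows "coef 0 \<in> ring_hom (trunc_ring k) \<Z>"
  by (rule ring_hom_memI)
     (auto elim!: cls_cases simp: assms coef_cls cls_mult cls_add cls_one ZX.coeff_mult)

text \<open>Multiplication by the j-th power pushes the top j coefficients out of the truncation, so
  only the lower k - j are tested. Together with \<open>xpow_multiples_iff\<close> this shows, for j
  at most k, that the annihilator of the j-th power is generated by the (k - j)-th.\<close>

lemma xpow_mult_cls_eq_zero_iff:
  assumes "f \<in> carrier ZX"
  shows "cls k (xpow j \<otimes>\<^bsub>ZX\<^esub> f) = \<zero>\<^bsub>trunc_ring k\<^esub> \<longleftrightarrow> (\<forall>i < k - j. cf f i = 0)"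
proof -
  have "(\<forall>i<k. cf (xpow j \<otimes>\<^bsub>ZX\<^esub> f) i = 0) \<longleftrightarrow> (\<forall>i < k - j. cf f i = 0)"
  proof safe
    fix i assume "\<forall>i<k. cf (xpow j \<otimes>\<^bsub>ZX\<^esub> f) i = 0" "i < k - j"
    then have "cf (xpow j \<otimes>\<^bsub>ZX\<^esub> f) (i + j) = 0" by auto
    then show "cf f i = 0" by (simp add: coeff_X_mult[OF assms])
  qed (auto simp: coeff_X_mult[OF assms])
  then show ?thesis using assms by (simp add: cls_zero cls_eq_iff xpow_closed)
qed

lemma xpow_multiples_iff:
  assumes f: "f \<in> carrier ZX" and j: "j \<le> k"
  shows "cls k f \<in> (\<lambda>U. cls k (xpow j) \<otimes>\<^bsub>trunc_ring k\<^esub> U) ` carrier (trunc_ring k) \<longleftrightarrow> (\<forall>i<j. cf f i = 0)"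
proof
  assume "cls k f \<in> (\<lambda>U. cls k (xpow j) \<otimes>\<^bsub>trunc_ring k\<^esub> U) ` carrier (trunc_ring k)"
  then obtain g where g: "g \<in> carrier ZX" "cls k f = cls k (xpow j \<otimes>\<^bsub>ZX\<^esub> g)"
    by (auto elim!: cls_cases simp: cls_mult xpow_closed)
  then have "\<forall>i<k. cf f i = (if i < j then 0 else cf g (i - j))"
    using f xpow_closed by (simp add: cls_eq_iff coeff_X_mult)
  then show "\<forall>i<j. cf f i = 0" using j by auto
next
  assume "\<forall>i<j. cf f i = 0"
  then obtain g where g: "g \<in> carrier ZX" "f = xpow j \<otimes>\<^bsub>ZX\<^esub> g" using xpow_mult_ex f by metis
  then have "cls k f = cls k (xpow j) \<otimes>\<^bsub>trunc_ring k\<^esub> cls k g" by (simp add: cls_mult xpow_closed)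
  then show "cls k f \<in> (\<lambda>U. cls k (xpow j) \<otimes>\<^bsub>trunc_ring k\<^esub> U) ` carrier (trunc_ring k)"
    using g cls_closed by blast
qed

section \<open>The modules over the truncated polynomials\<close>

lemma hom_module_module:
  assumes R: "cring R" and S: "cring S" and \<phi>: "\<phi> \<in> ring_hom R S"
  shows "module R (hom_module \<phi> S)"
proof -
  interpret R: cring R by fact
  interpret S: cring S by fact
  note hom = ring_hom_closed[OF \<phi>] ring_hom_mult[OF \<phi>] ring_hom_add[OF \<phi>] ring_hom_one[OF \<phi>]
  show ?thesis
  proof (rule moduleI[OF R])
    show "abelian_group (hom_module \<phi> S)"
      by (rule abelian_groupI)
         (auto simp: hom_module_def S.a_ac intro: bexI[of _ "\<ominus>\<^bsub>S\<^esub> _"] S.l_neg)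
  qed (simp_all add: hom_module_simps hom S.l_distr S.r_distr S.m_assoc)
qed

lemma hom_module_hom:
  assumes "h \<in> ring_hom S T" "\<And>a. a \<in> carrier R \<Longrightarrow> \<phi> a \<in> carrier S" "\<And>a. a \<in> carrier R \<Longrightarrow> h (\<phi> a) = \<psi> a"
  shows "h \<in> mod_hom R (hom_module \<phi> S) (hom_module \<psi> T)"
  by (rule mod_homI)
     (simp_all add: hom_module_simps assms ring_hom_closed[OF assms(1)] ring_hom_add[OF assms(1)] ring_hom_mult[OF assms(1)])

text \<open>All boundaries of the complex with terms \<open>N\<close> vanish, so every element is a
  cycle, only zero is a boundary, and the homology in each degree is \<open>N\<close>
  itself.\<close>

lemma (in cyclic_resolution) Tor_Ext_trivial_action:
  assumes N: "module R N" and W: "module R W" and iso: "N \<cong>\<^bsub>R\<^esub> W"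
    and c: "\<And>n y. y \<in> carrier N \<Longrightarrow> c n \<odot>\<^bsub>N\<^esub> y = \<zero>\<^bsub>N\<^esub>"
  shows "Tor (Suc n) R M N \<cong>\<^bsub>R\<^esub> W" "Ext (Suc n) R M N \<cong>\<^bsub>R\<^esub> W"
proof -
  interpret N: module R N by fact
  obtain f where f: "f \<in> mod_hom R N W" "bij_betw f (carrier N) (carrier W)"
    using iso by (auto simp: mod_iso_def)
  have Z: "{y \<in> carrier N. c n \<odot>\<^bsub>N\<^esub> y = \<zero>\<^bsub>N\<^esub>} = carrier N" for n using c by auto
  have B: "(\<lambda>y. c n \<odot>\<^bsub>N\<^esub> y) ` carrier N = {\<zero>\<^bsub>N\<^esub>}" for n
    using c N.zero_closed by (auto simp: image_iff intro!: bexI[of _ "\<zero>\<^bsub>N\<^esub>"])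
  have hom: "f \<in> mod_hom R (N\<lparr>carrier := carrier N\<rparr>) W"
    using f(1) by simp
  have surj: "f ` carrier N = carrier W" using f(2) by (simp add: bij_betw_def)
  have ker: "f y = \<zero>\<^bsub>W\<^esub> \<longleftrightarrow> y = \<zero>\<^bsub>N\<^esub>" if "y \<in> carrier N" for y
    using f(2) that mod_hom_zero[OF N W f(1)] by (metis N.zero_closed bij_betw_def inj_onD)
  show "Tor (Suc n) R M N \<cong>\<^bsub>R\<^esub> W"
    by (rule Tor_iso[OF N W, where \<theta> = f]) (simp_all only: Z B hom surj ker singleton_iff)
  show "Ext (Suc n) R M N \<cong>\<^bsub>R\<^esub> W"
    by (rule Ext_iso[OF N W, where \<theta> = f]) (simp_all only: Z B hom surj ker singleton_iff)
qed

lemma A_cring: "cring A_ring" and R_cring: "cring R_ring"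
  unfolding A_ring_eq R_ring_eq by (rule trunc_cring)+

lemma pA_closed: "pA \<in> carrier A_ring"
  unfolding A_ring_eq pA_eq by (rule cls_closed[OF xpow_closed])

lemma R_mod_module: "module A_ring R_mod"
  unfolding R_mod_def by (rule hom_module_module[OF A_cring R_cring A_to_R_hom])

lemma A_to_int_hom: "A_to_int \<in> ring_hom A_ring \<Z>"
  unfolding A_to_int_eq A_ring_eq by (rule coef_0_hom) simp

lemma int_mod_module: "module A_ring int_mod"
  unfolding int_mod_def by (rule hom_module_module[OF A_cring int_is_cring A_to_int_hom])

lemma periodic_resolution:
  "free_resolution A_ring R_mod (\<lambda>n. A_mod)
     (\<lambda>n x. (if even n then pA [^]\<^bsub>A_ring\<^esub> (2::nat) else pA) \<odot>\<^bsub>A_mod\<^esub> x) A_to_R"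
proof -
  interpret A: cring A_ring by (rule A_cring)
  interpret AM: module A_ring A_mod
    unfolding A_mod_def by (rule hom_module_self_module[OF A_cring])
  have sm: "a \<odot>\<^bsub>A_mod\<^esub> x = a \<otimes>\<^bsub>A_ring\<^esub> x" for a x by (simp add: A_mod_def hom_module_simps)
  have cA: "carrier A_mod = carrier (trunc_ring 3)" by (simp add: A_mod_def hom_module_simps A_ring_eq)
  have zA: "\<zero>\<^bsub>A_mod\<^esub> = \<zero>\<^bsub>trunc_ring 3\<^esub>" by (simp add: A_mod_def hom_module_simps A_ring_eq)
  have cR: "carrier R_mod = carrier (trunc_ring 2)" by (simp add: R_mod_def hom_module_simps R_ring_eq)
  have zR: "\<zero>\<^bsub>R_mod\<^esub> = cls 2 \<zero>\<^bsub>ZX\<^esub>" by (simp add: R_mod_def hom_module_simps R_ring_eq cls_zero)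
  \<comment> \<open>The boundaries alternate between exponents 2 and 1, so exactness in positive
    degrees is given by the pairs (i, j) = (2, 1) and (1, 2).\<close>
  have ann: "a_kernel A_mod A_mod (\<lambda>x. cls 3 (xpow i) \<odot>\<^bsub>A_mod\<^esub> x) = (\<lambda>x. cls 3 (xpow j) \<odot>\<^bsub>A_mod\<^esub> x) ` carrier A_mod"
    if ij: "i + j = 3" for i j
  proof (rule Set.set_eqI)
    fix U
    have j: "j = 3 - i" "j \<le> 3" using ij by simp_all
    have "U \<in> carrier (trunc_ring 3)" if "U \<in> (\<lambda>x. cls 3 (xpow j) \<odot>\<^bsub>A_mod\<^esub> x) ` carrier A_mod"
      using that AM.smult_closed cls_closed[OF xpow_closed, of 3 j] cA unfolding A_ring_eq by blast
    moreover have "cls 3 (xpow i) \<odot>\<^bsub>A_mod\<^esub> U = \<zero>\<^bsub>A_mod\<^esub> \<longleftrightarrow> U \<in> (\<lambda>x. cls 3 (xpow j) \<odot>\<^bsub>A_mod\<^esub> x) ` carrier A_mod"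
      if U: "U \<in> carrier (trunc_ring 3)"
    proof -
      obtain f where f: "f \<in> carrier ZX" "U = cls 3 f" using U by (rule cls_cases)
      show ?thesis
        using xpow_multiples_iff[OF f(1) j(2)] j(1)
        by (simp add: f sm A_ring_eq cA zA cls_mult xpow_closed xpow_mult_cls_eq_zero_iff)
    qed
    ultimately show "U \<in> a_kernel A_mod A_mod (\<lambda>x. cls 3 (xpow i) \<odot>\<^bsub>A_mod\<^esub> x)
        \<longleftrightarrow> U \<in> (\<lambda>x. cls 3 (xpow j) \<odot>\<^bsub>A_mod\<^esub> x) ` carrier A_mod"
      using cA by (auto simp: a_kernel_iff)
  qed
  have "a_kernel A_mod R_mod A_to_R = (\<lambda>x. cls 3 (xpow 2) \<odot>\<^bsub>A_mod\<^esub> x) ` carrier A_mod"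
  proof (rule Set.set_eqI)
    fix U
    have "U \<in> carrier (trunc_ring 3)" if "U \<in> (\<lambda>x. cls 3 (xpow 2) \<odot>\<^bsub>A_mod\<^esub> x) ` carrier A_mod"
      using that AM.smult_closed cls_closed[OF xpow_closed, of 3 2] cA unfolding A_ring_eq by blast
    moreover have "A_to_R U = \<zero>\<^bsub>R_mod\<^esub> \<longleftrightarrow> U \<in> (\<lambda>x. cls 3 (xpow 2) \<odot>\<^bsub>A_mod\<^esub> x) ` carrier A_mod"
      if U: "U \<in> carrier (trunc_ring 3)"
    proof -
      obtain f where f: "f \<in> carrier ZX" "U = cls 3 f" using U by (rule cls_cases)
      have "A_to_R U = \<zero>\<^bsub>R_mod\<^esub> \<longleftrightarrow> (\<forall>i<2. cf f i = 0)"
        using f by (simp add: A_to_R_cls zR cls_eq_iff)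
      then show ?thesis using xpow_multiples_iff[OF f(1), of 2 3] by (simp add: f(2) sm A_ring_eq cA)
    qed
    ultimately show "U \<in> a_kernel A_mod R_mod A_to_R
        \<longleftrightarrow> U \<in> (\<lambda>x. cls 3 (xpow 2) \<odot>\<^bsub>A_mod\<^esub> x) ` carrier A_mod"
      using cA by (auto simp: a_kernel_iff)
  qed
  moreover have "A_to_R ` carrier A_mod = carrier R_mod"
  proof
    show "A_to_R ` carrier A_mod \<subseteq> carrier R_mod"
      using ring_hom_closed[OF A_to_R_hom] by (auto simp: A_mod_def R_mod_def hom_module_simps)
    show "carrier R_mod \<subseteq> A_to_R ` carrier A_mod"
    proof
      fix U assume "U \<in> carrier R_mod"
      then obtain f where "f \<in> carrier ZX" "U = cls 2 f" unfolding cR by (rule cls_cases)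
      then show "U \<in> A_to_R ` carrier A_mod"
        using A_to_R_cls cls_closed cA by (metis imageI)
    qed
  qed
  moreover have "A_to_R \<in> mod_hom A_ring A_mod R_mod"
    unfolding A_mod_def R_mod_def by (rule hom_module_hom[OF A_to_R_hom]) auto
  moreover have "(\<lambda>x. a \<odot>\<^bsub>A_mod\<^esub> x) \<in> mod_hom A_ring A_mod A_mod" if "a \<in> carrier A_ring" for a
    by (rule mod_hom_smult[OF AM.module_axioms mod_hom_id that])
  moreover have "free_module A_ring A_mod"
    unfolding A_mod_def by (rule hom_module_self_free[OF A_cring])
  moreover have "pA [^]\<^bsub>A_ring\<^esub> (2::nat) \<in> carrier A_ring" by (rule A.nat_pow_closed[OF pA_closed])
  ultimately show ?thesis
    using R_mod_module pA_closed ann[of 2 1] ann[of 1 2]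
    unfolding free_resolution_def by (simp add: pA_sq[unfolded pA_eq] pA_eq del: One_nat_def)
qed

section \<open>The quotient of A by p, and its identification with the integers\<close>

lemma A_to_int_kernel: "a_kernel A_ring \<Z> A_to_int = PIdl\<^bsub>A_ring\<^esub> pA"
proof -
  interpret A: cring A_ring by (rule A_cring)
  have P: "PIdl\<^bsub>A_ring\<^esub> pA = (\<lambda>U. cls 3 (xpow 1) \<otimes>\<^bsub>trunc_ring 3\<^esub> U) ` carrier (trunc_ring 3)"
    unfolding cgenideal_def using A.m_comm[OF pA_closed] by (auto simp: A_ring_eq pA_eq)
  show ?thesis
  proof (rule Set.set_eqI)
    fix U
    have "U \<in> carrier (trunc_ring 3)" if "U \<in> PIdl\<^bsub>A_ring\<^esub> pA"
      using that A.cgenideal_ideal[OF pA_closed] ideal.Icarr unfolding A_ring_eq by metis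
    moreover have "A_to_int U = 0 \<longleftrightarrow> U \<in> PIdl\<^bsub>A_ring\<^esub> pA" if U: "U \<in> carrier (trunc_ring 3)"
    proof -
      obtain f where f: "f \<in> carrier ZX" "U = cls 3 f" using U by (rule cls_cases)
      show ?thesis
        using xpow_multiples_iff[OF f(1), of 1 3] f by (simp add: P A_to_int_eq coef_cls del: One_nat_def)
    qed
    ultimately show "U \<in> a_kernel A_ring \<Z> A_to_int \<longleftrightarrow> U \<in> PIdl\<^bsub>A_ring\<^esub> pA"
      by (auto simp: a_kernel_iff A_ring_eq)
  qed
qed

lemma A_to_Z_hom: "A_to_Z \<in> ring_hom A_ring Z_ring"
proof -
  interpret A: cring A_ring by (rule A_cring)
  show ?thesis
    unfolding A_to_Z_def[abs_def] Z_ring_def by (rule ideal.rcos_ring_hom[OF A.cgenideal_ideal[OF pA_closed]])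
qed

lemma Z_cring: "cring Z_ring"
proof -
  interpret A: cring A_ring by (rule A_cring)
  show ?thesis
    unfolding Z_ring_def by (rule ideal.quotient_is_cring[OF A.cgenideal_ideal[OF pA_closed] A_cring])
qed

lemma Z_mod_module: "module A_ring Z_mod"
  unfolding Z_mod_def by (rule hom_module_module[OF A_cring Z_cring A_to_Z_hom])

lemma A_to_int_surj: "A_to_int ` carrier A_ring = UNIV"
proof -
  have "n \<in> A_to_int ` carrier A_ring" for n
  proof -
    have "up_ring.monom ZX n 0 \<in> carrier ZX" by (rule ZX.monom_closed) simp
    moreover from this have "A_to_int (cls 3 (up_ring.monom ZX n 0)) = n"
      by (simp add: A_to_int_eq coef_cls)
    ultimately show ?thesis unfolding A_ring_eq using cls_closed by (metis imageI)
  qed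
  then show ?thesis by blast
qed

text \<open>The first isomorphism theorem for the constant coefficient, whose kernel is the ideal of
  \<open>pA\<close>. Compatibility with \<open>A_to_Z\<close> is what makes the ring isomorphism
  linear over \<open>A_ring\<close> in \<open>Z_mod_iso\<close>.\<close>

lemma Z_ring_iso:
  obtains h where "h \<in> ring_iso Z_ring \<Z>" "\<And>a. a \<in> carrier A_ring \<Longrightarrow> h (A_to_Z a) = A_to_int a"
proof -
  interpret A: cring A_ring by (rule A_cring)
  interpret hom: ring_hom_ring A_ring \<Z> A_to_int
    by (rule ring_hom_ringI2[OF A.ring_axioms cring.axioms(1)[OF int_is_cring] A_to_int_hom])
  show ?thesis
  proof (rule that)
    show "(\<lambda>U. the_elem (A_to_int ` U)) \<in> ring_iso Z_ring \<Z>"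
      using hom.FactRing_iso_set A_to_int_surj by (simp add: A_to_int_kernel Z_ring_def)
    show "the_elem (A_to_int ` A_to_Z a) = A_to_int a" if "a \<in> carrier A_ring" for a
      using hom.the_elem_simp[OF that] by (simp add: A_to_int_kernel A_to_Z_def)
  qed
qed

lemma Z_mod_iso: "Z_mod \<cong>\<^bsub>A_ring\<^esub> int_mod"
proof -
  obtain h where h: "h \<in> ring_iso Z_ring \<Z>" "\<And>a. a \<in> carrier A_ring \<Longrightarrow> h (A_to_Z a) = A_to_int a"
    using Z_ring_iso by blast
  show ?thesis
  proof (rule mod_isoI)
    show "h \<in> mod_hom A_ring Z_mod int_mod"
      unfolding Z_mod_def int_mod_def
      by (rule hom_module_hom) (use h ring_hom_closed[OF A_to_Z_hom] in \<open>auto simp: ring_iso_def\<close>)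
    show "bij_betw h (carrier Z_mod) (carrier int_mod)"
      using h(1) by (simp add: ring_iso_def Z_mod_def int_mod_def hom_module_simps)
  qed
qed

lemma Z_mod_trivial_action:
  assumes "y \<in> carrier Z_mod"
  shows "pA \<odot>\<^bsub>Z_mod\<^esub> y = \<zero>\<^bsub>Z_mod\<^esub>" "(pA [^]\<^bsub>A_ring\<^esub> (2::nat)) \<odot>\<^bsub>Z_mod\<^esub> y = \<zero>\<^bsub>Z_mod\<^esub>"
proof -
  interpret A: cring A_ring by (rule A_cring)
  interpret Z: cring Z_ring by (rule Z_cring)
  interpret ZM: module A_ring Z_mod by (rule Z_mod_module)
  interpret I: ideal "PIdl\<^bsub>A_ring\<^esub> pA" A_ring by (rule A.cgenideal_ideal[OF pA_closed])
  have "A_to_Z pA = \<zero>\<^bsub>Z_ring\<^esub>"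
    using I.a_rcos_const[OF A.cgenideal_self[OF pA_closed]] by (simp add: A_to_Z_def Z_ring_def FactRing_def)
  then show p: "pA \<odot>\<^bsub>Z_mod\<^esub> y = \<zero>\<^bsub>Z_mod\<^esub>"
    using assms by (simp add: Z_mod_def hom_module_simps)
  have "pA [^]\<^bsub>A_ring\<^esub> (2::nat) = pA \<otimes>\<^bsub>A_ring\<^esub> pA" using pA_closed by (simp add: numeral_2_eq_2)
  then show "(pA [^]\<^bsub>A_ring\<^esub> (2::nat)) \<odot>\<^bsub>Z_mod\<^esub> y = \<zero>\<^bsub>Z_mod\<^esub>"
    using ZM.smult_assoc1[OF pA_closed pA_closed assms] p pA_closed by simp
qed

section \<open>Multiplication by p on R, and the modules pR and R/pR\<close>

lemma R_mod_simps:
  "carrier R_mod = carrier (trunc_ring 2)" "\<zero>\<^bsub>R_mod\<^esub> = \<zero>\<^bsub>trunc_ring 2\<^esub>"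
  "x \<oplus>\<^bsub>R_mod\<^esub> y = x \<oplus>\<^bsub>trunc_ring 2\<^esub> y"
  "f \<in> carrier ZX \<Longrightarrow> g \<in> carrier ZX \<Longrightarrow> cls 3 f \<odot>\<^bsub>R_mod\<^esub> cls 2 g = cls 2 (f \<otimes>\<^bsub>ZX\<^esub> g)"
  by (simp_all add: R_mod_def hom_module_simps R_ring_eq A_to_R_cls cls_mult)

lemma R_mod_p_sq:
  assumes "y \<in> carrier R_mod" shows "(pA [^]\<^bsub>A_ring\<^esub> (2::nat)) \<odot>\<^bsub>R_mod\<^esub> y = \<zero>\<^bsub>R_mod\<^esub>"
proof -
  obtain f where "f \<in> carrier ZX" "y = cls 2 f" using assms unfolding R_mod_simps by (rule cls_cases)
  \<comment> \<open>With k = j = 2 the coefficient condition ranges over no index, so it holds for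
    every class.\<close>
  then show ?thesis by (simp add: pA_sq R_mod_simps xpow_closed xpow_mult_cls_eq_zero_iff)
qed

lemma scaled_pA_R_mod:
  assumes "f \<in> carrier ZX" shows "cls 2 f \<in> scaled pA R_mod \<longleftrightarrow> cf f 0 = 0"
proof -
  have "pA \<odot>\<^bsub>R_mod\<^esub> U = cls 2 (xpow 1) \<otimes>\<^bsub>trunc_ring 2\<^esub> U" if "U \<in> carrier (trunc_ring 2)" for U
    using that by (rule cls_cases) (simp add: pA_eq R_mod_simps xpow_closed cls_mult del: One_nat_def)
  then have "scaled pA R_mod = (\<lambda>U. cls 2 (xpow 1) \<otimes>\<^bsub>trunc_ring 2\<^esub> U) ` carrier (trunc_ring 2)"
    unfolding scaled_def R_mod_simps by (rule image_cong[OF refl])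
  then show ?thesis using xpow_multiples_iff[OF assms, of 1 2] by (simp del: One_nat_def)
qed

lemma scaled_submodule: "submodule (scaled pA R_mod) A_ring R_mod"
  unfolding scaled_def
  by (rule mod_hom_image_submodule[OF R_mod_module R_mod_module mod_hom_smult[OF R_mod_module mod_hom_id pA_closed]])

text \<open>Multiplication by p sends the class of a + b p to that of a p, so its kernel and its
  image both consist of the classes with constant coefficient zero.\<close>

lemma R_mod_p_kernel: "{y \<in> carrier R_mod. pA \<odot>\<^bsub>R_mod\<^esub> y = \<zero>\<^bsub>R_mod\<^esub>} = scaled pA R_mod"
proof (rule Set.set_eqI)
  fix U
  interpret module A_ring R_mod by (rule R_mod_module)
  have "pA \<odot>\<^bsub>R_mod\<^esub> U = \<zero>\<^bsub>R_mod\<^esub> \<longleftrightarrow> U \<in> scaled pA R_mod" if U: "U \<in> carrier R_mod"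
  proof -
    obtain f where f: "f \<in> carrier ZX" "U = cls 2 f" using U unfolding R_mod_simps by (rule cls_cases)
    then show ?thesis
      using xpow_mult_cls_eq_zero_iff[OF f(1), of 2 1]
      by (simp add: scaled_pA_R_mod[unfolded pA_eq] pA_eq R_mod_simps xpow_closed del: One_nat_def)
  qed
  then show "U \<in> {y \<in> carrier R_mod. pA \<odot>\<^bsub>R_mod\<^esub> y = \<zero>\<^bsub>R_mod\<^esub>} \<longleftrightarrow> U \<in> scaled pA R_mod"
    using submoduleE(1)[OF scaled_submodule] by blast
qed

interpretation pR: quotient_module A_ring R_mod "scaled pA R_mod"
  by (rule quotient_module.intro[OF R_mod_module quotient_module_axioms.intro[OF scaled_submodule]])

lemma R_mod_pR_iso: "R_mod_pR \<cong>\<^bsub>A_ring\<^esub> int_mod"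
  unfolding R_mod_pR_def
proof (rule pR.quot_mod_iso[OF int_mod_module])
  show "coef 0 \<in> mod_hom A_ring R_mod int_mod"
    unfolding R_mod_def int_mod_def R_ring_eq
  proof (rule hom_module_hom)
    show "coef 0 \<in> ring_hom (trunc_ring 2) \<Z>" by (rule coef_0_hom) simp
  qed (auto elim!: cls_cases simp: A_ring_eq A_to_R_cls cls_closed A_to_int_eq coef_cls)
  show "coef 0 ` carrier R_mod = carrier int_mod"
  proof -
    have "n \<in> coef 0 ` carrier R_mod" for n
    proof -
      have m: "up_ring.monom ZX n 0 \<in> carrier ZX" by (rule ZX.monom_closed) simp
      then have "coef 0 (cls 2 (up_ring.monom ZX n 0)) = n" by (simp add: coef_cls)
      then show ?thesis unfolding R_mod_simps using cls_closed[OF m] by (metis imageI)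
    qed
    then show ?thesis by (auto simp: int_mod_def hom_module_simps)
  qed
  show "coef 0 y = \<zero>\<^bsub>int_mod\<^esub> \<longleftrightarrow> y \<in> scaled pA R_mod" if "y \<in> carrier R_mod" for y
    using that unfolding R_mod_simps
    by (auto elim!: cls_cases simp: coef_cls scaled_pA_R_mod int_mod_def hom_module_simps)
qed

lemma pR_mod_module: "module A_ring pR_mod"
  unfolding pR_mod_def by (rule submodule.submodule_is_module[OF scaled_submodule R_mod_module])

text \<open>Classes in pR have no constant term, so the linear coefficient alone determines them. It
  is linear over \<open>A_ring\<close> on pR: the linear coefficient of g f is g_0 f_1 + g_1 f_0,
  and f_0 = 0.\<close>

lemma pR_mod_iso: "pR_mod \<cong>\<^bsub>A_ring\<^esub> int_mod"
proof (rule mod_isoI)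
  have rep: "\<exists>f. f \<in> carrier ZX \<and> cf f 0 = 0 \<and> U = cls 2 f" if "U \<in> carrier pR_mod" for U
  proof -
    have "U \<in> carrier (trunc_ring 2)" using that pR.submoduleE(1)[OF scaled_submodule] by (auto simp: pR_mod_def R_mod_simps)
    then obtain f where "f \<in> carrier ZX" "U = cls 2 f" by (rule cls_cases)
    then show ?thesis using that scaled_pA_R_mod by (auto simp: pR_mod_def)
  qed
  show "coef 1 \<in> mod_hom A_ring pR_mod int_mod"
  proof (rule mod_homI)
    fix U V assume "U \<in> carrier pR_mod" "V \<in> carrier pR_mod"
    then obtain f g where "f \<in> carrier ZX" "U = cls 2 f" "g \<in> carrier ZX" "V = cls 2 g"
      using rep by blast
    then show "coef 1 (U \<oplus>\<^bsub>pR_mod\<^esub> V) = coef 1 U \<oplus>\<^bsub>int_mod\<^esub> coef 1 V"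
      by (simp add: pR_mod_def R_mod_simps cls_add coef_cls int_mod_def hom_module_simps)
  next
    fix a U assume "a \<in> carrier A_ring" "U \<in> carrier pR_mod"
    then obtain f g where "f \<in> carrier ZX" "U = cls 2 f" "cf f 0 = 0" "g \<in> carrier ZX" "a = cls 3 g"
      using rep cls_cases unfolding A_ring_eq by metis
    then show "coef 1 (a \<odot>\<^bsub>pR_mod\<^esub> U) = a \<odot>\<^bsub>int_mod\<^esub> coef 1 U"
      by (simp add: pR_mod_def R_mod_simps coef_cls int_mod_def hom_module_simps A_to_int_eq ZX.coeff_mult)
  qed (simp add: int_mod_def hom_module_simps)
  show "bij_betw (coef 1) (carrier pR_mod) (carrier int_mod)"
    unfolding bij_betw_def
  proof
    show "inj_on (coef 1) (carrier pR_mod)"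
    proof (rule inj_onI)
      fix U V assume "U \<in> carrier pR_mod" "V \<in> carrier pR_mod" "coef 1 U = coef 1 V"
      moreover from this obtain f g where "f \<in> carrier ZX" "U = cls 2 f" "cf f 0 = 0"
        "g \<in> carrier ZX" "V = cls 2 g" "cf g 0 = 0"
        using rep by metis
      ultimately show "U = V"
        by (simp add: coef_cls cls_eq_iff less_2_cases_iff)
    qed
    have "n \<in> coef 1 ` carrier pR_mod" for n
    proof -
      have m: "up_ring.monom ZX n 1 \<in> carrier ZX" by (rule ZX.monom_closed) simp
      then have "coef 1 (cls 2 (up_ring.monom ZX n 1)) = n" by (simp add: coef_cls)
      moreover have "cls 2 (up_ring.monom ZX n 1) \<in> carrier pR_mod"
        using scaled_pA_R_mod[OF m] by (simp add: pR_mod_def)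
      ultimately show ?thesis by (metis imageI)
    qed
    then show "coef 1 ` carrier pR_mod = carrier int_mod"
      by (auto simp: int_mod_def hom_module_simps)
  qed
qed

theorem theorem14p3:
  shows "free_resolution A_ring R_mod (\<lambda>n. A_mod)
           (\<lambda>n x. (if even n then pA [^]\<^bsub>A_ring\<^esub> (2::nat) else pA) \<odot>\<^bsub>A_mod\<^esub> x) A_to_R
    \<and> Z_ring \<simeq> \<Z> \<and> Z_mod \<cong>\<^bsub>A_ring\<^esub> int_mod
    \<and> (\<forall>n\<ge>1. Tor n A_ring R_mod Z_mod \<cong>\<^bsub>A_ring\<^esub> int_mod
           \<and> Ext n A_ring R_mod Z_mod \<cong>\<^bsub>A_ring\<^esub> int_mod)
    \<and> R_mod_pR \<cong>\<^bsub>A_ring\<^esub> int_mod \<and> pR_mod \<cong>\<^bsub>A_ring\<^esub> int_mod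
    \<and> (\<forall>j. Tor (2 * j + 1) A_ring R_mod R_mod \<cong>\<^bsub>A_ring\<^esub> R_mod_pR
         \<and> Tor (2 * j + 2) A_ring R_mod R_mod \<cong>\<^bsub>A_ring\<^esub> pR_mod
         \<and> Ext (2 * j + 1) A_ring R_mod R_mod \<cong>\<^bsub>A_ring\<^esub> pR_mod
         \<and> Ext (2 * j + 2) A_ring R_mod R_mod \<cong>\<^bsub>A_ring\<^esub> R_mod_pR)"
proof -
  interpret A: cring A_ring by (rule A_cring)
  \<comment> \<open>The first boundary, with index 0, is p^2, so even indices carry p^2 and odd ones
    p.\<close>
  define c where "c n = (if even n then pA [^]\<^bsub>A_ring\<^esub> (2::nat) else pA)" for n :: nat
  interpret cyclic_resolution A_ring R_mod c A_to_R
  proof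
    show "c n \<in> carrier A_ring" for n by (simp add: c_def pA_closed)
    show "free_resolution A_ring R_mod (\<lambda>n. hom_module (\<lambda>a. a) A_ring)
        (\<lambda>n x. c n \<odot>\<^bsub>hom_module (\<lambda>a. a) A_ring\<^esub> x) A_to_R"
      using periodic_resolution unfolding A_mod_def c_def .
  qed
  have Z: "Z_ring \<simeq> \<Z>" using Z_ring_iso by (metis is_ring_iso_def empty_iff)
  have TorExt_Z: "Tor n A_ring R_mod Z_mod \<cong>\<^bsub>A_ring\<^esub> int_mod \<and> Ext n A_ring R_mod Z_mod \<cong>\<^bsub>A_ring\<^esub> int_mod"
    if "n \<ge> 1" for n
  proof -
    have "c k \<odot>\<^bsub>Z_mod\<^esub> y = \<zero>\<^bsub>Z_mod\<^esub>" if "y \<in> carrier Z_mod" for k y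
      using Z_mod_trivial_action[OF that] by (simp add: c_def)
    from Tor_Ext_trivial_action[OF Z_mod_module int_mod_module Z_mod_iso this, of "n - 1"] that
    show ?thesis by simp
  qed
  have p_sq: "{y \<in> carrier R_mod. (pA [^]\<^bsub>A_ring\<^esub> (2::nat)) \<odot>\<^bsub>R_mod\<^esub> y = \<zero>\<^bsub>R_mod\<^esub>} = carrier R_mod"
    "(\<lambda>y. (pA [^]\<^bsub>A_ring\<^esub> (2::nat)) \<odot>\<^bsub>R_mod\<^esub> y) ` carrier R_mod = {\<zero>\<^bsub>R_mod\<^esub>}"
    using R_mod_p_sq pR.M.zero_closed by (auto simp: image_iff intro!: bexI[of _ "\<zero>\<^bsub>R_mod\<^esub>"])
  have quotient: "(\<lambda>y. scaled pA R_mod +>\<^bsub>R_mod\<^esub> y) \<in> mod_hom A_ring R_mod R_mod_pR"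
    "(\<lambda>y. scaled pA R_mod +>\<^bsub>R_mod\<^esub> y) ` carrier R_mod = carrier R_mod_pR"
    "module A_ring R_mod_pR"
    using pR.coset_hom pR.coset_carrier pR.quot_mod_module
    by (auto simp: R_mod_pR_def elim: pR.coset_cases)
  have quotient_zero: "scaled pA R_mod +>\<^bsub>R_mod\<^esub> y = \<zero>\<^bsub>R_mod_pR\<^esub> \<longleftrightarrow> y \<in> scaled pA R_mod"
    if "y \<in> carrier R_mod" for y
    using that pR.coset_eq_iff[OF that pR.M.zero_closed] pR.M.minus_equality[of "\<zero>\<^bsub>R_mod\<^esub>" "\<zero>\<^bsub>R_mod\<^esub>"]
    by (simp add: R_mod_pR_def pR.coset_zero a_minus_def)
  have simps: "c (2 * j) = pA [^]\<^bsub>A_ring\<^esub> (2::nat)" "c (Suc (2 * j)) = pA"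
    "c (Suc (Suc (2 * j))) = pA [^]\<^bsub>A_ring\<^esub> (2::nat)" for j
    by (simp_all add: c_def)
  \<comment> \<open>\<open>Tor_iso\<close> and \<open>Ext_iso\<close> take \<open>\<theta>\<close>
    on a record with updated carrier; where the kernel is all of \<open>R_mod\<close>, this identity
    removes the update.\<close>
  have R: "R_mod\<lparr>carrier := carrier R_mod\<rparr> = R_mod" by simp
  have pR: "R_mod\<lparr>carrier := scaled pA R_mod\<rparr> = pR_mod" "carrier pR_mod = scaled pA R_mod" "\<zero>\<^bsub>pR_mod\<^esub> = \<zero>\<^bsub>R_mod\<^esub>"
    by (simp_all add: pR_mod_def)
  have sc: "(\<lambda>y. pA \<odot>\<^bsub>R_mod\<^esub> y) ` carrier R_mod = scaled pA R_mod"
    by (simp add: scaled_def)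
  \<comment> \<open>In odd Tor degrees the outgoing boundary is p^2, whose kernel is everything, and
    the incoming one is p, which leaves R/pR. Even Ext degrees give the same pair, since the arrows
    are reversed.\<close>
  have "Tor (Suc (2 * j)) A_ring R_mod R_mod \<cong>\<^bsub>A_ring\<^esub> R_mod_pR" for j
    by (rule Tor_iso[OF R_mod_module quotient(3), where \<theta> = "\<lambda>y. scaled pA R_mod +>\<^bsub>R_mod\<^esub> y"])
       (simp_all only: simps p_sq R sc quotient quotient_zero)
  moreover have "Ext (Suc (Suc (2 * j))) A_ring R_mod R_mod \<cong>\<^bsub>A_ring\<^esub> R_mod_pR" for j
    by (rule Ext_iso[OF R_mod_module quotient(3), where \<theta> = "\<lambda>y. scaled pA R_mod +>\<^bsub>R_mod\<^esub> y"])
       (simp_all only: simps p_sq R sc quotient quotient_zero)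
  \<comment> \<open>In even positive Tor degrees and odd Ext degrees the cycles are the kernel pR of
    p, and the boundaries p^2 R are zero, so the identity serves as \<open>\<theta>\<close>.\<close>
  moreover have "Tor (Suc (Suc (2 * j))) A_ring R_mod R_mod \<cong>\<^bsub>A_ring\<^esub> pR_mod" for j
    by (rule Tor_iso[OF R_mod_module pR_mod_module, where \<theta> = "\<lambda>y. y"])
       (simp_all only: simps p_sq R_mod_p_kernel pR mod_hom_id image_ident singleton_iff)
  moreover have "Ext (Suc (2 * j)) A_ring R_mod R_mod \<cong>\<^bsub>A_ring\<^esub> pR_mod" for j
    by (rule Ext_iso[OF R_mod_module pR_mod_module, where \<theta> = "\<lambda>y. y"])
       (simp_all only: simps p_sq R_mod_p_kernel pR mod_hom_id image_ident singleton_iff)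
  ultimately show ?thesis
    using periodic_resolution Z Z_mod_iso TorExt_Z R_mod_pR_iso pR_mod_iso by simp
qed

end
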